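(* Let $q,z,a,b,h$ be non-zero complex numbers with $|q|<1$, $|z|<1$, let $\sigma\in(0,\infty)$, $w=\mathrm e^{i\psi}$, and suppose $\frac hb\sqrt{\frac{qa}z}\notin\{q^k:k\in\mathbb Z\}$. Assume there are no vanishing denominator factors and that the denominator factors in the integrand have maximum modulus less than unity, i.e. $\big|\sigma b\sqrt{\frac z{qa}}\big|$, $\big|\frac\sigma b\sqrt{\frac{qa}z}\big|$ and $|\gamma|/\sigma$ are $<1$ for each $\gamma\in\big\{b\sqrt{\frac{az}q},\pm\sqrt{az},\frac1b\sqrt{qaz},-\sqrt{qaz}\big\}$. Then $$\int_{-\pi}^{\pi}\frac{\left(\big(\frac hb\sqrt{\frac{qa}z},\frac{qb}h\sqrt{\frac z{qa}}\big)\frac\sigma w,\ \big(\frac hb\sqrt{\frac{qa}z},\frac{qb}h\sqrt{\frac z{qa}},\sqrt{qaz},b\sqrt{\frac{az^3}q},\frac1b\sqrt{qa^3z}\big)\frac w\sigma;q\right)_\infty}{\left(\big(b\sqrt{\frac z{qa}},\frac1b\sqrt{\frac{qa}z}\big)\frac\sigma w,\ \big(b\sqrt{\frac{az}q},\pm\sqrt{az},\frac1b\sqrt{qaz},-\sqrt{qaz}\big)\frac w\sigma;q\right)_\infty}\,\mathrm d\psi$$ $$=\frac{2\pi\,\vartheta(h,h\frac{qa}{b^2z};q)\,(z,\frac{qa}b,\frac{qa}b;q)_\infty}{(q,a,\frac{qa}{b^2},\frac{b^2z}q;q)_\infty}\left({}_2\phi_1\!\left(a,b;\tfrac{qa}b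;q,z\right)\right)^2.$$
   Context: Notation. $(a;q)_k=\prod_{j=0}^{k-1}(1-aq^j)$, $(a;q)_\infty=\prod_{j\ge0}(1-aq^j)$, $(a_1,\dots,a_r;q)_k=\prod_j(a_j;q)_k$ for $k\in\mathbb N_0\cup\{\infty\}$. In a list, $\pm x$ stands for the two entries $x,-x$, and $(x_1,\dots,x_k)t$ stands for the entries $x_1t,\dots,x_kt$. $\vartheta(x;q)=(x,q/x;q)_\infty$ for $x\ne0$, $\vartheta(x_1,\dots,x_k;q)=\prod_j\vartheta(x_j;q)$. ${}_2\phi_1(a,b;c;q,z)=\sum_{k\ge0}\frac{(a,b;q)_k}{(q,c;q)_k}z^k$ for $|z|<1$. Square roots are chosen consistently: fix square roots of $q,a,z$ and define all square roots of monomials multiplicatively from these. Convention "no vanishing denominator factors": every infinite $q$-shifted factorial appearing in a denominator is non-zero, and no denominator parameter of any series lies in $\{q^{-k}:k\in\mathbb N_0\}$. *)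

theory Defs
  imports "HOL-Analysis.Analysis"
begin

definition qpoch :: "complex \<Rightarrow> complex \<Rightarrow> nat \<Rightarrow> complex" where
  "qpoch a q k = (\<Prod>j<k. 1 - a * q ^ j)"

text \<open>The library's \<^const>\<open>prodinf\<close> yields 0 when finitely many factors vanish (the remaining
  product converging), so this is the usual value for every \<open>a\<close> as soon as \<open>\<bar>q\<bar> < 1\<close>.\<close>

definition qpoch_inf :: "complex \<Rightarrow> complex \<Rightarrow> complex" where
  "qpoch_inf a q = (\<Prod>j. 1 - a * q ^ j)"

definition qpochs :: "complex list \<Rightarrow> complex \<Rightarrow> nat \<Rightarrow> complex" where
  "qpochs as q k = (\<Prod>a\<leftarrow>as. qpoch a q k)"

definition qpochs_inf :: "complex list \<Rightarrow> complex \<Rightarrow> complex" where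
  "qpochs_inf as q = (\<Prod>a\<leftarrow>as. qpoch_inf a q)"

text \<open>\<open>times_list [x\<^sub>1, \<dots>, x\<^sub>k] t\<close> stands for the entries written
  \<open>(x\<^sub>1, \<dots>, x\<^sub>k) t\<close> in parameter lists.\<close>

definition times_list :: "complex list \<Rightarrow> complex \<Rightarrow> complex list" where
  "times_list xs t = map (\<lambda>x. x * t) xs"

text \<open>Modified theta function; meaningful for \<open>x \<noteq> 0\<close> only.\<close>

definition qtheta :: "complex \<Rightarrow> complex \<Rightarrow> complex" where
  "qtheta x q = qpochs_inf [x, q / x] q"

definition qthetas :: "complex list \<Rightarrow> complex \<Rightarrow> complex" where
  "qthetas xs q = (\<Prod>x\<leftarrow>xs. qtheta x q)"

text \<open>Basic hypergeometric series \<open>\<^sub>2\<phi>\<^sub>1(a, b; c; q, z)\<close>; meaningful for \<open>\<bar>z\<bar> < 1\<close>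
  and \<open>c \<noteq> q\<^sup>-\<^sup>k\<close> for all natural \<open>k\<close>.\<close>

definition phi21 :: "complex \<Rightarrow> complex \<Rightarrow> complex \<Rightarrow> complex \<Rightarrow> complex \<Rightarrow> complex" where
  "phi21 a b c q z = (\<Sum>k. qpochs [a, b] q k / qpochs [q, c] q k * z ^ k)"

end

theory Submission
  imports Defs "HOL-Complex_Analysis.Complex_Analysis"
begin

text \<open>
  Put \<open>u = w / \<sigma>\<close>, \<open>\<beta> = b (z / (q a))\<^sup>1\<^sup>/\<^sup>2\<close>, \<open>A = (a z)\<^sup>1\<^sup>/\<^sup>2\<close>, \<open>x = b / q\<^sup>1\<^sup>/\<^sup>2\<close>, \<open>H = h / \<beta>\<close> and \<open>s = q\<^sup>1\<^sup>/\<^sup>2\<close>. The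
  integrand becomes \<open>\<theta>(H / u) \<theta>(H u) / (\<beta> / u, 1 / (\<beta> u))\<^sub>\<infinity>\<close> times a function that is holomorphic
  near the disc \<open>\<bar>u\<bar> \<le> 1 / \<sigma>\<close> and invariant under \<open>\<beta> \<mapsto> 1 / \<beta>\<close>. Under \<open>u \<mapsto> q u\<close> the theta
  quotient picks up a factor of order \<open>q\<close>, so the contour can be contracted to the origin and the
  integral is the sum of the residues at \<open>\<beta> q\<^sup>k\<close> and \<open>q\<^sup>k / \<beta>\<close>, that is, of two series exchanged
  by \<open>\<beta> \<mapsto> 1 / \<beta>\<close>. With \<open>p = A \<beta>\<close> and \<open>B = \<beta>\<^sup>2\<close> call them \<open>T x\<close> and \<open>T' x\<close>. They satisfy a
  nonterminating \<open>q\<close>-Clausen formula \<open>T x + T' x = (W x)\<^sup>2\<close>, where \<open>W x\<close> is a \<open>\<^sub>2\<phi>\<^sub>2\<close> that transforms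
  into the \<open>\<^sub>2\<phi>\<^sub>1\<close> of the theorem. For \<open>x = p q\<^sup>n\<close> the series \<open>T' x\<close> vanishes and the formula is the
  terminating \<open>q\<close>-Clausen formula, which follows by induction on \<open>n\<close> from a three-term recurrence
  for \<open>W\<close> and a four-term recurrence for \<open>T\<close>. Hence \<open>T x + T' x - (W x)\<^sup>2\<close> vanishes at all zeros
  of \<open>(p x, p / x, p x / B, p / (B x))\<^sub>\<infinity>\<close>; the quotient is holomorphic for \<open>x \<noteq> 0\<close>, invariant under
  \<open>x \<mapsto> 1 / x\<close> and small on large circles, so it is zero. The countably many values
  of \<open>\<beta>\<close> that this argument excludes are recovered by continuity.
\<close>

subsection \<open>Shifted factorials\<close>

text \<open>The zeros x = p q^n supplied by the terminating formula accumulate only at 0, which lies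
  outside the domain, so the identity theorem cannot finish the nonterminating case. Growth replaces
  it: on suitable circles the difference \<open>D\<close> is at most a multiple of |x|^(-1/2) times
  \<open>prefac\<close>, the product with exactly the known zeros. For this the square is written
  \<open>W x * dual.W x\<close>, since \<open>W\<close> and \<open>dual.W\<close> are each
  controlled by one half of \<open>prefac\<close> only. The exponent 1/2 is a compromise: a positive
  exponent gives the decay, one below 1 keeps the coefficients \<open>ct k\<close>, which are
  O(|q|^k), summable after division. The square of a solution of a second-order recurrence in
  general satisfies one of order three, which explains the four terms for \<open>T\<close>. Both
  recurrences are written in Z = s p X with X = q^n: as \<open>cker\<close> is unchanged under Y to
  1/(p^2 Y), inverting Z exchanges X with q X and X/q with q^2 X. Hence the palindromic shape of
  \<open>clausen_V\<close>.\<close>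

lemma qpoch_0 [simp]: "qpoch a q 0 = 1"
  by (simp add: qpoch_def)

lemma qpoch_Suc: "qpoch a q (Suc k) = qpoch a q k * (1 - a * q ^ k)"
  by (simp add: qpoch_def)

lemma qpoch_add: "qpoch a q (m + k) = qpoch a q m * qpoch (a * q ^ m) q k"
  by (induction k) (simp_all add: qpoch_Suc power_add mult.assoc)

lemma qpoch_Suc_left: "qpoch a q (Suc k) = (1 - a) * qpoch (a * q) q k"
  using qpoch_add[of a q 1 k] by (simp add: qpoch_Suc)

lemma qpoch_eq_0_iff: "qpoch a q k = 0 \<longleftrightarrow> (\<exists>j<k. a * q ^ j = 1)"
  by (auto simp: qpoch_def)

lemma norm_qpower_le_one:
  fixes q :: complex
  assumes "norm q < 1" shows "norm (q ^ k) \<le> 1"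
  using assms by (simp add: norm_power power_le_one)

lemma qpoch_nonzero:
  assumes "norm q < 1" "norm a < 1" shows "qpoch a q k \<noteq> 0"
proof
  assume "qpoch a q k = 0"
  then obtain j where j: "a * q ^ j = 1" by (auto simp: qpoch_eq_0_iff)
  have "norm (a * q ^ j) \<le> norm a * 1"
    unfolding norm_mult by (intro mult_left_mono norm_qpower_le_one assms) auto
  with j assms show False by simp
qed

context
  fixes q :: complex
  assumes q: "norm q < 1"
begin

lemma qpoch_abs_convergent: "abs_convergent_prod (\<lambda>j. 1 - a * q ^ j)"
proof -
  have "summable (\<lambda>j. norm a * norm q ^ j)"
    by (intro summable_mult summable_geometric) (use q in auto)
  thus ?thesis
    unfolding abs_convergent_prod_conv_summable by (simp add: norm_mult norm_power)
qed

lemma qpoch_convergent: "convergent_prod (\<lambda>j. 1 - a * q ^ j)"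
  by (rule abs_convergent_prod_imp_convergent_prod[OF qpoch_abs_convergent])

lemma qpoch_tendsto: "qpoch a q \<longlonglongrightarrow> qpoch_inf a q"
proof -
  have "(\<lambda>n. \<Prod>j\<le>n. 1 - a * q ^ j) \<longlonglongrightarrow> qpoch_inf a q"
    unfolding qpoch_inf_def by (rule convergent_prod_LIMSEQ[OF qpoch_convergent])
  hence "(\<lambda>n. qpoch a q (Suc n)) \<longlonglongrightarrow> qpoch_inf a q"
    by (simp add: qpoch_def lessThan_Suc_atMost)
  thus ?thesis by (rule LIMSEQ_imp_Suc)
qed

lemma qpoch_inf_split: "qpoch_inf a q = qpoch a q k * qpoch_inf (a * q ^ k) q"
proof -
  have "(\<lambda>n. qpoch a q k * qpoch (a * q ^ k) q n) \<longlonglongrightarrow> qpoch a q k * qpoch_inf (a * q ^ k) q"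
    by (intro tendsto_intros qpoch_tendsto)
  moreover have "(\<lambda>n. qpoch a q (n + k)) \<longlonglongrightarrow> qpoch_inf a q"
    by (rule LIMSEQ_ignore_initial_segment[OF qpoch_tendsto])
  moreover have "qpoch a q (n + k) = qpoch a q k * qpoch (a * q ^ k) q n" for n
    by (subst add.commute) (rule qpoch_add)
  ultimately show ?thesis
    using LIMSEQ_unique by simp
qed

lemma qpoch_inf_step: "qpoch_inf a q = (1 - a) * qpoch_inf (a * q) q"
  using qpoch_inf_split[of a 1] by (simp add: qpoch_Suc)

lemma qpoch_inf_0 [simp]: "qpoch_inf 0 q = 1"
  by (simp add: qpoch_inf_def)

lemma qpoch_inf_eq_0_iff: "qpoch_inf a q = 0 \<longleftrightarrow> (\<exists>k. a * q ^ k = 1)"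
proof
  assume "qpoch_inf a q = 0"
  moreover have "(\<lambda>j. 1 - a * q ^ j) has_prod qpoch_inf a q"
    unfolding qpoch_inf_def by (rule convergent_prod_has_prod[OF qpoch_convergent])
  ultimately show "\<exists>k. a * q ^ k = 1"
    using has_prod_eq_0_iff by fastforce
next
  assume "\<exists>k. a * q ^ k = 1"
  then obtain k where "a * q ^ k = 1" by blast
  thus "qpoch_inf a q = 0"
    by (subst qpoch_inf_split[of _ "Suc k"]) (simp add: qpoch_Suc)
qed

lemma qpoch_inf_nonzero:
  assumes "norm a < 1" shows "qpoch_inf a q \<noteq> 0"
proof
  assume "qpoch_inf a q = 0"
  then obtain j where j: "a * q ^ j = 1" by (auto simp: qpoch_inf_eq_0_iff)
  have "norm (a * q ^ j) \<le> norm a * 1"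
    unfolding norm_mult by (intro mult_left_mono norm_qpower_le_one q) auto
  with j assms show False by simp
qed

lemma norm_qpoch_le:
  assumes "norm a \<le> M"
  shows "norm (qpoch a q k) \<le> exp (M / (1 - norm q))"
proof -
  have M: "M \<ge> 0" using assms norm_ge_zero order_trans by blast
  have "norm (qpoch a q k) = (\<Prod>j<k. norm (1 - a * q ^ j))"
    by (simp add: qpoch_def prod_norm)
  also have "\<dots> \<le> (\<Prod>j<k. exp (M * norm q ^ j))"
  proof (intro prod_mono conjI norm_ge_zero)
    fix j
    have "norm (1 - a * q ^ j) \<le> 1 + norm a * norm q ^ j"
      using norm_triangle_ineq4[of 1 "a * q ^ j"] by (simp add: norm_mult norm_power)
    also have "\<dots> \<le> 1 + M * norm q ^ j"
      using assms by (intro add_left_mono mult_right_mono) auto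
    also have "\<dots> \<le> exp (M * norm q ^ j)" by (rule exp_ge_add_one_self)
    finally show "norm (1 - a * q ^ j) \<le> exp (M * norm q ^ j)" .
  qed
  also have "\<dots> = exp (M * (\<Sum>j<k. norm q ^ j))"
    by (simp add: exp_sum sum_distrib_left)
  also have "\<dots> \<le> exp (M / (1 - norm q))"
  proof -
    have "(\<Sum>j<k. norm q ^ j) \<le> (\<Sum>j. norm q ^ j)"
      by (intro sum_le_suminf summable_geometric) (use q in auto)
    hence "M * (\<Sum>j<k. norm q ^ j) \<le> M * (1 / (1 - norm q))"
      using M q by (intro mult_left_mono) (auto simp: suminf_geometric)
    thus ?thesis by simp
  qed
  finally show ?thesis .
qed

lemma norm_qpoch_inf_le:
  assumes "norm a \<le> M"
  shows "norm (qpoch_inf a q) \<le> exp (M / (1 - norm q))"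
  by (rule LIMSEQ_le_const2[OF tendsto_norm[OF qpoch_tendsto]]) (use norm_qpoch_le[OF assms] in auto)

text \<open>Writing the finite products as telescoping sums reduces locally uniform convergence to
  the Weierstrass test: the n-th increment is O(|q|^n) on a closed disc of radius 1.\<close>

lemma qpoch_inf_holomorphic: "(\<lambda>a. qpoch_inf a q) holomorphic_on UNIV"
proof (rule holomorphic_uniform_sequence[of _ "\<lambda>n a. qpoch a q n"])
  fix a :: complex
  let ?C = "exp ((norm a + 1) / (1 - norm q)) * (norm a + 1)"
  have C: "?C \<ge> 0" by simp
  have le: "norm (qpoch b q (Suc n) - qpoch b q n) \<le> ?C * norm q ^ n" if "b \<in> cball a 1" for b n
  proof -
    have b: "norm b \<le> norm a + 1"
      using that norm_triangle_ineq2[of b a] by (simp add: dist_norm norm_minus_commute)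
    have "norm (qpoch b q (Suc n) - qpoch b q n) = norm (qpoch b q n) * (norm b * norm q ^ n)"
      by (simp add: qpoch_Suc algebra_simps norm_mult norm_power)
    also have "\<dots> \<le> exp ((norm a + 1) / (1 - norm q)) * ((norm a + 1) * norm q ^ n)"
      by (intro mult_mono norm_qpoch_le b) auto
    finally show ?thesis by (simp add: mult_ac)
  qed
  have "uniform_limit (cball a 1) (\<lambda>n b. \<Sum>k<n. qpoch b q (Suc k) - qpoch b q k)
           (\<lambda>b. \<Sum>k. qpoch b q (Suc k) - qpoch b q k) sequentially"
    by (rule Weierstrass_m_test[OF le]) (use q in \<open>auto intro!: summable_mult summable_geometric\<close>)
  moreover have "(\<Sum>k<n. qpoch b q (Suc k) - qpoch b q k) = qpoch b q n - 1" for b n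
    by (subst sum_lessThan_telescope) simp
  moreover have "(\<Sum>k. qpoch b q (Suc k) - qpoch b q k) = qpoch_inf b q - 1" for b
    using telescope_sums[OF qpoch_tendsto[of b]] by (simp add: sums_iff)
  ultimately have "uniform_limit (cball a 1) (\<lambda>n b. qpoch b q n - 1) (\<lambda>b. qpoch_inf b q - 1) sequentially"
    by simp
  from uniform_limit_add[OF this uniform_limit_const[where c = "\<lambda>_. 1"]]
  have "uniform_limit (cball a 1) (\<lambda>n b. qpoch b q n) (\<lambda>b. qpoch_inf b q) sequentially"
    by simp
  thus "\<exists>d>0. cball a d \<subseteq> UNIV \<and> uniform_limit (cball a d) (\<lambda>n b. qpoch b q n) (\<lambda>b. qpoch_inf b q) sequentially"
    by (intro exI[of _ 1]) auto
qed (auto simp: qpoch_def intro!: holomorphic_intros)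

lemma holomorphic_on_qpoch_inf [holomorphic_intros]:
  "f holomorphic_on S \<Longrightarrow> (\<lambda>x. qpoch_inf (f x) q) holomorphic_on S"
  using holomorphic_on_compose_gen[OF _ qpoch_inf_holomorphic, of f S] by (simp add: o_def)

lemma continuous_on_qpoch_inf [continuous_intros]:
  fixes f :: "'a :: topological_space \<Rightarrow> complex"
  shows "continuous_on S f \<Longrightarrow> continuous_on S (\<lambda>x. qpoch_inf (f x) q)"
  using continuous_on_compose2[OF holomorphic_on_imp_continuous_on[OF qpoch_inf_holomorphic], of S f] by auto

lemma tendsto_qpoch_inf [tendsto_intros]:
  assumes "(f \<longlongrightarrow> l) F" shows "((\<lambda>x. qpoch_inf (f x) q) \<longlongrightarrow> qpoch_inf l q) F"
proof -
  have "isCont (\<lambda>a. qpoch_inf a q) l"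
    using holomorphic_on_imp_continuous_on[OF qpoch_inf_holomorphic]
    by (simp add: continuous_on_eq_continuous_at)
  thus ?thesis using assms by (rule isCont_tendsto_compose)
qed

lemma holomorphic_on_qpoch [holomorphic_intros]:
  "f holomorphic_on S \<Longrightarrow> (\<lambda>x. qpoch (f x) q k) holomorphic_on S"
  unfolding qpoch_def by (intro holomorphic_intros)

lemma tendsto_q_power: "(\<lambda>n. a * q ^ n) \<longlonglongrightarrow> 0"
  by (intro tendsto_mult_right_zero LIMSEQ_power_zero q)

text \<open>A non-zero limit makes the reciprocals a convergent, hence bounded, sequence. This is
  the uniform control of the denominators in all series below.\<close>

lemma inverse_qpoch_bounded:
  assumes "qpoch_inf a q \<noteq> 0"
  obtains C where "C > 0" "\<And>k. norm (1 / qpoch a q k) \<le> C"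
proof -
  have "(\<lambda>k. 1 / qpoch a q k) \<longlonglongrightarrow> 1 / qpoch_inf a q"
    by (intro tendsto_intros qpoch_tendsto assms)
  hence "Bseq (\<lambda>k. 1 / qpoch a q k)" by (rule convergentI[THEN convergent_imp_Bseq])
  thus ?thesis using that by (elim BseqE) blast
qed

end

lemma holomorphic_on_suminf:
  fixes f :: "nat \<Rightarrow> complex \<Rightarrow> complex"
  assumes hol: "\<And>k. f k holomorphic_on S" and S: "open S"
    and bound: "\<And>x. x \<in> S \<Longrightarrow> \<exists>d>0. \<exists>M. cball x d \<subseteq> S \<and> summable M \<and> (\<forall>k. \<forall>y\<in>cball x d. norm (f k y) \<le> M k)"
  shows "(\<lambda>x. \<Sum>k. f k x) holomorphic_on S"
proof (rule holomorphic_uniform_sequence[OF S])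
  show "(\<lambda>x. \<Sum>k<n. f k x) holomorphic_on S" for n
    by (intro holomorphic_on_sum hol)
next
  fix x assume "x \<in> S"
  then obtain d M where dM: "d > 0" "cball x d \<subseteq> S" "summable M" "\<And>k y. y \<in> cball x d \<Longrightarrow> norm (f k y) \<le> M k"
    using bound[OF \<open>x \<in> S\<close>] by auto
  have "uniform_limit (cball x d) (\<lambda>n x. \<Sum>k<n. f k x) (\<lambda>x. \<Sum>k. f k x) sequentially"
    by (rule Weierstrass_m_test[OF dM(4) dM(3)])
  thus "\<exists>d>0. cball x d \<subseteq> S \<and> uniform_limit (cball x d) (\<lambda>n x. \<Sum>k<n. f k x) (\<lambda>x. \<Sum>k. f k x) sequentially"
    using dM by blast
qed

subsection \<open>From \<open>\<^sub>2\<phi>\<^sub>1\<close> to \<open>\<^sub>2\<phi>\<^sub>2\<close>\<close>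

definition phi22 :: "complex \<Rightarrow> complex \<Rightarrow> complex \<Rightarrow> complex \<Rightarrow> complex \<Rightarrow> complex \<Rightarrow> complex" where
  "phi22 a b c d q t =
     (\<Sum>k. qpochs [a, b] q k / qpochs [q, c, d] q k * (- t) ^ k * q ^ (k choose 2))"

lemma Suc_choose_two: "(Suc k choose 2) = (k choose 2) + k"
  by (simp add: numeral_2_eq_2)

text \<open>The ratio of consecutive terms is c r^k, which tends to 0 however large c is.\<close>

lemma summable_gauss_power:
  fixes c r :: real
  assumes "0 \<le> r" "r < 1" "0 \<le> c"
  shows "summable (\<lambda>k. c ^ k * r ^ (k choose 2))"
proof -
  have "(\<lambda>k. c * r ^ k) \<longlonglongrightarrow> 0"
    by (intro tendsto_mult_right_zero LIMSEQ_power_zero) (use assms in auto)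
  hence "eventually (\<lambda>k. c * r ^ k < 1 / 2) sequentially"
    by (rule order_tendstoD) simp
  then obtain N where N: "\<And>k. k \<ge> N \<Longrightarrow> c * r ^ k < 1 / 2"
    by (auto simp: eventually_sequentially)
  show ?thesis
  proof (rule summable_ratio_test[of "1/2" N])
    fix k assume "k \<ge> N"
    have "norm (c ^ Suc k * r ^ (Suc k choose 2)) = (c * r ^ k) * norm (c ^ k * r ^ (k choose 2))"
      using assms by (simp add: Suc_choose_two power_add abs_mult)
    also have "\<dots> \<le> 1 / 2 * norm (c ^ k * r ^ (k choose 2))"
      using N[OF \<open>k \<ge> N\<close>] by (intro mult_right_mono) auto
    finally show "norm (c ^ Suc k * r ^ (Suc k choose 2)) \<le> 1 / 2 * norm (c ^ k * r ^ (k choose 2))" .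
  qed simp
qed

lemma summable_on_times_nonneg:
  fixes u :: "'a \<Rightarrow> real" and v :: "'b \<Rightarrow> real"
  assumes "u summable_on A" "v summable_on B" "\<And>x. u x \<ge> 0" "\<And>x. v x \<ge> 0"
  shows "(\<lambda>(x, y). u x * v y) summable_on A \<times> B"
proof (rule summable_on_SigmaI)
  show "((\<lambda>y. case (x, y) of (x, y) \<Rightarrow> u x * v y) has_sum u x * infsum v B) B" for x
    using has_sum_cmult_right[OF has_sum_infsum[OF assms(2)], of "u x"] by simp
  show "(\<lambda>x. u x * infsum v B) summable_on A"
    by (intro summable_on_cmult_left assms)
qed (use assms in auto)

lemma infsum_nat_eq_suminf:
  fixes f :: "nat \<Rightarrow> 'a :: {topological_comm_monoid_add, t2_space}"
  assumes "f summable_on UNIV"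
  shows "infsum f UNIV = suminf f"
  using has_sum_imp_sums[OF has_sum_infsum[OF assms]] by (simp add: sums_iff)

context
  fixes q :: complex
  assumes q: "norm q < 1"
begin

lemma qpoch_q_nonzero: "qpoch q q k \<noteq> 0"
  by (rule qpoch_nonzero[OF q q])

lemma qpoch_q_Suc: "qpoch q q (Suc k) = qpoch q q k * (1 - q ^ Suc k)"
  by (simp add: qpoch_Suc)

lemma one_minus_q_power_nonzero: "1 - q ^ Suc k \<noteq> 0"
  using qpoch_q_nonzero[of "Suc k"] unfolding qpoch_q_Suc by auto

section \<open>The q-binomial theorem\<close>

lemma qbinomial_coeff_bounded:
  obtains C where "C > 0" "\<And>n. norm (qpoch a q n / qpoch q q n) \<le> C"
proof -
  obtain C where C: "C > 0" "\<And>k. norm (1 / qpoch q q k) \<le> C"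
    using inverse_qpoch_bounded[OF q qpoch_inf_nonzero[OF q q]] by blast
  have "norm (qpoch a q n / qpoch q q n) \<le> exp (norm a / (1 - norm q)) * C" for n
    using mult_mono[OF norm_qpoch_le[OF q, of a "norm a" n] C(2)[of n]]
    by (simp add: norm_divide)
  thus ?thesis using C(1) by (intro that[of "exp (norm a / (1 - norm q)) * C"]) auto
qed

text \<open>The power series F satisfies (1 - z) F(z) = (1 - a z) F(q z). Iteration pushes the
  argument to 0, where F is continuous with value 1, and the quotient of products appears in the
  limit.\<close>

theorem qbinomial:
  assumes z: "norm z < 1"
  shows "(\<lambda>n. qpoch a q n / qpoch q q n * z ^ n) sums (qpoch_inf (a * z) q / qpoch_inf z q)"
proof -
  define c where "c = (\<lambda>n. qpoch a q n / qpoch q q n)"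
  define F where "F = (\<lambda>z. \<Sum>n. c n * z ^ n)"
  obtain C where C: "\<And>n. norm (c n) \<le> C"
    using qbinomial_coeff_bounded[of a] unfolding c_def by blast
  have summ: "summable (\<lambda>n. c n * z ^ n)" if "norm z < 1" for z
  proof (rule summable_comparison_test')
    show "summable (\<lambda>n. C * norm z ^ n)"
      by (intro summable_mult summable_geometric) (use that in auto)
    show "norm (c n * z ^ n) \<le> C * norm z ^ n" for n
      unfolding norm_mult norm_power by (intro mult_right_mono C) auto
  qed
  have c_Suc: "c (Suc n) * (1 - q ^ Suc n) = c n * (1 - a * q ^ n)" for n
    using one_minus_q_power_nonzero[of n] qpoch_q_nonzero[of n]
    by (simp add: c_def qpoch_Suc[of a] qpoch_q_Suc)
  have F_step: "(1 - z) * F z = (1 - a * z) * F (z * q)" if z: "norm z < 1" for z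
  proof -
    have zq: "norm (z * q) < 1"
      using mult_strict_mono'[of "norm z" 1 "norm q" 1] z q by (simp add: norm_mult)
    have 1: "(\<lambda>n. c n * z ^ n) sums F z" and 2: "(\<lambda>n. c n * (z * q) ^ n) sums F (z * q)"
      using summ[OF z] summ[OF zq] by (simp_all add: F_def summable_sums)
    have "(\<lambda>n. c n * z ^ n - c n * (z * q) ^ n) sums (F z - F (z * q))"
      by (intro sums_diff 1 2)
    hence "(\<lambda>n. c (Suc n) * z ^ Suc n - c (Suc n) * (z * q) ^ Suc n) sums (F z - F (z * q))"
      by (subst sums_Suc_iff) simp
    moreover have "c (Suc n) * z ^ Suc n - c (Suc n) * (z * q) ^ Suc n
        = z * (c n * z ^ n) - a * z * (c n * (z * q) ^ n)" for n
    proof -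
      have "c (Suc n) * z ^ Suc n - c (Suc n) * (z * q) ^ Suc n = (c (Suc n) * (1 - q ^ Suc n)) * z ^ Suc n"
        by (simp add: power_mult_distrib algebra_simps)
      thus ?thesis unfolding c_Suc by (simp add: power_mult_distrib algebra_simps)
    qed
    moreover have "(\<lambda>n. z * (c n * z ^ n) - a * z * (c n * (z * q) ^ n)) sums (z * F z - a * z * F (z * q))"
      by (intro sums_diff sums_mult 1 2)
    ultimately have "F z - F (z * q) = z * F z - a * z * F (z * q)"
      using sums_unique2 by simp
    thus ?thesis by (simp add: algebra_simps)
  qed
  have F_iter: "qpoch z q n * F z = qpoch (a * z) q n * F (z * q ^ n)" for n
  proof (induction n)
    case (Suc n)
    have "norm (z * q ^ n) \<le> norm z * 1"
      unfolding norm_mult by (intro mult_left_mono norm_qpower_le_one q) auto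
    hence "norm (z * q ^ n) < 1" using z by simp
    from F_step[OF this] have "(1 - z * q ^ n) * F (z * q ^ n) = (1 - a * z * q ^ n) * F (z * q ^ Suc n)"
      by (simp add: mult_ac)
    thus ?case using Suc by (simp add: qpoch_Suc) (metis mult.assoc mult.commute)
  qed simp
  have "isCont F 0"
    unfolding F_def by (rule isCont_powser[OF summ[of "1/2"]]) auto
  hence "(\<lambda>n. F (z * q ^ n)) \<longlonglongrightarrow> F 0"
    by (rule isCont_tendsto_compose[OF _ tendsto_q_power[OF q]])
  moreover have "F 0 = 1" unfolding F_def by (subst powser_zero) (simp add: c_def)
  ultimately have "(\<lambda>n. qpoch (a * z) q n * F (z * q ^ n)) \<longlonglongrightarrow> qpoch_inf (a * z) q"
    by (auto intro!: tendsto_eq_intros qpoch_tendsto[OF q])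
  moreover have "(\<lambda>n. qpoch (a * z) q n * F (z * q ^ n)) \<longlonglongrightarrow> qpoch_inf z q * F z"
    unfolding F_iter[symmetric] by (intro tendsto_intros qpoch_tendsto[OF q])
  ultimately have "qpoch_inf z q * F z = qpoch_inf (a * z) q"
    using LIMSEQ_unique by blast
  hence "F z = qpoch_inf (a * z) q / qpoch_inf z q"
    using qpoch_inf_nonzero[OF q z] by (simp add: field_simps)
  thus ?thesis using summable_sums[OF summ[OF z]] by (simp add: F_def c_def)
qed

section \<open>Gaussian binomial coefficients and the q-Chu-Vandermonde sum\<close>

definition qbin :: "nat \<Rightarrow> nat \<Rightarrow> complex" where
  "qbin n k = qpoch q q n / (qpoch q q k * qpoch q q (n - k))"

text \<open>\<open>qbin n k\<close> is the Gaussian binomial coefficient only for k <= n: beyond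
  that the truncated subtraction n - k makes it a non-zero number. The two guards supply the missing
  zeros at k = n + 1 and at k = 0.\<close>

lemma qbin_pascal:
  assumes "k \<le> Suc n"
  shows "qbin (Suc n) k = (if k \<le> n then q ^ k * qbin n k else 0) + (if k = 0 then 0 else qbin n (k - 1))"
proof (cases "k = 0 \<or> k = Suc n")
  case True
  thus ?thesis using qpoch_q_nonzero by (auto simp: qbin_def)
next
  case False
  then obtain j m where k: "k = Suc j" and n: "n = Suc j + m"
    using assms by (metis Suc_leI le_SucE le_add_diff_inverse not0_implies_Suc)
  \<comment> \<open>Splitting the last numerator factor in this way lets each summand cancel one of
    the two last denominator factors.\<close>
  have e: "1 - q ^ Suc n = q ^ k * (1 - q ^ Suc m) + (1 - q ^ Suc j)"
    by (simp add: k n algebra_simps power_add)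
  have "qbin (Suc n) k = qpoch q q n * (1 - q ^ Suc n) / (qpoch q q (Suc j) * qpoch q q (Suc m))"
    by (simp add: qbin_def k n qpoch_q_Suc[of "Suc (j + m)"])
  also have "\<dots> = q ^ k * qbin n k + qbin n (k - 1)"
  proof -
    have *: "N * (x * v + u) / ((J * u) * (M * v)) = x * (N / ((J * u) * M)) + N / (J * (M * v))"
      if "J \<noteq> 0" "M \<noteq> 0" "u \<noteq> 0" "v \<noteq> 0" for N x u v J M :: complex
      using that by (simp add: field_simps)
    have "qbin n k = qpoch q q n / ((qpoch q q j * (1 - q ^ Suc j)) * qpoch q q m)"
      and "qbin n (k - 1) = qpoch q q n / (qpoch q q j * (qpoch q q m * (1 - q ^ Suc m)))"
      by (simp_all add: qbin_def k n qpoch_q_Suc)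
    thus ?thesis
      unfolding e qpoch_q_Suc[of j] qpoch_q_Suc[of m]
      by (simp only: *[OF qpoch_q_nonzero qpoch_q_nonzero one_minus_q_power_nonzero one_minus_q_power_nonzero])
  qed
  finally show ?thesis by (simp add: k n)
qed

text \<open>Pascal's rule in summed form: it lowers n and merges neighbouring terms of f, which is
  what the induction for \<open>qchu_vandermonde\<close> needs.\<close>

lemma sum_qbin_Suc: "(\<Sum>k\<le>Suc n. qbin (Suc n) k * f k) = (\<Sum>k\<le>n. qbin n k * (q ^ k * f k + f (Suc k)))"
proof -
  have "(\<Sum>k\<le>Suc n. qbin (Suc n) k * f k) =
      (\<Sum>k\<le>Suc n. (if k \<le> n then q ^ k * qbin n k else 0) * f k)
      + (\<Sum>k\<le>Suc n. (if k = 0 then 0 else qbin n (k - 1)) * f k)"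
    by (subst sum.distrib[symmetric], rule sum.cong) (auto simp: qbin_pascal distrib_right)
  also have "(\<Sum>k\<le>Suc n. (if k \<le> n then q ^ k * qbin n k else 0) * f k) = (\<Sum>k\<le>n. q ^ k * qbin n k * f k)"
    by simp
  also have "(\<Sum>k\<le>Suc n. (if k = 0 then 0 else qbin n (k - 1)) * f k) = (\<Sum>k\<le>n. qbin n k * f (Suc k))"
    by (subst sum.atMost_Suc_shift) simp
  finally show ?thesis by (simp add: sum.distrib algebra_simps)
qed

text \<open>The \<open>q\<close>-Chu--Vandermonde sum with the denominators cleared.\<close>

lemma qchu_vandermonde:
  "qpoch b q n = (\<Sum>k\<le>n. qbin n k * (qpoch d q k * (- b) ^ k * q ^ (k choose 2) * qpoch (b * d * q ^ k) q (n - k)))"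
proof (induction n arbitrary: b)
  case 0
  thus ?case by (simp add: qbin_def numeral_2_eq_2)
next
  case (Suc n)
  let ?f = "\<lambda>k. qpoch d q k * (- b) ^ k * q ^ (k choose 2) * qpoch (b * d * q ^ k) q (Suc n - k)"
  have "(\<Sum>k\<le>Suc n. qbin (Suc n) k * ?f k) = (\<Sum>k\<le>n. qbin n k * (q ^ k * ?f k + ?f (Suc k)))"
    by (rule sum_qbin_Suc)
  also have "\<dots> = (\<Sum>k\<le>n. (1 - b) * (qbin n k * (qpoch d q k * (- (b * q)) ^ k * q ^ (k choose 2)
      * qpoch (b * q * d * q ^ k) q (n - k))))"
  proof (rule sum.cong[OF refl])
    fix k assume "k \<in> {..n}"
    then obtain m where n: "n = k + m" using le_Suc_ex by auto
    define X where "X = qpoch (b * q * d * q ^ k) q m"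
    have 1: "?f k = qpoch d q k * (- b) ^ k * q ^ (k choose 2) * ((1 - b * d * q ^ k) * X)"
      by (simp add: n Suc_diff_le qpoch_Suc_left X_def mult_ac)
    have 2: "?f (Suc k) = (qpoch d q k * (1 - d * q ^ k)) * (- b * (- b) ^ k) * (q ^ (k choose 2) * q ^ k) * X"
      by (simp add: n Suc_choose_two power_add qpoch_Suc X_def mult_ac)
    have 3: "(- (b * q)) ^ k = (- b) ^ k * q ^ k"
      using power_mult_distrib[of "- b" q k] by simp
    have 4: "qpoch (b * q * d * q ^ k) q (n - k) = X" by (simp add: n X_def)
    \<comment> \<open>The brackets combine as (1 - b d q^k) - b (1 - d q^k) = 1 - b, and the surplus
      power q^k turns b into b q.\<close>
    have "q ^ k * ?f k + ?f (Suc k) = (1 - b) * (qpoch d q k * (- (b * q)) ^ k * q ^ (k choose 2)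
      * qpoch (b * q * d * q ^ k) q (n - k))"
      unfolding 1 2 3 4 by (simp add: algebra_simps)
    thus "qbin n k * (q ^ k * ?f k + ?f (Suc k)) = (1 - b) * (qbin n k * (qpoch d q k * (- (b * q)) ^ k * q ^ (k choose 2)
      * qpoch (b * q * d * q ^ k) q (n - k)))" by (simp only: mult_ac)
  qed
  also have "\<dots> = (1 - b) * qpoch (b * q) q n"
    by (subst Suc.IH[of "b * q"]) (simp add: sum_distrib_left)
  finally show ?case by (simp add: qpoch_Suc_left)
qed

section \<open>Transformation formulas for the basic hypergeometric series\<close>

lemma phi22_term_bound:
  assumes nc: "\<And>k. norm (1 / qpoch c q k) \<le> C1" and ng: "\<And>k. norm (1 / qpoch g q k) \<le> C2"
    and C: "\<And>k. norm (1 / qpoch q q k) \<le> C" and M: "norm a \<le> M" "norm b \<le> M" and N: "norm t \<le> N"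
  shows "norm (qpochs [a, b] q k / qpochs [q, c, g] q k * (- t) ^ k * q ^ (k choose 2))
    \<le> exp (M / (1 - norm q)) * exp (M / (1 - norm q)) * (C * C1 * C2) * (N ^ k * norm q ^ (k choose 2))"
proof -
  have "0 \<le> C" "0 \<le> C1" "0 \<le> C2" "0 \<le> N"
    using order_trans[OF norm_ge_zero C] order_trans[OF norm_ge_zero nc] order_trans[OF norm_ge_zero ng]
      order_trans[OF norm_ge_zero N] by auto
  have "norm (qpochs [a, b] q k / qpochs [q, c, g] q k * (- t) ^ k * q ^ (k choose 2)) =
     norm (qpoch a q k) * norm (qpoch b q k) * (norm (1 / qpoch q q k) * norm (1 / qpoch c q k) * norm (1 / qpoch g q k))
       * (norm t ^ k * norm q ^ (k choose 2))"
    by (simp add: qpochs_def norm_mult norm_divide norm_power)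
  also have "\<dots> \<le> exp (M / (1 - norm q)) * exp (M / (1 - norm q)) * (C * C1 * C2) * (N ^ k * norm q ^ (k choose 2))"
    by (intro mult_mono norm_qpoch_le[OF q] nc ng C M power_mono N order_refl mult_nonneg_nonneg)
      (auto intro!: mult_nonneg_nonneg simp: \<open>0 \<le> C\<close> \<open>0 \<le> C1\<close> \<open>0 \<le> C2\<close> \<open>0 \<le> N\<close>)
  finally show ?thesis .
qed

lemma summable_phi22:
  assumes nc: "qpoch_inf c q \<noteq> 0" and ng: "qpoch_inf g q \<noteq> 0"
  shows "summable (\<lambda>k. qpochs [a, b] q k / qpochs [q, c, g] q k * (- t) ^ k * q ^ (k choose 2))"
proof -
  obtain C1 where C1: "\<And>k. norm (1 / qpoch c q k) \<le> C1"
    using inverse_qpoch_bounded[OF q nc] by blast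
  obtain C2 where C2: "\<And>k. norm (1 / qpoch g q k) \<le> C2"
    using inverse_qpoch_bounded[OF q ng] by blast
  obtain C where C: "\<And>k. norm (1 / qpoch q q k) \<le> C"
    using inverse_qpoch_bounded[OF q qpoch_inf_nonzero[OF q q]] by blast
  define M where "M = max (norm a) (norm b)"
  have M: "norm a \<le> M" "norm b \<le> M" by (auto simp: M_def)
  have "summable (\<lambda>k. norm t ^ k * norm q ^ (k choose 2))"
    by (intro summable_gauss_power) (use q in auto)
  hence "summable (\<lambda>k. exp (M / (1 - norm q)) * exp (M / (1 - norm q)) * (C * C1 * C2) * (norm t ^ k * norm q ^ (k choose 2)))"
    by (rule summable_mult)
  thus ?thesis
    by (rule summable_comparison_test') (rule phi22_term_bound[OF C1 C2 C M order_refl])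
qed

text \<open>Expand \<open>(b)\<^sub>n / (c)\<^sub>n\<close> by the \<open>q\<close>-Chu--Vandermonde sum and sum over \<open>n\<close> with the
  \<open>q\<close>-binomial theorem.\<close>

theorem phi21_eq_phi22:
  assumes z: "norm z < 1" and c: "c = b * d" and nc: "qpoch_inf c q \<noteq> 0" and naz: "qpoch_inf (a * z) q \<noteq> 0"
  shows "phi21 a b c q z = qpoch_inf (a * z) q / qpoch_inf z q * phi22 a d c (a * z) q (b * z)"
proof -
  define w where "w = (\<lambda>k. qpoch d q k / qpoch c q k / qpoch q q k * (- b) ^ k * q ^ (k choose 2))"
  \<comment> \<open>The double series before either summation: k is the Chu-Vandermonde index, n
    that of the 2phi1. It is extended by 0 to n < k so that both indices run over all
    naturals.\<close>
  define f where "f = (\<lambda>k n. if k \<le> n then w k * (qpoch a q n / qpoch q q (n - k)) * z ^ n else 0)"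
  have nck: "qpoch c q k \<noteq> 0" for k
    using nc qpoch_inf_split[OF q, of c k] by auto
  have nazk: "qpoch (a * z) q k \<noteq> 0" for k
    using naz qpoch_inf_split[OF q, of "a * z" k] by auto
  obtain C1 where C1: "C1 > 0" "\<And>k. norm (1 / qpoch c q k) \<le> C1"
    using inverse_qpoch_bounded[OF q nc] by blast
  obtain C2 where C2: "C2 > 0" "\<And>k. norm (1 / qpoch q q k) \<le> C2"
    using inverse_qpoch_bounded[OF q qpoch_inf_nonzero[OF q q]] by blast
  define D where "D = exp (norm d / (1 - norm q)) * C1 * C2"
  define A where "A = exp (norm a / (1 - norm q)) * C2"
  have w_le: "norm (w k) \<le> D * (norm b ^ k * norm q ^ (k choose 2))" for k
  proof -
    have "norm (w k) = norm (qpoch d q k) * norm (1 / qpoch c q k) * norm (1 / qpoch q q k) * (norm b ^ k * norm q ^ (k choose 2))"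
      by (simp add: w_def norm_mult norm_divide norm_power)
    also have "\<dots> \<le> D * (norm b ^ k * norm q ^ (k choose 2))"
      unfolding D_def by (intro mult_right_mono mult_mono norm_qpoch_le[OF q] C1(2) C2(2)) (use C1 C2 in auto)
    finally show ?thesis .
  qed
  \<comment> \<open>The majorant is a product of a series in k, convergent for every b thanks to the
    Gaussian factor, and a geometric series in n. This licenses the exchange of the
    summations.\<close>
  have f_le: "norm (f k n) \<le> D * (norm b ^ k * norm q ^ (k choose 2)) * (A * norm z ^ n)" for k n
  proof (cases "k \<le> n")
    case True
    have "norm (f k n) = norm (w k) * (norm (qpoch a q n) * norm (1 / qpoch q q (n - k)) * norm z ^ n)"
      using True by (simp add: f_def norm_mult norm_divide norm_power)
    also have "\<dots> \<le> D * (norm b ^ k * norm q ^ (k choose 2)) * (A * norm z ^ n)"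
      unfolding A_def by (intro mult_mono w_le norm_qpoch_le[OF q] C2(2)) (use C1 C2 in \<open>auto simp: D_def\<close>)
    finally show ?thesis .
  qed (use C1 C2 in \<open>simp add: f_def D_def A_def\<close>)
  have "summable (\<lambda>k. D * (norm b ^ k * norm q ^ (k choose 2)))"
    by (intro summable_mult summable_gauss_power) (use q in auto)
  hence s1: "(\<lambda>k. D * (norm b ^ k * norm q ^ (k choose 2))) summable_on UNIV"
    by (intro norm_summable_imp_summable_on) (use C1 C2 in \<open>simp add: D_def\<close>)
  have "summable (\<lambda>n. A * norm z ^ n)"
    by (intro summable_mult summable_geometric) (use z in auto)
  hence s2: "(\<lambda>n. A * norm z ^ n) summable_on UNIV"
    by (intro norm_summable_imp_summable_on) (use C2 in \<open>simp add: A_def\<close>)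
  have "(\<lambda>(k, n). D * (norm b ^ k * norm q ^ (k choose 2)) * (A * norm z ^ n)) summable_on UNIV \<times> UNIV"
    by (rule summable_on_times_nonneg[OF s1 s2]) (use C1 C2 in \<open>auto simp: D_def A_def\<close>)
  hence summ: "(\<lambda>(k, n). f k n) summable_on UNIV \<times> UNIV"
    by (rule Infinite_Sum.abs_summable_summable[OF Infinite_Sum.abs_summable_on_comparison_test']) (use f_le in auto)
  have inner: "infsum (f k) UNIV = w k * qpoch a q k * z ^ k * (qpoch_inf (a * z * q ^ k) q / qpoch_inf z q)" for k
  proof -
    have "f k summable_on UNIV"
      using summable_on_SigmaD1[of f UNIV "\<lambda>_. UNIV" k] summ by simp
    hence "infsum (f k) UNIV = suminf (f k)" by (rule infsum_nat_eq_suminf)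
    also have "f k sums (w k * qpoch a q k * z ^ k * (qpoch_inf (a * z * q ^ k) q / qpoch_inf z q))"
    proof (rule iffD1[OF sums_iff_shift'[of _ k]])
      \<comment> \<open>The first k terms vanish. After n is shifted by k, (a)_(n+k) = (a)_k (a
        q^k)_n leaves a q-binomial series with parameter a q^k.\<close>
      have "(\<lambda>n. w k * qpoch a q k * z ^ k * (qpoch (a * q ^ k) q n / qpoch q q n * z ^ n)) sums
          (w k * qpoch a q k * z ^ k * (qpoch_inf (a * q ^ k * z) q / qpoch_inf z q))"
        by (intro sums_mult qbinomial z)
      also have "(\<lambda>n. w k * qpoch a q k * z ^ k * (qpoch (a * q ^ k) q n / qpoch q q n * z ^ n)) = (\<lambda>n. f k (n + k))"
        using qpoch_add[of a q k] by (auto simp: f_def fun_eq_iff power_add add.commute[of _ k])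
      finally show "(\<lambda>n. f k (n + k)) sums (w k * qpoch a q k * z ^ k * (qpoch_inf (a * z * q ^ k) q / qpoch_inf z q) - (\<Sum>n<k. f k n))"
        by (simp add: f_def mult_ac)
    qed
    hence "suminf (f k) = w k * qpoch a q k * z ^ k * (qpoch_inf (a * z * q ^ k) q / qpoch_inf z q)"
      by (simp add: sums_iff)
    finally show ?thesis .
  qed
  have inner': "infsum (\<lambda>k. f k n) UNIV = qpochs [a, b] q n / qpochs [q, c] q n * z ^ n" for n
  proof -
    have "infsum (\<lambda>k. f k n) UNIV = infsum (\<lambda>k. f k n) {..n}"
      by (rule infsum_cong_neutral) (auto simp: f_def)
    also have "\<dots> = (\<Sum>k\<le>n. f k n)" by simp
    also have "\<dots> = (\<Sum>k\<le>n. qbin n k * (qpoch d q k * (- b) ^ k * q ^ (k choose 2) * qpoch (b * d * q ^ k) q (n - k)))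
         * (qpoch a q n / (qpoch q q n * qpoch c q n) * z ^ n)"
      unfolding sum_distrib_right
    proof (rule sum.cong[OF refl])
      fix k assume "k \<in> {..n}"
      hence k: "k \<le> n" by simp
      \<comment> \<open>Here c = b d enters: the tail of (c)_n is the last factor in the
        Chu-Vandermonde summand.\<close>
      have e: "qpoch c q n = qpoch c q k * qpoch (b * d * q ^ k) q (n - k)"
        using qpoch_add[of c q k "n - k"] k by (simp add: c)
      with nck[of n] have "qpoch (b * d * q ^ k) q (n - k) \<noteq> 0" by auto
      thus "f k n = qbin n k * (qpoch d q k * (- b) ^ k * q ^ (k choose 2) * qpoch (b * d * q ^ k) q (n - k))
         * (qpoch a q n / (qpoch q q n * qpoch c q n) * z ^ n)"
        using k qpoch_q_nonzero[of n] by (simp add: f_def w_def qbin_def e mult_ac)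
    qed
    also have "\<dots> = qpoch b q n * (qpoch a q n / (qpoch q q n * qpoch c q n) * z ^ n)"
      by (simp only: qchu_vandermonde[of b n d, symmetric])
    finally show ?thesis by (simp add: qpochs_def)
  qed
  have "(\<lambda>(n, k). f k n) summable_on UNIV \<times> UNIV"
    using summ by (subst summable_on_swap) simp
  hence "(\<lambda>n. infsum (\<lambda>k. f k n) UNIV) summable_on UNIV"
    by (rule summable_on_Sigma_banach)
  from infsum_nat_eq_suminf[OF this]
  have "phi21 a b c q z = infsum (\<lambda>n. infsum (\<lambda>k. f k n) UNIV) UNIV"
    by (simp only: phi21_def inner')
  also have "\<dots> = infsum (\<lambda>k. infsum (f k) UNIV) UNIV"
    by (rule infsum_swap_banach[OF summ, symmetric])
  also have "\<dots> = (\<Sum>k. infsum (f k) UNIV)"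
    by (rule infsum_nat_eq_suminf[OF summable_on_Sigma_banach[OF summ]])
  also have "\<dots> = (\<Sum>k. qpoch_inf (a * z) q / qpoch_inf z q *
      (qpochs [a, d] q k / qpochs [q, c, a * z] q k * (- (b * z)) ^ k * q ^ (k choose 2)))"
  proof (rule suminf_cong)
    fix k
    have bz: "(- (b * z)) ^ k = (- b) ^ k * z ^ k"
      using power_mult_distrib[of "- b" z k] by simp
    show "infsum (f k) UNIV = qpoch_inf (a * z) q / qpoch_inf z q *
      (qpochs [a, d] q k / qpochs [q, c, a * z] q k * (- (b * z)) ^ k * q ^ (k choose 2))"
      unfolding inner bz w_def qpoch_inf_split[OF q, of "a * z" k]
      using nazk[of k] nck[of k] qpoch_q_nonzero[of k] by (simp add: qpochs_def) (simp add: mult_ac)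
  qed
  also have "\<dots> = qpoch_inf (a * z) q / qpoch_inf z q * phi22 a d c (a * z) q (b * z)"
    unfolding phi22_def by (rule suminf_mult[OF summable_phi22[OF nc naz]])
  finally show ?thesis .
qed

lemma phi22_commute: "phi22 a b c g q t = phi22 b a c g q t"
  by (simp add: phi22_def qpochs_def mult_ac)

text \<open>Applying the previous theorem to a \<open>\<^sub>2\<phi>\<^sub>1\<close> of argument \<open>s x\<close> in both orders of its numerator parameters.\<close>

lemma phi22_reflect:
  assumes s: "s ^ 2 = q" and x: "x \<noteq> 0" and \<beta>: "\<beta> \<noteq> 0"
    and A: "norm (A ^ 2) < 1" "norm (s * A * \<beta>) < 1" "norm (s * A / \<beta>) < 1"
  shows "qpoch_inf (s * A / \<beta>) q * phi22 (A * x / \<beta>) (A / (\<beta> * x)) (A ^ 2) (s * A / \<beta>) q (s * A * \<beta>) =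
         qpoch_inf (s * A * \<beta>) q * phi22 (A * \<beta> * x) (A * \<beta> / x) (A ^ 2) (s * A * \<beta>) q (s * A / \<beta>)"
proof -
  have ns: "norm s < 1"
    using q unfolding s[symmetric] norm_power by (metis abs_norm_cancel abs_square_less_1)
  have main: "qpoch_inf (s * A / \<beta>) q * phi22 (A * x / \<beta>) (A / (\<beta> * x)) (A ^ 2) (s * A / \<beta>) q (s * A * \<beta>) =
         qpoch_inf (s * A * \<beta>) q * phi22 (A * \<beta> * x) (A * \<beta> / x) (A ^ 2) (s * A * \<beta>) q (s * A / \<beta>)"
    if x: "x \<noteq> 0" and sx: "norm (s * x) < 1" for x
  proof -
    have "phi21 (A / (\<beta> * x)) (A * \<beta> / x) (A ^ 2) q (s * x) =
       qpoch_inf (s * A / \<beta>) q / qpoch_inf (s * x) q * phi22 (A / (\<beta> * x)) (A * x / \<beta>) (A ^ 2) (s * A / \<beta>) q (s * A * \<beta>)"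
      using phi21_eq_phi22[OF sx, of "A ^ 2" "A * \<beta> / x" "A * x / \<beta>" "A / (\<beta> * x)"] x \<beta>
        qpoch_inf_nonzero[OF q A(1)] qpoch_inf_nonzero[OF q A(3)]
      by (simp add: mult_ac power2_eq_square)
    moreover have "phi21 (A * \<beta> / x) (A / (\<beta> * x)) (A ^ 2) q (s * x) =
       qpoch_inf (s * A * \<beta>) q / qpoch_inf (s * x) q * phi22 (A * \<beta> / x) (A * \<beta> * x) (A ^ 2) (s * A * \<beta>) q (s * A / \<beta>)"
      using phi21_eq_phi22[OF sx, of "A ^ 2" "A / (\<beta> * x)" "A * \<beta> * x" "A * \<beta> / x"] x \<beta>
        qpoch_inf_nonzero[OF q A(1)] qpoch_inf_nonzero[OF q A(2)]
      by (simp add: mult_ac power2_eq_square)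
    moreover have "phi21 (A * \<beta> / x) (A / (\<beta> * x)) (A ^ 2) q (s * x) = phi21 (A / (\<beta> * x)) (A * \<beta> / x) (A ^ 2) q (s * x)"
      by (simp add: phi21_def qpochs_def mult_ac)
    ultimately show ?thesis
      using qpoch_inf_nonzero[OF q sx]
      by (simp add: phi22_commute[of "A / (\<beta> * x)"] phi22_commute[of "A * \<beta> / x"])
  qed
  \<comment> \<open>A 2phi1 of argument s x needs |s x| < 1. For |x| > 1 the point 1 / x is used
    instead: inverting x only swaps the two numerator parameters on each side.\<close>
  show ?thesis
  proof (cases "norm x \<le> 1")
    case True
    have "norm (s * x) \<le> norm s" using True by (simp add: norm_mult mult_left_le)
    thus ?thesis using main[OF x] ns by simp
  next
    case False
    have "norm (s * (1 / x)) \<le> norm s"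
      using False mult_left_mono[of 1 "norm x" "norm s"] x by (simp add: norm_mult norm_divide divide_le_eq)
    hence "norm (s * (1 / x)) < 1" using ns by simp
    have e: "A * (1 / x) / \<beta> = A / (\<beta> * x)" "A / (\<beta> * (1 / x)) = A * x / \<beta>"
      "A * \<beta> * (1 / x) = A * \<beta> / x" "A * \<beta> / (1 / x) = A * \<beta> * x"
      by simp_all
    from main[OF _ \<open>norm (s * (1 / x)) < 1\<close>] x show ?thesis
      unfolding e phi22_commute[of "A / (\<beta> * x)"] phi22_commute[of "A * \<beta> / x"] by simp
  qed
qed

end

subsection \<open>The terminating \<open>q\<close>-Clausen formula\<close>

text \<open>This is the cofactor of \<open>(1 + Z)\<^sup>2\<close> in \<open>clausen_V_eq\<close>.\<close>

definition clausen_V :: "complex \<Rightarrow> complex \<Rightarrow> complex \<Rightarrow> complex \<Rightarrow> complex" where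
  "clausen_V s p B Z = s^4 * p^2 * B * (1 + Z^4)
     + (s^2 * p^2 * B + s^2 * p^4 + s^3 * p^3 + s^3 * p^3 * B + s^4 * p^2 + 2 * s^4 * p^2 * B + s^4 * p^2 * B^2 + s^5 * p*B
        + s^5 * p*B^2 + s^6 * B^2 + s^6 * p^2 * B) * (Z + Z^3)
     - (s * p^3 + s * p^3 * B + 2 * s^2 * p^2 * B + s^2 * p^4 + s^3 * p*B + s^3 * p*B^2 + 2 * s^3 * p^3 + 2 * s^3 * p^3 * B
        + s^4 * p^2 + 2 * s^4 * p^2 * B + s^4 * p^2 * B^2 + 2 * s^5 * p*B + 2 * s^5 * p*B^2 + s^5 * p^3 + s^5 * p^3 * B
        + s^6 * B^2 + 2 * s^6 * p^2 * B + s^7 * p*B + s^7 * p*B^2) * Z^2"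

text \<open>The left-hand side is the common factor of \<phi>0^2 and \<phi>1^2 after the two squared
  three-term relations are combined. Its divisibility by (1 + Z)^2 cancels the factor 1 + Z that
  these relations carry at \<phi>m and at \<phi>2.\<close>

lemma clausen_V_eq:
  "(s+p)^2 * (p+s * B)^2 * Z * (s^2 - Z^2) * (1 - s^2 * Z^2)
     + (Z+s^2) * (1+s^2 * Z) * ((s * B-p * Z) * (s * B*Z-p) * (s-p * Z) * (s * Z-p)) = (1+Z)^2 * clausen_V s p B Z"
  unfolding clausen_V_def by algebra

text \<open>The telescoping identity for the summands of the four-term relation, cleared of
  denominators. With R = p q^k / s^3 the kernel factors are linear in Z and R: 1 - q^k / (q^2 X) =
  (Z - R) / Z and 1 - p^2 X q^k / q = 1 - R Z. Each further shift by q multiplies R by s^2.\<close>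

lemma clausen_certificate_poly:
  fixes s p B Z R :: complex
  defines "T1 \<equiv> s^2 - Z^2" and "T2 \<equiv> 1 - s^2 * Z^2" and "r1 \<equiv> Z + s^2" and "r2 \<equiv> 1 + s^2 * Z"
    and "V \<equiv> clausen_V s p B Z"
  shows "R * (s^2 * V * T1 * r2 * (Z-R) * (Z-s^2 * R) * (1-R * Z) + s^2 * V * T2 * r1 * (Z-R) * (1-R * Z) * (1-s^2 * R*Z)
       - (s^3-p * Z) * (Z-p * s) * (B * Z-p * s) * (s^3 * B-p * Z) * T2 * r2 * (Z-R) * (Z-s^2 * R) * (Z-s^4 * R)
       - (s^3 * Z-p) * (1-p * s*Z) * (B-p * s*Z) * (s^3 * B*Z-p) * T1 * r1 * (1-R * Z) * (1-s^2 * R*Z) * (1-s^4 * R*Z))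
     = (1-Z^2) * T1 * T2 * r1 * r2 * (p^2 * B*(Z-R) * (1-R * Z) * (1-s^6 * R^2) * (1+s^4 * R)
         - Z * (p-s^3 * R) * (p-B * s^3 * R) * (1-s^2 * R) * (1-p * s*R) * (B-p * s*R))"
  unfolding V_def clausen_V_def T1_def T2_def r1_def r2_def by algebra

text \<open>The analogue for the three-term relation, in the same variables Z and R; the last
  bracket is the difference of consecutive certificates divided by their common factor.\<close>

lemma clausen_phi_certificate:
  fixes s p B Z R :: complex
  assumes "s \<noteq> 0" "p \<noteq> 0" "B \<noteq> 0" "Z \<noteq> 0"
  defines "T1 \<equiv> s^2 - Z^2" and "r1 \<equiv> Z + s^2" and "h \<equiv> (s+p) * (p+s * B)"
  shows "Z * (s * B-p * Z) * s*r1 * ((s * Z-p)/(s * Z)) * ((1-R * Z) * (1-s^2 * R*Z)) - h * Z*T1 * ((Z-s^2 * R)/Z * (1-R * Z))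
      - s^2 * (B * Z-p * s) * Z*(1+Z) * ((s^3-p * Z)/s^3) * ((Z-s^2 * R)/Z * ((Z-s^4 * R)/Z))
    = T1 * (1+Z) * r1 * p*B/s * (- (s * p/B) * (s^3 * R/p) * ((Z-s^2 * R)/Z) * (1-R * Z) - (1-s^3 * R/p) * (1-s^2 * R) * ((B-p * s*R)/B))"
  using assms(1-4) unfolding T1_def r1_def h_def
  by (simp add: divide_simps) algebra

text \<open>\<open>clausen_certificate_poly\<close> with the kernel factors restored to the form in
  which the summation produces them; \<kappa> stands for q^k. Multiplication by R clears the
  division by \<kappa>.\<close>

lemma clausen_certificate:
  fixes s p B Z R :: complex
  assumes nz: "s \<noteq> 0" "p \<noteq> 0" "B \<noteq> 0" "Z \<noteq> 0" "R \<noteq> 0"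
  defines "T1 \<equiv> s^2 - Z^2" and "T2 \<equiv> 1 - s^2 * Z^2" and "r1 \<equiv> Z + s^2" and "r2 \<equiv> 1 + s^2 * Z"
    and "V \<equiv> clausen_V s p B Z" and "\<kappa> \<equiv> s^3 * R / p"
  shows "s^2 * V * T1 * r2 * Z^2 * ((Z-R)/Z * ((Z-s^2 * R)/Z) * (1-R * Z))
     + s^2 * V * T2 * r1 * Z * ((Z-R)/Z * ((1-R * Z) * (1-s^2 * R * Z)))
     - (s^3-p * Z) * (Z-p * s) * (B * Z-p * s) * (s^3 * B-p * Z) * T2 * r2 * Z^3 * ((Z-R)/Z * ((Z-s^2 * R)/Z) * ((Z-s^4 * R)/Z))
     - (s^3 * Z-p) * (1-p * s * Z) * (B-p * s * Z) * (s^3 * B * Z-p) * T1 * r1 * ((1-R * Z) * (1-s^2 * R * Z) * (1-s^4 * R * Z))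
     = (1-Z^2) * T1 * T2 * r1 * r2 * p * B * Z * s^3 *
        (((Z-R)/Z * (1-R * Z) * ((1-p * \<kappa>) * (1+p * \<kappa>) * (1+s * p * \<kappa>))
           - (1-\<kappa>) * (1-B * \<kappa>) * (1-s^2 * R) * (1-p * s * R) * ((B-p * s * R)/B)) / \<kappa>)" (is "?L = ?M * p * B * Z * s^3 * (?N / \<kappa>)")
proof -
  have "?L = s^2 * V * T1 * r2 * (Z-R) * (Z-s^2 * R) * (1-R * Z) + s^2 * V * T2 * r1 * (Z-R) * (1-R * Z) * (1-s^2 * R * Z)
       - (s^3-p * Z) * (Z-p * s) * (B * Z-p * s) * (s^3 * B-p * Z) * T2 * r2 * (Z-R) * (Z-s^2 * R) * (Z-s^4 * R)
       - (s^3 * Z-p) * (1-p * s * Z) * (B-p * s * Z) * (s^3 * B * Z-p) * T1 * r1 * (1-R * Z) * (1-s^2 * R * Z) * (1-s^4 * R * Z)"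
    using nz(4) by (simp add: power2_eq_square power3_eq_cube)
  hence 1: "R * ?L = ?M * (p^2 * B * (Z-R) * (1-R * Z) * (1-s^6 * R^2) * (1+s^4 * R)
         - Z * (p-s^3 * R) * (p-B * s^3 * R) * (1-s^2 * R) * (1-p * s * R) * (B-p * s * R))"
    unfolding V_def T1_def T2_def r1_def r2_def by (simp only: clausen_certificate_poly)
  have 2: "p^2 * B * Z * ?N = p^2 * B * (Z-R) * (1-R * Z) * (1-s^6 * R^2) * (1+s^4 * R)
         - Z * (p-s^3 * R) * (p-B * s^3 * R) * (1-s^2 * R) * (1-p * s * R) * (B-p * s * R)"
    unfolding \<kappa>_def using nz by (simp add: divide_simps) algebra
  have "R * (?M * p * B * Z * s^3 * (?N / \<kappa>)) = ?M * (p^2 * B * Z * ?N)"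
    unfolding \<kappa>_def using nz by (simp add: power2_eq_square)
  hence "R * ?L = R * (?M * p * B * Z * s^3 * (?N / \<kappa>))"
    unfolding 1 2 by simp
  thus ?thesis by (rule mult_left_cancel[THEN iffD1, OF nz(5)])
qed

text \<open>In a suitable combination of the squares of the two three-term relations the product
  \<open>\<phi>0 \<phi>1\<close> cancels, and by \<open>clausen_V_eq\<close> what remains is the four-term relation of \<open>S\<close>.\<close>

lemma clausen_induction_step:
  fixes s p B Z \<phi>m \<phi>0 \<phi>1 \<phi>2 Sm S0 S1 S2 g0 g1 g2 :: complex
  defines "T1 \<equiv> s^2 - Z^2" and "T2 \<equiv> 1 - s^2 * Z^2" and "r1 \<equiv> Z + s^2" and "r2 \<equiv> 1 + s^2 * Z"
    and "V \<equiv> clausen_V s p B Z" and "h \<equiv> (s+p) * (p+s * B)"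
  assumes \<phi>1: "Z * (s * B - p * Z) * (s - p * Z) * r1 * \<phi>1 - h * Z * T1 * \<phi>0
      - s^2 * (B * Z - p * s) * (Z - p * s) * (1 + Z) * \<phi>m = 0"
    and \<phi>2: "s^2 * Z * (B - p * s * Z) * (1 - p * s * Z) * (1 + Z) * \<phi>2 - h * Z * T2 * \<phi>1
      - (s * B * Z - p) * (s * Z - p) * r2 * \<phi>0 = 0"
    and S: "s^2 * V * T1 * r2 * Z * (s * Z - p) * S0 + s^2 * V * T2 * r1 * Z * (s - p * Z) * S1
      - s^3 * Z * (Z - p * s)^2 * (B * Z - p * s) * (s^3 * B - p * Z) * T2 * r2 * (s * Z - p) * Sm
      - s^3 * Z * (1 - p * s * Z)^2 * (B - p * s * Z) * (s^3 * B * Z - p) * T1 * r1 * (s - p * Z) * S2 = 0"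
    and g1: "g1 * (s * B - p * Z) * Z = g0 * (s * B * Z - p)"
    and g2: "g2 * (s^3 * Z * (B - p * s * Z)) = g1 * (s^3 * B * Z - p)"
    and IHm: "(Z - p * s) * (g0 * (s^3 * B - p * Z) * Z * Sm) = (Z - p * s) * (s^3 * (B * Z - p * s) * \<phi>m^2)"
    and IH0: "\<phi>0^2 = g0 * S0" and IH1: "\<phi>1^2 = g1 * S1"
    and nz: "s \<noteq> 0" "Z \<noteq> 0" "1 + Z \<noteq> 0" "T1 \<noteq> 0" "r1 \<noteq> 0" "s * B - p * Z \<noteq> 0" "s - p * Z \<noteq> 0"
       "B - p * s * Z \<noteq> 0" "1 - p * s * Z \<noteq> 0"
  shows "\<phi>2^2 = g2 * S2"
proof -
  define F1 F2 G1 D1 a c where "F1 = s * B - p * Z" "F2 = s * B * Z - p" "G1 = s - p * Z" "D1 = s * Z - p"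
    "a = (B * Z - p * s) * (Z - p * s)" "c = (B - p * s * Z) * (1 - p * s * Z)"
  note d = F1_F2_G1_D1_a_c_def
  have V: "h^2 * Z * T1 * T2 + r1 * r2 * (F1 * F2 * G1 * D1) = (1 + Z)^2 * V"
    using clausen_V_eq[of s p B Z] unfolding h_def T1_def T2_def r1_def r2_def V_def d by (simp add: power_mult_distrib)
  have e1: "Z * F1 * G1 * r1 * \<phi>1 - h * Z * T1 * \<phi>0 = s^2 * a * (1 + Z) * \<phi>m"
    using \<phi>1 unfolding d by (simp add: algebra_simps)
  have e2: "s^2 * Z * c * (1 + Z) * \<phi>2 = h * Z * T2 * \<phi>1 + F2 * D1 * r2 * \<phi>0"
    using \<phi>2 unfolding d by (simp add: algebra_simps)
  \<comment> \<open>The weights of the two squares are chosen so that their mixed products \<phi>0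
    \<phi>1 cancel: each weight contains a coefficient of the other relation.\<close>
  have "(1+Z)^2 * (T2 * F2 * D1 * r2 * (s^2 * a * \<phi>m)^2 + T1 * (Z * F1 * G1 * r1) * (s^2 * Z * c * \<phi>2)^2)
      = T2 * F2 * D1 * r2 * (s^2 * a * (1+Z) * \<phi>m)^2 + T1 * (Z * F1 * G1 * r1) * (s^2 * Z * c * (1+Z) * \<phi>2)^2"
    by algebra
  also have "\<dots> = Z * ((h^2 * Z * T1 * T2 + r1 * r2 * (F1 * F2 * G1 * D1)) * (T1 * F2 * D1 * r2 * \<phi>0^2 + T2 * (Z * F1 * G1 * r1) * \<phi>1^2))"
    unfolding e2 e1[symmetric] by algebra
  also have "\<dots> = (1+Z)^2 * (Z * V * (T1 * F2 * D1 * r2 * \<phi>0^2 + T2 * (Z * F1 * G1 * r1) * \<phi>1^2))"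
    unfolding V by algebra
  finally have L: "T2 * F2 * D1 * r2 * (s^2 * a * \<phi>m)^2 + T1 * (Z * F1 * G1 * r1) * (s^2 * Z * c * \<phi>2)^2
      = Z * V * (T1 * F2 * D1 * r2 * \<phi>0^2 + T2 * (Z * F1 * G1 * r1) * \<phi>1^2)"
    using nz(3) by simp
  have S': "s^2 * V * T1 * r2 * Z * D1 * S0 + s^2 * V * T2 * r1 * Z * G1 * S1
      = s^3 * Z * (Z - p * s)^2 * (B * Z - p * s) * (s^3 * B - p * Z) * T2 * r2 * D1 * Sm
      + s^3 * Z * (1 - p * s * Z)^2 * (B - p * s * Z) * (s^3 * B * Z - p) * T1 * r1 * G1 * S2"
    using S unfolding d by (simp only: diff_diff_eq right_minus_eq)
  have g1': "g1 * F1 * Z = g0 * F2" using g1 by (simp add: d)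
  \<comment> \<open>The ratios of g0, g1 and g2 are such that multiplying the relation of S by g0 F2
    turns every S except S2 into a square of \<phi>. Comparison with \<open>L\<close> then isolates
    \<phi>2^2.\<close>
  have "s^2 * (Z * V * (T1 * F2 * D1 * r2 * \<phi>0^2 + T2 * (Z * F1 * G1 * r1) * \<phi>1^2))
     = g0 * F2 * (s^2 * V * T1 * r2 * Z * D1 * S0) + (g1 * F1 * Z) * (s^2 * V * T2 * r1 * Z * G1 * S1)"
    unfolding IH0 IH1 by algebra
  also have "\<dots> = g0 * F2 * (s^2 * V * T1 * r2 * Z * D1 * S0 + s^2 * V * T2 * r1 * Z * G1 * S1)"
    unfolding g1' by algebra
  also have "\<dots> = g0 * F2 * (s^3 * Z * (Z - p * s)^2 * (B * Z - p * s) * (s^3 * B - p * Z) * T2 * r2 * D1 * Sm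
      + s^3 * Z * (1 - p * s * Z)^2 * (B - p * s * Z) * (s^3 * B * Z - p) * T1 * r1 * G1 * S2)"
    unfolding S' by (rule refl)
  also have "\<dots> = (s^3 * F2 * (Z - p * s) * (B * Z - p * s) * T2 * r2 * D1) * ((Z - p * s) * (g0 * (s^3 * B - p * Z) * Z * Sm))
      + (g0 * F2) * (s^3 * Z * (1 - p * s * Z)^2 * (B - p * s * Z) * (s^3 * B * Z - p) * T1 * r1 * G1 * S2)"
    by algebra
  also have "\<dots> = s^2 * (T2 * F2 * D1 * r2 * (s^2 * a * \<phi>m)^2)
     + (s^3 * Z * (1 - p * s * Z)^2 * (B - p * s * Z) * T1 * r1 * G1 * S2 * F1 * Z) * (g1 * (s^3 * B * Z - p))"
    unfolding IHm g1'[symmetric] d(5) by algebra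
  also have "\<dots> = s^2 * (T2 * F2 * D1 * r2 * (s^2 * a * \<phi>m)^2 + T1 * (Z * F1 * G1 * r1) * ((s^2 * Z * c)^2 * (g2 * S2)))"
    unfolding g2[symmetric] d(6) by algebra
  finally have "T1 * (Z * F1 * G1 * r1) * (s^2 * Z * c)^2 * \<phi>2^2 = T1 * (Z * F1 * G1 * r1) * (s^2 * Z * c)^2 * (g2 * S2)"
    unfolding L[symmetric] using nz(1) by (simp add: power_mult_distrib)
  thus ?thesis using nz unfolding d by simp
qed

text \<open>\<open>nB1\<close> and \<open>nB2\<close> say that B is no integral power of q, so that
  the two families of poles are disjoint. The condition p^2 \<noteq> q keeps the multipliers of the
  recurrences non-zero at X = 1.\<close>

locale clausen =
  fixes q s p B :: complex
  assumes q: "norm q < 1" and q0: "q \<noteq> 0" and s: "s ^ 2 = q"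
    and p0: "p \<noteq> 0" and B0: "B \<noteq> 0" and np: "norm p < 1" and nA: "norm (p ^ 2 / B) < 1"
    and nB1: "\<And>j::nat. B * q ^ j \<noteq> 1" and nB2: "\<And>j::nat. q ^ j \<noteq> B" and p2q: "p ^ 2 \<noteq> q"
begin

text \<open>At x = p X this is (p x, p / x)_k, the only part of the summands that depends on x. For
  X = q^n it vanishes beyond k = n.\<close>

definition cker :: "complex \<Rightarrow> nat \<Rightarrow> complex" where
  "cker X k = qpoch (1 / X) q k * qpoch (p ^ 2 * X) q k"

definition ctau :: "nat \<Rightarrow> complex" where
  "ctau k = (- (s * p / B)) ^ k * q ^ (k choose 2) / (qpoch q q k * qpoch (s * p) q k * qpoch (p ^ 2 / B) q k)"

text \<open>Multiplied by \<open>cker\<close>, these are the terms of a balanced 5phi4 of argument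
  q; \<open>ctau\<close> plays the same role for the 2phi2.\<close>

definition ct :: "nat \<Rightarrow> complex" where
  "ct k = q ^ k * (qpoch p q k * qpoch (- p) q k * qpoch (- (s * p)) q k)
     / (qpoch q q k * qpoch (q * B) q k * qpoch (s * p) q k * qpoch (p ^ 2) q k * qpoch (p ^ 2 / B) q k)"

lemma s0: "s \<noteq> 0" using q0 s by auto

lemma ns: "norm s < 1"
  using q unfolding s[symmetric] norm_power by (metis abs_norm_cancel abs_square_less_1)

lemma nsp: "norm (s * p) < 1"
  using mult_strict_mono'[of "norm s" 1 "norm p" 1] ns np by (simp add: norm_mult)

lemma np2: "norm (p ^ 2) < 1"
  using np by (simp add: norm_power power_less_one_iff)

lemma one_minus_nonzero:
  assumes "norm a < 1" shows "1 - a * q ^ k \<noteq> 0"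
proof -
  have "qpoch a q (Suc k) \<noteq> 0" using qpoch_nonzero[OF q assms] .
  thus ?thesis by (auto simp: qpoch_Suc)
qed

section \<open>Term ratios, parameter shifts and the two recurrences\<close>

lemma qpoch_qB_nonzero: "qpoch (q * B) q k \<noteq> 0"
proof
  assume "qpoch (q * B) q k = 0"
  then obtain j where "q * B * q ^ j = 1" by (auto simp: qpoch_eq_0_iff)
  thus False using nB1[of "Suc j"] by (simp add: mult_ac)
qed

lemma qpoch_shift: "(1 - a) * qpoch (a * q) q k = qpoch a q k * (1 - a * q ^ k)"
  by (metis qpoch_Suc qpoch_Suc_left)

text \<open>Shifting a parameter by q trades the first factor 1 - a for a new last factor 1 - a q^k.
  This and its variants express the kernels at neighbouring X as one common product times a
  polynomial in q^k.\<close>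

lemma kernel_chain:
  assumes "a * q = a'" "a' * q = a''"
  shows "(1 - a) * (1 - a') * (qpoch a'' q k * W) = qpoch a q k * W * ((1 - a * q ^ k) * (1 - a' * q ^ k))"
proof -
  have "(1 - a) * (1 - a') * (qpoch a'' q k * W) = (1 - a) * ((1 - a') * qpoch (a' * q) q k) * W"
    using assms by simp
  also have "\<dots> = ((1 - a) * qpoch (a * q) q k) * (1 - a' * q ^ k) * W"
    using assms(1) by (simp only: qpoch_shift) (simp add: mult_ac)
  finally show ?thesis by (simp only: qpoch_shift) (simp add: mult_ac)
qed

lemma kernel_pair:
  assumes "a * q = a'" "c * q = c'"
  shows "(1 - a) * (1 - c) * (qpoch a' q k * qpoch c' q k) = qpoch a q k * qpoch c q k * ((1 - a * q ^ k) * (1 - c * q ^ k))"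
proof -
  have "(1 - a) * (1 - c) * (qpoch a' q k * qpoch c' q k) = ((1 - a) * qpoch (a * q) q k) * ((1 - c) * qpoch (c * q) q k)"
    using assms by simp
  thus ?thesis by (simp only: qpoch_shift) (simp add: mult_ac)
qed

lemma ctau_Suc: "ctau (Suc k) * ((1 - q * q ^ k) * (1 - s * p * q ^ k) * (1 - p ^ 2 / B * q ^ k)) = ctau k * (- (s * p / B) * q ^ k)"
proof -
  have nz: "qpoch q q k \<noteq> 0" "qpoch (s * p) q k \<noteq> 0" "qpoch (p ^ 2 / B) q k \<noteq> 0"
    using qpoch_nonzero[OF q] q nsp nA by auto
  have nz': "1 - q * q ^ k \<noteq> 0" "1 - s * p * q ^ k \<noteq> 0" "1 - p ^ 2 / B * q ^ k \<noteq> 0"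
    by (rule one_minus_nonzero[OF q] one_minus_nonzero[OF nsp] one_minus_nonzero[OF nA])+
  have "x * y * (u * v) / ((a * n1) * (b * n2) * (c * n3)) * (n1 * n2 * n3) = y * u / (a * b * c) * (x * v)"
    if "a \<noteq> 0" "b \<noteq> 0" "c \<noteq> 0" "n1 \<noteq> 0" "n2 \<noteq> 0" "n3 \<noteq> 0" for x y u v a b c n1 n2 n3 :: complex
    using that by (simp add: field_simps)
  from this[OF nz nz'] show ?thesis
    unfolding ctau_def qpoch_Suc Suc_choose_two power_Suc power_add .
qed

lemma ct_Suc: "ct (Suc k) * ((1 - q * q ^ k) * (1 - q * B * q ^ k) * (1 - s * p * q ^ k) * (1 - p ^ 2 * q ^ k) * (1 - p ^ 2 / B * q ^ k))
   = ct k * (q * ((1 - p * q ^ k) * (1 + p * q ^ k) * (1 + s * p * q ^ k)))"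
proof -
  have nz: "qpoch q q k \<noteq> 0" "qpoch (q * B) q k \<noteq> 0" "qpoch (s * p) q k \<noteq> 0" "qpoch (p ^ 2) q k \<noteq> 0" "qpoch (p ^ 2 / B) q k \<noteq> 0"
    using qpoch_nonzero[OF q] q nsp nA np2 qpoch_qB_nonzero by auto
  have nz': "1 - q * q ^ k \<noteq> 0" "1 - q * B * q ^ k \<noteq> 0" "1 - s * p * q ^ k \<noteq> 0" "1 - p ^ 2 * q ^ k \<noteq> 0" "1 - p ^ 2 / B * q ^ k \<noteq> 0"
    using one_minus_nonzero[OF q] one_minus_nonzero[OF nsp] one_minus_nonzero[OF nA] one_minus_nonzero[OF np2]
      qpoch_qB_nonzero[of "Suc k"] unfolding qpoch_Suc mult_eq_0_iff by blast+
  have "x * y * ((u1 * v1) * (u2 * v2) * (u3 * v3)) / ((a * n1) * (b * n2) * (c * n3) * (d * n4) * (e * n5)) * (n1 * n2 * n3 * n4 * n5)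
      = y * (u1 * u2 * u3) / (a * b * c * d * e) * (x * (v1 * v2 * v3))"
    if "a \<noteq> 0" "b \<noteq> 0" "c \<noteq> 0" "d \<noteq> 0" "e \<noteq> 0" "n1 \<noteq> 0" "n2 \<noteq> 0" "n3 \<noteq> 0" "n4 \<noteq> 0" "n5 \<noteq> 0"
    for x y u1 u2 u3 v1 v2 v3 a b c d e n1 n2 n3 n4 n5 :: complex
    using that by (simp add: field_simps)
  from this[OF nz nz', of q "q ^ k" "qpoch p q k" "1 - p * q ^ k" "qpoch (- p) q k" "1 - - p * q ^ k"
      "qpoch (- (s * p)) q k" "1 - - (s * p) * q ^ k"]
  show ?thesis
    unfolding ct_def qpoch_Suc power_Suc by simp
qed

text \<open>After multiplication by d1 e0 the three kernels become multiples of the common product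
  \<open>b\<close>, and \<open>clausen_phi_certificate\<close> telescopes the sum. The hypothesis on
  N says that the sum extends to where \<open>b\<close> has died out.\<close>

lemma clausen_phi_relation:
  fixes X :: complex and N :: nat
  assumes X: "X \<noteq> 0" and X1: "q * X \<noteq> 1" and X2: "p ^ 2 * X \<noteq> q" and N: "qpoch (1 / (q * X)) q (Suc N) = 0"
  defines "Z \<equiv> s * p * X"
  defines "T1 \<equiv> q - Z^2" and "r1 \<equiv> Z + q" and "h \<equiv> (s+p) * (p+s * B)"
  shows "Z * (s * B - p * Z) * (s - p * Z) * r1 * (\<Sum>k\<le>N. cker (q * X) k * ctau k)
     - h * Z * T1 * (\<Sum>k\<le>N. cker X k * ctau k)
     - q * (B * Z - p * s) * (Z - p * s) * (1 + Z) * (\<Sum>k\<le>N. cker (X / q) k * ctau k) = 0"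
proof -
  define b where "b = (\<lambda>k. qpoch (1 / (q * X)) q k * qpoch (p ^ 2 * X / q) q k)"
  define d1 where "d1 = 1 - 1 / (q * X)"
  define e0 where "e0 = 1 - p ^ 2 * X / q"
  \<comment> \<open>the \<open>q\<close>-Zeilberger certificate: the summand of the recurrence is a multiple of \<open>G (k + 1) - G k\<close>\<close>
  define G where "G = (\<lambda>k. b k * ctau k * ((1 - q ^ k) * (1 - s * p / q * q ^ k) * (1 - p ^ 2 / (q * B) * q ^ k)))"
  define C where "C = T1 * (1 + Z) * r1 * p * B / s"
  \<comment> \<open>These are the outer coefficients without the factors 1 - p^2 X = (s - p Z) / s
    and 1 - 1 / X = (Z - p s) / Z, which the kernel shifts absorb.\<close>
  define u where "u = Z * (s * B - p * Z) * s * r1"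
  define v where "v = q * (B * Z - p * s) * Z * (1 + Z)"
  have Z0: "Z \<noteq> 0" using s0 p0 X by (simp add: Z_def)
  have d1: "d1 \<noteq> 0" and e0: "e0 \<noteq> 0" using X X1 X2 q0 by (auto simp: d1_def e0_def divide_simps)
  have q': "q = s ^ 2" using s by simp
  have summand: "d1 * e0 * (u * (1 - p ^ 2 * X) * (cker (q * X) k * ctau k) - h * Z * T1 * (cker X k * ctau k)
      - v * (1 - 1 / X) * (cker (X / q) k * ctau k)) = C * (G (Suc k) - G k)" for k
  proof -
    define R where "R = p * q ^ k / s ^ 3"
    have \<kappa>: "q ^ k = s ^ 3 * R / p" using s0 p0 by (simp add: R_def)
    have Xeq: "X = Z / (s * p)" using s0 p0 by (simp add: Z_def)
    have f1: "1 - 1 / (q * X) * q ^ k = (Z - s ^ 2 * R) / Z"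
      unfolding \<kappa> unfolding Xeq q' using s0 p0 Z0 by (simp add: field_simps eval_nat_numeral)
    have f2: "1 - 1 / X * q ^ k = (Z - s ^ 4 * R) / Z"
      unfolding \<kappa> unfolding Xeq using s0 p0 Z0 by (simp add: field_simps eval_nat_numeral)
    have f3: "1 - p ^ 2 * X / q * q ^ k = 1 - R * Z"
      unfolding \<kappa> unfolding Xeq q' using s0 p0 Z0 by (simp add: field_simps eval_nat_numeral)
    have f4: "1 - p ^ 2 * X * q ^ k = 1 - s ^ 2 * R * Z"
      unfolding \<kappa> unfolding Xeq using s0 p0 Z0 by (simp add: field_simps eval_nat_numeral)
    have f5: "d1 = (s * Z - p) / (s * Z)"
      unfolding d1_def Xeq q' using s0 p0 Z0 by (simp add: field_simps eval_nat_numeral)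
    have f6: "e0 = (s ^ 3 - p * Z) / s ^ 3"
      unfolding e0_def Xeq q' using s0 p0 Z0 by (simp add: field_simps eval_nat_numeral)
    have f7: "1 - s * p / q * q ^ k = 1 - s ^ 2 * R"
      unfolding \<kappa> unfolding q' using s0 p0 Z0 by (simp add: field_simps eval_nat_numeral)
    have f8: "1 - p ^ 2 / (q * B) * q ^ k = (B - p * s * R) / B"
      unfolding \<kappa> unfolding q' using s0 p0 Z0 B0 by (simp add: field_simps eval_nat_numeral)
    have k1: "d1 * (1 - 1 / X) * cker (X / q) k = b k * ((Z - s ^ 2 * R) / Z * ((Z - s ^ 4 * R) / Z))"
      using kernel_chain[of "1 / (q * X)" "1 / X" "q / X" k "qpoch (p ^ 2 * X / q) q k"] q0 X
      unfolding f1[symmetric] f2[symmetric] by (simp add: cker_def b_def d1_def)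
    have k2: "d1 * e0 * cker X k = b k * ((Z - s ^ 2 * R) / Z * (1 - R * Z))"
      using kernel_pair[of "1 / (q * X)" "1 / X" "p ^ 2 * X / q" "p ^ 2 * X" k] q0 X
      unfolding f1[symmetric] f3[symmetric] by (simp add: cker_def b_def d1_def e0_def)
    have k3: "e0 * (1 - p ^ 2 * X) * cker (q * X) k = b k * ((1 - R * Z) * (1 - s ^ 2 * R * Z))"
      using kernel_chain[of "p ^ 2 * X / q" "p ^ 2 * X" "p ^ 2 * X * q" k "qpoch (1 / (q * X)) q k"] q0 X
      unfolding f3[symmetric] f4[symmetric] by (simp add: cker_def b_def e0_def mult_ac)
    have G1: "G (Suc k) = b k * ctau k * (- (s * p / B) * q ^ k * ((Z - s ^ 2 * R) / Z) * (1 - R * Z))"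
    proof -
      have "b (Suc k) = b k * ((1 - 1 / (q * X) * q ^ k) * (1 - p ^ 2 * X / q * q ^ k))"
        by (simp add: b_def qpoch_Suc)
      moreover have "ctau (Suc k) * ((1 - q ^ Suc k) * (1 - s * p / q * q ^ Suc k) * (1 - p ^ 2 / (q * B) * q ^ Suc k))
          = ctau k * (- (s * p / B) * q ^ k)"
        using ctau_Suc[of k] q0 by (simp add: mult.assoc)
      moreover have "G (Suc k) = b (Suc k) * (ctau (Suc k) * ((1 - q ^ Suc k) * (1 - s * p / q * q ^ Suc k) * (1 - p ^ 2 / (q * B) * q ^ Suc k)))"
        by (simp only: G_def mult.assoc)
      ultimately have "G (Suc k) = b k * ((1 - 1 / (q * X) * q ^ k) * (1 - p ^ 2 * X / q * q ^ k)) * (ctau k * (- (s * p / B) * q ^ k))"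
        by (simp only:)
      thus ?thesis unfolding f1 f3 by (simp only: mult_ac)
    qed
    have "d1 * e0 * (u * (1 - p ^ 2 * X) * (cker (q * X) k * ctau k) - h * Z * T1 * (cker X k * ctau k)
      - v * (1 - 1 / X) * (cker (X / q) k * ctau k))
      = (u * d1 * (e0 * (1 - p ^ 2 * X) * cker (q * X) k) - h * Z * T1 * (d1 * e0 * cker X k)
         - v * e0 * (d1 * (1 - 1 / X) * cker (X / q) k)) * ctau k"
      by (simp add: algebra_simps)
    also have "\<dots> = b k * ctau k * (u * d1 * ((1 - R * Z) * (1 - s ^ 2 * R * Z)) - h * Z * T1 * ((Z - s ^ 2 * R) / Z * (1 - R * Z))
         - v * e0 * ((Z - s ^ 2 * R) / Z * ((Z - s ^ 4 * R) / Z)))"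
      unfolding k1 k2 k3 by (simp add: algebra_simps)
    also have "\<dots> = b k * ctau k * (C * (- (s * p/B) * (s^3 * R/p) * ((Z-s^2 * R)/Z) * (1-R * Z) - (1-s^3 * R/p) * (1-s^2 * R) * ((B-p * s*R)/B)))"
      using clausen_phi_certificate[OF s0 p0 B0 Z0, of R]
      unfolding u_def v_def f5 f6 T1_def r1_def h_def C_def q' by (simp only:)
    also have "\<dots> = C * (G (Suc k) - G k)"
      unfolding G1 unfolding G_def unfolding f7 f8 unfolding \<kappa> by (simp add: algebra_simps)
    finally show ?thesis .
  qed
  have "d1 * e0 * (u * (1 - p ^ 2 * X) * (\<Sum>k\<le>N. cker (q * X) k * ctau k) - h * Z * T1 * (\<Sum>k\<le>N. cker X k * ctau k)
      - v * (1 - 1 / X) * (\<Sum>k\<le>N. cker (X / q) k * ctau k)) = (\<Sum>k\<le>N. C * (G (Suc k) - G k))"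
    unfolding summand[symmetric] by (simp only: sum_distrib_left flip: sum_subtractf)
  also have "\<dots> = C * (G (Suc N) - G 0)"
    unfolding sum_distrib_left[symmetric] using sum_lessThan_telescope[of G "Suc N"] by (simp add: lessThan_Suc_atMost)
  \<comment> \<open>\<open>G 0\<close> has the factor 1 - q^0, and \<open>G (Suc N)\<close> has the
    factor \<open>qpoch (1 / (q * X)) q (Suc N)\<close>.\<close>
  also have "\<dots> = 0" using N by (simp add: G_def b_def)
  finally have *: "u * (1 - p ^ 2 * X) * (\<Sum>k\<le>N. cker (q * X) k * ctau k) - h * Z * T1 * (\<Sum>k\<le>N. cker X k * ctau k)
      - v * (1 - 1 / X) * (\<Sum>k\<le>N. cker (X / q) k * ctau k) = 0"
    using d1 e0 by simp
  have "u * (1 - p ^ 2 * X) = Z * (s * B - p * Z) * (s - p * Z) * r1"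
    unfolding u_def Z_def by (simp add: algebra_simps power2_eq_square)
  moreover have "v * (1 - 1 / X) = q * (B * Z - p * s) * (Z - p * s) * (1 + Z)"
    unfolding v_def using X by (simp add: Z_def field_simps)
  ultimately show ?thesis using * by simp
qed

lemma kernel_chain3:
  assumes "a * q = a'" "a' * q = a''" "a'' * q = aa"
  shows "(1 - a) * (1 - a') * (1 - a'') * (qpoch aa q k * W)
    = qpoch a q k * W * ((1 - a * q ^ k) * (1 - a' * q ^ k) * (1 - a'' * q ^ k))"
proof -
  have "(1 - a) * (1 - a') * (1 - a'') * (qpoch aa q k * W)
      = (1 - a) * ((1 - a') * (1 - a'') * (qpoch aa q k * W))" by (simp only: mult.assoc)
  also have "\<dots> = ((1 - a) * qpoch (a * q) q k) * W * ((1 - a' * q ^ k) * (1 - a'' * q ^ k))"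
    unfolding kernel_chain[OF assms(2,3)] using assms(1) by (simp add: mult_ac)
  finally show ?thesis by (simp only: qpoch_shift) (simp add: mult_ac)
qed

lemma kernel_chain_pair:
  assumes "a * q = a'" "a' * q = a''" "c * q = c'"
  shows "(1 - a) * (1 - a') * (1 - c) * (qpoch a'' q k * qpoch c' q k)
    = qpoch a q k * qpoch c q k * ((1 - a * q ^ k) * (1 - a' * q ^ k) * (1 - c * q ^ k))"
proof -
  have "(1 - a) * (1 - a') * (1 - c) * (qpoch a'' q k * qpoch c' q k)
      = (1 - a) * (1 - a') * (qpoch a'' q k * ((1 - c) * qpoch (c * q) q k))" using assms(3) by (simp only: mult_ac)
  also have "\<dots> = qpoch a q k * ((1 - c) * qpoch (c * q) q k) * ((1 - a * q ^ k) * (1 - a' * q ^ k))"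
    by (rule kernel_chain[OF assms(1,2)])
  finally show ?thesis by (simp only: qpoch_shift) (simp add: mult_ac)
qed

text \<open>The same telescoping one order higher: \<open>b\<close> starts at 1 / (q^2 X), so that
  four kernels are multiples of it, and the certificate is divided by q^k to absorb the argument q
  of the 5phi4.\<close>

lemma clausen_s_relation:
  fixes X :: complex and N :: nat
  assumes X: "X \<noteq> 0" and X1: "q ^ 2 * X \<noteq> 1" and X2: "p ^ 2 * X \<noteq> q" and N: "qpoch (1 / (q ^ 2 * X)) q (Suc N) = 0"
  defines "Z \<equiv> s * p * X"
  defines "T1 \<equiv> s^2 - Z^2" and "T2 \<equiv> 1 - s^2 * Z^2" and "r1 \<equiv> Z + s^2" and "r2 \<equiv> 1 + s^2 * Z"
    and "V \<equiv> clausen_V s p B Z"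
  defines "S \<equiv> \<lambda>Y. \<Sum>k\<le>N. cker Y k * ct k"
  shows "s^2 * V * T1 * r2 * Z * (s * Z - p) * S X + s^2 * V * T2 * r1 * Z * (s - p * Z) * S (q * X)
      - s^3 * Z * (Z - p * s)^2 * (B * Z - p * s) * (s^3 * B - p * Z) * T2 * r2 * (s * Z - p) * S (X / q)
      - s^3 * Z * (1 - p * s * Z)^2 * (B - p * s * Z) * (s^3 * B * Z - p) * T1 * r1 * (s - p * Z) * S (q ^ 2 * X) = 0"
proof -
  define b where "b = (\<lambda>k. qpoch (1 / (q ^ 2 * X)) q k * qpoch (p ^ 2 * X / q) q k)"
  define d0 where "d0 = 1 - 1 / (q ^ 2 * X)"
  define d1 where "d1 = 1 - 1 / (q * X)"
  define d2 where "d2 = 1 - 1 / X"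
  define e0 where "e0 = 1 - p ^ 2 * X / q"
  define e1 where "e1 = 1 - p ^ 2 * X"
  define e2 where "e2 = 1 - p ^ 2 * X * q"
  define G where "G = (\<lambda>k. b k * ct k * ((1 - q ^ k) * (1 - B * q ^ k) * (1 - s * p / q * q ^ k) * (1 - p ^ 2 / q * q ^ k)
     * (1 - p ^ 2 / (q * B) * q ^ k)) / q ^ k)"
  define C where "C = (1-Z^2) * T1 * T2 * r1 * r2 * p * B * Z * s^3"
  define c0 where "c0 = s^2 * V * T1 * r2 * Z^2"
  define c1 where "c1 = s^2 * V * T2 * r1 * Z"
  define cm where "cm = s^3 * (Z-p * s) * (B * Z-p * s) * (s^3 * B-p * Z) * T2 * r2 * Z^3"
  define c2 where "c2 = s^3 * Z * (1-p * s * Z) * (B-p * s * Z) * (s^3 * B * Z-p) * T1 * r1"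
  have Z0: "Z \<noteq> 0" using s0 p0 X by (simp add: Z_def)
  have d0: "d0 \<noteq> 0" and e0: "e0 \<noteq> 0" using X X1 X2 q0 by (auto simp: d0_def e0_def divide_simps)
  have q': "q = s ^ 2" using s by simp
  have Xeq: "X = Z / (s * p)" using s0 p0 by (simp add: Z_def)
  have z: "d0 = (s^3 * Z - p) / (s^3 * Z)" "d1 = (s * Z - p) / (s * Z)" "d2 = (Z - p * s) / Z"
    "e0 = (s ^ 3 - p * Z) / s ^ 3" "e1 = (s - p * Z) / s" "e2 = 1 - p * s * Z"
    unfolding d0_def d1_def d2_def e0_def e1_def e2_def Xeq q' using s0 p0 Z0 by (simp_all add: field_simps eval_nat_numeral)
  have summand: "d0 * e0 * (c0 * d1 * (cker X k * ct k) + c1 * e1 * (cker (q * X) k * ct k)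
      - cm * d1 * d2 * (cker (X / q) k * ct k) - c2 * e1 * e2 * (cker (q ^ 2 * X) k * ct k)) = C * (G (Suc k) - G k)" for k
  proof -
    define R where "R = p * q ^ k / s ^ 3"
    have R0: "R \<noteq> 0" using p0 s0 q0 by (simp add: R_def)
    have \<kappa>: "q ^ k = s ^ 3 * R / p" using s0 p0 by (simp add: R_def)
    have f0: "1 - 1 / (q ^ 2 * X) * q ^ k = (Z - R) / Z"
      unfolding \<kappa> unfolding Xeq q' using s0 p0 Z0 by (simp add: field_simps eval_nat_numeral)
    have f1: "1 - 1 / (q * X) * q ^ k = (Z - s ^ 2 * R) / Z"
      unfolding \<kappa> unfolding Xeq q' using s0 p0 Z0 by (simp add: field_simps eval_nat_numeral)
    have f2: "1 - 1 / X * q ^ k = (Z - s ^ 4 * R) / Z"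
      unfolding \<kappa> unfolding Xeq using s0 p0 Z0 by (simp add: field_simps eval_nat_numeral)
    have f3: "1 - p ^ 2 * X / q * q ^ k = 1 - R * Z"
      unfolding \<kappa> unfolding Xeq q' using s0 p0 Z0 by (simp add: field_simps eval_nat_numeral)
    have f4: "1 - p ^ 2 * X * q ^ k = 1 - s ^ 2 * R * Z"
      unfolding \<kappa> unfolding Xeq using s0 p0 Z0 by (simp add: field_simps eval_nat_numeral)
    have f5: "1 - p ^ 2 * X * q * q ^ k = 1 - s ^ 4 * R * Z"
      unfolding \<kappa> unfolding Xeq q' using s0 p0 Z0 by (simp add: field_simps eval_nat_numeral)
    have f7: "1 - s * p / q * q ^ k = 1 - s ^ 2 * R"
      unfolding \<kappa> unfolding q' using s0 p0 Z0 by (simp add: field_simps eval_nat_numeral)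
    have f8: "1 - p ^ 2 / q * q ^ k = 1 - p * s * R"
      unfolding \<kappa> unfolding q' using s0 p0 Z0 B0 by (simp add: field_simps eval_nat_numeral)
    have f9: "1 - p ^ 2 / (q * B) * q ^ k = (B - p * s * R) / B"
      unfolding \<kappa> unfolding q' using s0 p0 Z0 B0 by (simp add: field_simps eval_nat_numeral)
    have k1: "d0 * d1 * d2 * cker (X / q) k = b k * ((Z - R) / Z * ((Z - s ^ 2 * R) / Z) * ((Z - s ^ 4 * R) / Z))"
      using kernel_chain3[of "1 / (q ^ 2 * X)" "1 / (q * X)" "1 / X" "q / X" k "qpoch (p ^ 2 * X / q) q k"] q0 X
      unfolding f0[symmetric] f1[symmetric] f2[symmetric] by (simp add: cker_def b_def d0_def d1_def d2_def power2_eq_square)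
    have k2: "d0 * d1 * e0 * cker X k = b k * ((Z - R) / Z * ((Z - s ^ 2 * R) / Z) * (1 - R * Z))"
      using kernel_chain_pair[of "1 / (q ^ 2 * X)" "1 / (q * X)" "1 / X" "p ^ 2 * X / q" "p ^ 2 * X" k] q0 X
      unfolding f0[symmetric] f1[symmetric] f3[symmetric]
      by (simp add: cker_def b_def d0_def d1_def e0_def power2_eq_square)
    have k3: "e0 * e1 * d0 * cker (q * X) k = b k * ((1 - R * Z) * (1 - s ^ 2 * R * Z) * ((Z - R) / Z))"
      using kernel_chain_pair[of "p ^ 2 * X / q" "p ^ 2 * X" "p ^ 2 * X * q" "1 / (q ^ 2 * X)" "1 / (q * X)" k] q0 X
      unfolding f0[symmetric] f3[symmetric] f4[symmetric]
      by (simp add: cker_def b_def d0_def e0_def e1_def power2_eq_square mult_ac)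
    have k4: "e0 * e1 * e2 * cker (q ^ 2 * X) k = b k * ((1 - R * Z) * (1 - s ^ 2 * R * Z) * (1 - s ^ 4 * R * Z))"
      using kernel_chain3[of "p ^ 2 * X / q" "p ^ 2 * X" "p ^ 2 * X * q" "p ^ 2 * X * q * q" k "qpoch (1 / (q ^ 2 * X)) q k"] q0 X
      unfolding f3[symmetric] f4[symmetric] f5[symmetric]
      by (simp add: cker_def b_def e0_def e1_def e2_def power2_eq_square mult_ac)
    have G1: "G (Suc k) = b k * ct k * ((Z - R) / Z * (1 - R * Z) * ((1 - p * q ^ k) * (1 + p * q ^ k) * (1 + s * p * q ^ k))) / q ^ k"
    proof -
      have "b (Suc k) = b k * ((1 - 1 / (q ^ 2 * X) * q ^ k) * (1 - p ^ 2 * X / q * q ^ k))"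
        by (simp add: b_def qpoch_Suc)
      moreover have "ct (Suc k) * ((1 - q ^ Suc k) * (1 - B * q ^ Suc k) * (1 - s * p / q * q ^ Suc k) * (1 - p ^ 2 / q * q ^ Suc k) * (1 - p ^ 2 / (q * B) * q ^ Suc k))
          = ct k * (q * ((1 - p * q ^ k) * (1 + p * q ^ k) * (1 + s * p * q ^ k)))"
        using ct_Suc[of k] q0 by (simp add: mult_ac)
      moreover have "G (Suc k) = b (Suc k) * (ct (Suc k) * ((1 - q ^ Suc k) * (1 - B * q ^ Suc k) * (1 - s * p / q * q ^ Suc k) * (1 - p ^ 2 / q * q ^ Suc k) * (1 - p ^ 2 / (q * B) * q ^ Suc k))) / (q * q ^ k)"
        by (simp only: G_def mult.assoc power_Suc)
      ultimately have "G (Suc k) = b k * ((1 - 1 / (q ^ 2 * X) * q ^ k) * (1 - p ^ 2 * X / q * q ^ k)) *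
          (ct k * (q * ((1 - p * q ^ k) * (1 + p * q ^ k) * (1 + s * p * q ^ k)))) / (q * q ^ k)"
        by (simp only:)
      thus ?thesis unfolding f0 f3 using q0 by simp
    qed
    have G0: "G k = b k * ct k * ((1-q ^ k) * (1-B * q ^ k) * (1-s^2 * R) * (1-p * s * R) * ((B-p * s * R)/B)) / q ^ k"
      unfolding G_def f7 f8 f9 by (rule refl)
    have "d0 * e0 * (c0 * d1 * (cker X k * ct k) + c1 * e1 * (cker (q * X) k * ct k)
      - cm * d1 * d2 * (cker (X / q) k * ct k) - c2 * e1 * e2 * (cker (q ^ 2 * X) k * ct k))
      = (c0 * (d0 * d1 * e0 * cker X k) + c1 * (e0 * e1 * d0 * cker (q * X) k)
          - cm * e0 * (d0 * d1 * d2 * cker (X / q) k) - c2 * d0 * (e0 * e1 * e2 * cker (q ^ 2 * X) k)) * ct k"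
      by (simp add: algebra_simps)
    also have "\<dots> = b k * ct k * (c0 * ((Z-R)/Z * ((Z-s^2 * R)/Z) * (1-R * Z))
       + c1 * ((Z-R)/Z * ((1-R * Z) * (1-s^2 * R * Z)))
       - cm * e0 * ((Z-R)/Z * ((Z-s^2 * R)/Z) * ((Z-s^4 * R)/Z))
       - c2 * d0 * ((1-R * Z) * (1-s^2 * R * Z) * (1-s^4 * R * Z)))"
      unfolding k1 k2 k3 k4 by (simp add: algebra_simps)
    also have "cm * e0 = (s^3-p * Z) * (Z-p * s) * (B * Z-p * s) * (s^3 * B-p * Z) * T2 * r2 * Z^3"
      unfolding cm_def z using s0 by simp
    also have "c2 * d0 = (s^3 * Z-p) * (1-p * s * Z) * (B-p * s * Z) * (s^3 * B * Z-p) * T1 * r1"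
      unfolding c2_def z using s0 Z0 by simp
    also have "b k * ct k * (c0 * ((Z-R)/Z * ((Z-s^2 * R)/Z) * (1-R * Z))
       + c1 * ((Z-R)/Z * ((1-R * Z) * (1-s^2 * R * Z)))
       - (s^3-p * Z) * (Z-p * s) * (B * Z-p * s) * (s^3 * B-p * Z) * T2 * r2 * Z^3 * ((Z-R)/Z * ((Z-s^2 * R)/Z) * ((Z-s^4 * R)/Z))
       - (s^3 * Z-p) * (1-p * s * Z) * (B-p * s * Z) * (s^3 * B * Z-p) * T1 * r1 * ((1-R * Z) * (1-s^2 * R * Z) * (1-s^4 * R * Z)))
      = b k * ct k * (C * (((Z-R)/Z * (1-R * Z) * ((1-p * q ^ k) * (1+p * q ^ k) * (1+s * p * q ^ k))
           - (1-q ^ k) * (1-B * q ^ k) * (1-s^2 * R) * (1-p * s * R) * ((B-p * s * R)/B)) / q ^ k))"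
      unfolding \<kappa> c0_def c1_def C_def T1_def T2_def r1_def r2_def V_def
      by (simp only: clausen_certificate[OF s0 p0 B0 Z0 R0])
    also have "\<dots> = C * (G (Suc k) - G k)"
    proof -
      have *: "y * (C * ((A - E) / k)) = C * (y * A / k - y * E / k)" for y C A E k :: complex
        by (simp add: diff_divide_distrib right_diff_distrib mult_ac)
      show ?thesis unfolding G0 G1 by (rule *)
    qed
    finally show ?thesis .
  qed
  have "d0 * e0 * (c0 * d1 * S X + c1 * e1 * S (q * X) - cm * d1 * d2 * S (X / q) - c2 * e1 * e2 * S (q ^ 2 * X))
     = (\<Sum>k\<le>N. C * (G (Suc k) - G k))"
    unfolding summand[symmetric] S_def by (simp only: sum_distrib_left flip: sum_subtractf sum.distrib)
  also have "\<dots> = C * (G (Suc N) - G 0)"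
    unfolding sum_distrib_left[symmetric] using sum_lessThan_telescope[of G "Suc N"] by (simp add: lessThan_Suc_atMost)
  also have "\<dots> = 0" using N by (simp add: G_def b_def)
  finally have *: "s * (c0 * d1 * S X + c1 * e1 * S (q * X) - cm * d1 * d2 * S (X / q) - c2 * e1 * e2 * S (q ^ 2 * X)) = 0"
    using d0 e0 by simp
  have "s * (c0 * d1) = s^2 * V * T1 * r2 * Z * (s * Z - p)" "s * (c1 * e1) = s^2 * V * T2 * r1 * Z * (s - p * Z)"
    "s * (cm * d1 * d2) = s^3 * Z * (Z - p * s)^2 * (B * Z - p * s) * (s^3 * B - p * Z) * T2 * r2 * (s * Z - p)"
    "s * (c2 * e1 * e2) = s^3 * Z * (1 - p * s * Z)^2 * (B - p * s * Z) * (s^3 * B * Z - p) * T1 * r1 * (s - p * Z)"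
    unfolding c0_def c1_def cm_def c2_def z using s0 Z0 by (simp_all add: power2_eq_square power3_eq_cube)
  thus ?thesis using * by (simp add: right_diff_distrib distrib_left flip: mult.assoc)
qed

section \<open>Terminating values and the induction on n\<close>

definition cphi :: "nat \<Rightarrow> complex" where
  "cphi n = (\<Sum>k\<le>n. cker (q ^ n) k * ctau k)"

definition cs :: "nat \<Rightarrow> complex" where
  "cs n = (\<Sum>k\<le>n. cker (q ^ n) k * ct k)"

text \<open>Up to the constant (1 / B, p^2 / B)_inf this is the value at x = p q^n of (p x / B, p /
  (B x))_inf, the product that \<open>T\<close> carries beside its series.\<close>

definition cg :: "nat \<Rightarrow> complex" where
  "cg n = qpoch (1 / (B * q ^ n)) q n / qpoch (p ^ 2 / B) q n"

lemma qpoch_inverse_power_eq_0: "n < k \<Longrightarrow> qpoch (1 / q ^ n) q k = 0"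
  using q0 by (auto simp: qpoch_eq_0_iff)

text \<open>Neighbouring values of n can thus be summed over one common range, as the recurrences
  require.\<close>

lemma cker_sum_extend:
  assumes "n \<le> N" shows "(\<Sum>k\<le>N. cker (q ^ n) k * f k) = (\<Sum>k\<le>n. cker (q ^ n) k * f k)"
  by (rule sum.mono_neutral_right) (use assms in \<open>auto simp: cker_def qpoch_inverse_power_eq_0\<close>)

lemma cg_Suc: "cg (Suc n) * (1 - p ^ 2 / B * q ^ n) = cg n * (1 - 1 / (B * q ^ Suc n))"
proof -
  have nz: "qpoch (p ^ 2 / B) q n \<noteq> 0" "1 - p ^ 2 / B * q ^ n \<noteq> 0"
    using qpoch_nonzero[OF q nA] one_minus_nonzero[OF nA] by auto
  have "qpoch (1 / (B * q ^ Suc n)) q (Suc n) = (1 - 1 / (B * q ^ Suc n)) * qpoch (1 / (B * q ^ n)) q n"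
    using q0 by (subst qpoch_Suc_left) simp
  thus ?thesis using nz by (simp add: cg_def qpoch_Suc[of "p ^ 2 / B"])
qed

lemma q_power_not_one: "q ^ Suc k \<noteq> 1"
  using one_minus_q_power_nonzero[OF q, of k] by auto

lemma p2_power: "p ^ 2 * q ^ k \<noteq> q"
proof (cases k)
  case (Suc j)
  thus ?thesis using one_minus_nonzero[OF np2, of j] q0 by auto
qed (use p2q in simp)

lemma choose_two_small: "(0 choose 2) = 0" "(Suc 0 choose 2) = 0"
  by (simp_all add: numeral_2_eq_2)

text \<open>The induction step reaches n + 2 from n and n + 1, so this second starting value is
  computed directly.\<close>

lemma clausen_first: "cphi 1 ^ 2 = cg 1 * cs 1"
proof -
  have n: "1 - q \<noteq> 0" "1 - s * p \<noteq> 0" "1 - p^2 \<noteq> 0" "1 - q * B \<noteq> 0" "1 - p ^ 2 / B \<noteq> 0" "1 - p ^ 2 * q \<noteq> 0"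
    using one_minus_nonzero[OF q, of 0] one_minus_nonzero[OF nsp, of 0] one_minus_nonzero[OF nA, of 0]
      one_minus_nonzero[OF np2, of 0] one_minus_nonzero[OF np2, of 1] nB1[of 1] by (auto simp: mult.commute)
  have nBp: "B - p ^ 2 \<noteq> 0" using n(5) B0 by (auto simp: divide_simps)
  have s2: "q = s ^ 2" using s by simp
  have "s ^ 2 * p ^ 2 \<noteq> 1" using n(6) s2 by (auto simp: mult.commute)
  hence nsp': "1 + s * p \<noteq> 0"
    by (metis add.commute add_eq_0_iff2 mult_minus1_right power_mult_distrib power2_minus power_one)
  have e: "1 - p ^ 2 * q = (1 - s * p) * (1 + s * p)" "1 - p ^ 2 / B = (B - p ^ 2) / B"
    "(1 - 1 / q) = - (1 - q) / q" "1 - 1 / (B * q) = - (1 - q * B) / (B * q)"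
    using q0 B0 by (simp_all add: s2 field_simps power2_eq_square)
  have phi: "cphi 1 = (s * B + p) / (s * (B - p ^ 2))"
  proof -
    have "cphi 1 = 1 + (1 - 1 / q) * (1 - p ^ 2 * q) * (- (s * p / B) / ((1 - q) * (1 - s * p) * (1 - p ^ 2 / B)))"
      by (simp add: cphi_def cker_def ctau_def qpoch_Suc choose_two_small)
    also have "\<dots> = 1 + (s * p / q) * (1 + s * p) / (B - p ^ 2)"
    proof -
      have *: "1 + (- a / q) * (b * c) * (- (s * p / B) / (a * b * (D / B))) = 1 + (s * p / q) * c / D"
        if "a \<noteq> 0" "b \<noteq> 0" "D \<noteq> 0" for a b c D
        using that q0 B0 by (simp add: field_simps)
      show ?thesis unfolding e by (rule *[OF n(1,2) nBp])
    qed
    also have "\<dots> = (s * B + p) / (s * (B - p ^ 2))"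
      unfolding s2 using s0 nBp by (simp add: divide_simps) algebra
    finally show ?thesis .
  qed
  have S: "cs 1 = 1 - (1 + s * p) ^ 2 * B / ((1 - q * B) * (B - p ^ 2))"
  proof -
    have "cs 1 = 1 + (1 - 1 / q) * (1 - p ^ 2 * q) * (q * ((1 - p) * (1 + p) * (1 + s * p))
         / ((1 - q) * (1 - q * B) * (1 - s * p) * (1 - p ^ 2) * (1 - p ^ 2 / B)))"
      by (simp add: cs_def cker_def ct_def qpoch_Suc)
    also have "(1 - p) * (1 + p) = 1 - p ^ 2" by (simp add: algebra_simps power2_eq_square)
    also have "1 + (1 - 1 / q) * (1 - p ^ 2 * q) * (q * ((1 - p ^ 2) * (1 + s * p))
         / ((1 - q) * (1 - q * B) * (1 - s * p) * (1 - p ^ 2) * (1 - p ^ 2 / B)))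
       = 1 - (1 + s * p) ^ 2 * B / ((1 - q * B) * (B - p ^ 2))"
    proof -
      have *: "1 + (- a / q) * (b * c) * (q * (d * c) / (a * f * b * d * (D / B))) = 1 - c ^ 2 * B / (f * D)"
        if "a \<noteq> 0" "b \<noteq> 0" "D \<noteq> 0" "d \<noteq> 0" "f \<noteq> 0" for a b c d f D
        using that q0 B0 by (simp add: field_simps power2_eq_square)
      show ?thesis unfolding e by (rule *[OF n(1,2) nBp n(3,4)])
    qed
    finally show ?thesis .
  qed
  have g: "cg 1 = - (1 - q * B) / (q * (B - p ^ 2))"
  proof -
    have "cg 1 = (1 - 1 / (B * q)) / (1 - p ^ 2 / B)" by (simp add: cg_def qpoch_Suc)
    moreover have "- a / (B * q) / (D / B) = - a / (q * D)" if "D \<noteq> 0" for a D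
      using that q0 B0 by simp
    ultimately show ?thesis unfolding e using nBp by simp
  qed
  show ?thesis unfolding phi S g unfolding s2 using s0 nBp n(4)[unfolded s2]
    by (simp add: divide_simps) algebra
qed

lemma cross_multiply:
  fixes x y u v c d :: complex
  assumes "x * (u / c) = y * (v / (c * d))" "c \<noteq> 0" "d \<noteq> 0"
  shows "x * u * d = y * v"
  using assms by (simp add: divide_simps mult.assoc)

theorem clausen_terminating: "cphi n ^ 2 = cg n * cs n"
proof (induction n rule: less_induct)
  case (less n)
  consider "n = 0" | "n = 1" | m where "n = Suc (Suc m)" by (metis One_nat_def not0_implies_Suc)
  thus ?case
  proof cases
    case 1
    thus ?thesis by (simp add: cphi_def cs_def cg_def cker_def ctau_def ct_def numeral_2_eq_2)
  next
    case 2
    thus ?thesis using clausen_first by simp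
  next
    case 3
    define X where "X = q ^ m"
    define Z where "Z = s * p * X"
    define \<phi> where "\<phi> = (\<lambda>Y. \<Sum>k\<le>Suc (Suc m). cker Y k * ctau k)"
    define S where "S = (\<lambda>Y. \<Sum>k\<le>Suc (Suc m). cker Y k * ct k)"
    have X0: "X \<noteq> 0" using q0 by (simp add: X_def)
    have q': "q = s ^ 2" using s by simp
    have pX: "p * s * Z = p ^ 2 * q * X" "p * Z = s * (p ^ 2 * X)" "Z ^ 2 = q * (p ^ 2 * X ^ 2)"
      unfolding Z_def q' by (simp_all add: power2_eq_square)
    have \<phi>S: "\<phi> (q ^ j) = cphi j" "S (q ^ j) = cs j" if "j \<le> Suc (Suc m)" for j
      using cker_sum_extend[OF that] by (simp_all add: \<phi>_def S_def cphi_def cs_def)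
    have X1: "q * X = q ^ Suc m" "q ^ 2 * X = q ^ Suc (Suc m)" by (simp_all add: X_def power2_eq_square)
    have Z0: "Z \<noteq> 0" using s0 p0 X0 by (simp add: Z_def)
    have nX: "norm X \<le> 1" unfolding X_def by (rule norm_qpower_le_one[OF q])
    have nZ: "norm Z < 1" using mult_left_le[OF nX, of "norm (s * p)"] nsp by (simp add: Z_def norm_mult)
    have "Z * (s * B - p * Z) * (s - p * Z) * (Z + s^2) * \<phi> (q * X) - (s+p) * (p+s * B) * Z * (s^2 - Z^2) * \<phi> X
      - s^2 * (B * Z - p * s) * (Z - p * s) * (1 + Z) * \<phi> (X / q) = 0"
      using clausen_phi_relation[of X "Suc (Suc m)"] X0 q_power_not_one[of m] p2_power[of m]
        qpoch_inverse_power_eq_0[of "Suc m" "Suc (Suc (Suc m))"]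
      unfolding \<phi>_def Z_def X1 X_def s by (simp add: s)
    note r1 = this
    \<comment> \<open>The relation at q X, that is, with s^2 Z in place of Z; a common factor s^4 is
      divided out below.\<close>
    have "s ^ 2 * Z * (s * B - p * (s ^ 2 * Z)) * (s - p * (s ^ 2 * Z)) * (s ^ 2 * Z + s^2) * \<phi> (q ^ 2 * X)
      - (s+p) * (p+s * B) * (s ^ 2 * Z) * (s^2 - (s ^ 2 * Z)^2) * \<phi> (q * X)
      - s^2 * (B * (s ^ 2 * Z) - p * s) * ((s ^ 2 * Z) - p * s) * (1 + (s ^ 2 * Z)) * \<phi> X = 0"
    proof -
      have A: "s * p * (q * X) = q * Z" "q * (q * X) = q ^ 2 * X" "q * X / q = X"
        using q0 by (simp_all add: Z_def power2_eq_square)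
      have "q * X \<noteq> 0" "q * (q * X) \<noteq> 1" "p ^ 2 * (q * X) \<noteq> q" "qpoch (1 / (q * (q * X))) q (Suc (Suc (Suc m))) = 0"
        using X0 q0 q_power_not_one[of "Suc m"] p2_power[of "Suc m"]
          qpoch_inverse_power_eq_0[of "Suc (Suc m)" "Suc (Suc (Suc m))"] unfolding A(2) X1 by simp_all
      from clausen_phi_relation[OF this] show ?thesis
        unfolding \<phi>_def A s .
    qed
    moreover have "s ^ 4 * (s^2 * Z * (B - p * s * Z) * (1 - p * s * Z) * (1 + Z) * f2 - (s+p) * (p+s * B) * Z * (1 - s^2 * Z^2) * f1
      - (s * B * Z - p) * (s * Z - p) * (1 + s^2 * Z) * f0)
      = s ^ 2 * Z * (s * B - p * (s ^ 2 * Z)) * (s - p * (s ^ 2 * Z)) * (s ^ 2 * Z + s^2) * f2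
      - (s+p) * (p+s * B) * (s ^ 2 * Z) * (s^2 - (s ^ 2 * Z)^2) * f1
      - s^2 * (B * (s ^ 2 * Z) - p * s) * ((s ^ 2 * Z) - p * s) * (1 + (s ^ 2 * Z)) * f0" for f0 f1 f2
      by algebra
    ultimately have r2: "s^2 * Z * (B - p * s * Z) * (1 - p * s * Z) * (1 + Z) * \<phi> (q ^ 2 * X)
      - (s+p) * (p+s * B) * Z * (1 - s^2 * Z^2) * \<phi> (q * X) - (s * B * Z - p) * (s * Z - p) * (1 + s^2 * Z) * \<phi> X = 0"
      using s0 by (metis mult_eq_0_iff power_not_zero)
    have r3: "s^2 * clausen_V s p B Z * (s^2 - Z^2) * (1 + s^2 * Z) * Z * (s * Z - p) * S X
      + s^2 * clausen_V s p B Z * (1 - s^2 * Z^2) * (Z + s^2) * Z * (s - p * Z) * S (q * X)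
      - s^3 * Z * (Z - p * s)^2 * (B * Z - p * s) * (s^3 * B - p * Z) * (1 - s^2 * Z^2) * (1 + s^2 * Z) * (s * Z - p) * S (X / q)
      - s^3 * Z * (1 - p * s * Z)^2 * (B - p * s * Z) * (s^3 * B * Z - p) * (s^2 - Z^2) * (Z + s^2) * (s - p * Z) * S (q ^ 2 * X) = 0"
      unfolding S_def Z_def
      by (rule clausen_s_relation) (use X0 q_power_not_one[of "Suc m"] p2_power[of m]
          qpoch_inverse_power_eq_0[of "Suc (Suc m)" "Suc (Suc (Suc m))"] in \<open>simp_all only: X1(2), simp_all add: X_def\<close>)
    have g1: "cg (Suc m) * (s * B - p * Z) * Z = cg m * (s * B * Z - p)"
    proof -
      have 1: "1 - p ^ 2 / B * q ^ m = (s * B - p * Z) / (s * B)" "1 - 1 / (B * q ^ Suc m) = (s * B * Z - p) / (s * B * Z)"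
        using s0 p0 B0 X0 q0 unfolding Z_def X1(1)[symmetric] X_def[symmetric]
        by (simp_all add: field_simps power2_eq_square s[symmetric])
      show ?thesis by (rule cross_multiply[OF cg_Suc[of m, unfolded 1]]) (use s0 B0 Z0 in auto)
    qed
    have g2: "cg (Suc (Suc m)) * (s ^ 3 * Z * (B - p * s * Z)) = cg (Suc m) * (s ^ 3 * B * Z - p)"
    proof -
      have 1: "1 - p ^ 2 / B * q ^ Suc m = (s ^ 3 * (B - p * s * Z)) / (s ^ 3 * B)" "1 - 1 / (B * q ^ Suc (Suc m)) = (s ^ 3 * B * Z - p) / (s ^ 3 * B * Z)"
        using s0 p0 B0 X0 q0 unfolding Z_def X1[symmetric] X_def[symmetric]
        by (simp_all add: field_simps power2_eq_square power3_eq_cube s[symmetric])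
      have "cg (Suc (Suc m)) * (s ^ 3 * (B - p * s * Z)) * Z = cg (Suc m) * (s ^ 3 * B * Z - p)"
        by (rule cross_multiply[OF cg_Suc[of "Suc m", unfolded 1]]) (use s0 B0 Z0 in auto)
      thus ?thesis by (simp only: mult_ac)
    qed
    \<comment> \<open>For m = 0 there is no preceding n to which the induction hypothesis applies,
      but then Z = p s and both sides vanish. The factor Z - p s is kept for this reason.\<close>
    have "(Z - p * s) * (cg m * (s^3 * B - p * Z) * Z * S (X / q)) = (Z - p * s) * (s^3 * (B * Z - p * s) * \<phi> (X / q)^2)"
    proof (cases m)
      case 0
      thus ?thesis by (simp add: Z_def X_def)
    next
      case (Suc l)
      have Xq: "X / q = q ^ l" using q0 by (simp add: X_def Suc)
      have 1: "1 - p ^ 2 / B * q ^ l = (s ^ 3 * B - p * Z) / (s ^ 3 * B)" "1 - 1 / (B * q ^ Suc l) = (s^3 * (B * Z - p * s)) / (s^3 * B * Z)"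
        using s0 p0 B0 X0 q0 unfolding Z_def Xq[symmetric] Suc[symmetric] X_def[symmetric]
        by (simp_all add: field_simps power2_eq_square power3_eq_cube s[symmetric])
      have "cg m * (s^3 * B - p * Z) * Z = cg l * (s^3 * (B * Z - p * s))"
        unfolding Suc by (rule cross_multiply[OF cg_Suc[of l, unfolded 1]]) (use s0 B0 Z0 in auto)
      moreover have "\<phi> (X / q) ^ 2 = cg l * S (X / q)"
        unfolding Xq using \<phi>S[of l] less.IH[of l] 3 Suc by simp
      ultimately show ?thesis by (simp add: mult_ac)
    qed
    note gm = this
    have nz1: "1 + Z \<noteq> 0" using nZ by (metis add_eq_0_iff norm_minus_cancel norm_one order_less_irrefl)
    have "p ^ 2 * X ^ 2 \<noteq> 1" and "p ^ 2 * X ^ 2 \<noteq> q"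
      using one_minus_nonzero[OF np2, of "m + m"] p2_power[of "m + m"] by (auto simp: X_def power2_eq_square power_add)
    hence nz2: "s^2 - Z^2 \<noteq> 0" and nz3: "Z + s^2 \<noteq> 0"
    proof -
      show "s^2 - Z^2 \<noteq> 0" using \<open>p ^ 2 * X ^ 2 \<noteq> 1\<close> q0 by (simp add: pX s)
      show "Z + s^2 \<noteq> 0"
      proof
        assume "Z + s^2 = 0"
        hence "Z = - q" by (simp add: s add_eq_0_iff2)
        hence "Z ^ 2 = q * q" by (simp add: power2_eq_square)
        thus False using \<open>p ^ 2 * X ^ 2 \<noteq> q\<close> q0 by (simp add: pX)
      qed
    qed
    have "s * B - p * Z = s * B * (1 - p ^ 2 / B * q ^ m)" "s - p * Z = s * (1 - p ^ 2 * q ^ m)"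
      "B - p * s * Z = B * (1 - p ^ 2 / B * q ^ Suc m)" "1 - p * s * Z = 1 - p ^ 2 * q ^ Suc m"
      unfolding pX X_def using B0 by (simp_all add: right_diff_distrib mult_ac)
    hence nz4: "s * B - p * Z \<noteq> 0" and nz5: "s - p * Z \<noteq> 0" and nz6: "B - p * s * Z \<noteq> 0" and nz7: "1 - p * s * Z \<noteq> 0"
      using one_minus_nonzero[OF nA, of m] one_minus_nonzero[OF np2, of m]
        one_minus_nonzero[OF nA, of "Suc m"] one_minus_nonzero[OF np2, of "Suc m"] s0 B0
      by (simp_all only: mult_eq_0_iff de_Morgan_disj simp_thms not_False_eq_True)
    have IH: "\<phi> X ^ 2 = cg m * S X" "\<phi> (q * X) ^ 2 = cg (Suc m) * S (q * X)"
      using \<phi>S[of m] \<phi>S[of "Suc m"] less.IH[of m] less.IH[of "Suc m"] 3 unfolding X1 by (simp_all add: X_def)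
    have "\<phi> (q ^ 2 * X) ^ 2 = cg (Suc (Suc m)) * S (q ^ 2 * X)"
      by (rule clausen_induction_step[OF r1 r2 r3 g1 g2 gm IH s0 Z0 nz1 nz2 nz3 nz4 nz5 nz6 nz7])
    thus ?thesis using \<phi>S[of "Suc (Suc m)"] unfolding X1 3 by simp
  qed
qed

end

subsection \<open>A Liouville argument\<close>

text \<open>Every zero a of g is simple and also a zero of f. Near it g is (x - a) v with v non-zero
  at a, while f / (x - a) extends over a, so the quotient does too. Its value at a is the quotient
  of the derivatives.\<close>

lemma holomorphic_quotient:
  fixes f g :: "complex \<Rightarrow> complex"
  assumes S: "open S" and f: "f holomorphic_on S" and g: "g holomorphic_on S"
    and zero: "\<And>a. a \<in> S \<Longrightarrow> g a = 0 \<Longrightarrow>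
        f a = 0 \<and> (\<exists>v. v holomorphic_on S \<and> v a \<noteq> 0 \<and> (\<forall>x\<in>S. g x = (x - a) * v x))"
  obtains h where "h holomorphic_on S" "\<And>x. x \<in> S \<Longrightarrow> f x = g x * h x"
proof -
  define h where "h = (\<lambda>x. if g x = 0 then deriv f x / deriv g x else f x / g x)"
  have "h field_differentiable at a" if a: "a \<in> S" for a
  proof (cases "g a = 0")
    case False
    have "continuous_on S g" using g by (rule holomorphic_on_imp_continuous_on)
    hence "open (S \<inter> g -` (- {0}))"
      by (rule continuous_open_preimage) (use S in auto)
    moreover have "S \<inter> g -` (- {0}) = {x \<in> S. g x \<noteq> 0}" by auto
    ultimately have o: "open {x \<in> S. g x \<noteq> 0}" by simp
    have "(\<lambda>x. f x / g x) holomorphic_on {x \<in> S. g x \<noteq> 0}"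
      by (intro holomorphic_intros holomorphic_on_subset[OF f] holomorphic_on_subset[OF g]) auto
    hence "h holomorphic_on {x \<in> S. g x \<noteq> 0}"
      by (rule holomorphic_transform) (auto simp: h_def)
    thus ?thesis using o False a by (auto simp: holomorphic_on_open field_differentiable_def)
  next
    case True
    from zero[OF a True] obtain v where v: "v holomorphic_on S" "v a \<noteq> 0" "\<And>x. x \<in> S \<Longrightarrow> g x = (x - a) * v x"
      and fa: "f a = 0" by blast
    define F where "F = (\<lambda>x. if x = a then deriv f a else (f x - f a) / (x - a))"
    have F: "F holomorphic_on S" unfolding F_def by (rule pole_theorem_open_0[OF f S]) (auto simp: fa)
    have "continuous_on S v" using v(1) by (rule holomorphic_on_imp_continuous_on)
    hence "open (S \<inter> v -` (- {0}))"
      by (rule continuous_open_preimage) (use S in auto)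
    moreover have "S \<inter> v -` (- {0}) = {x \<in> S. v x \<noteq> 0}" by auto
    ultimately have o: "open {x \<in> S. v x \<noteq> 0}" by simp
    have dg: "deriv g a = v a"
    proof (rule DERIV_imp_deriv)
      have "(v has_field_derivative deriv v a) (at a)"
        using v(1) S a by (rule holomorphic_derivI)
      hence "((\<lambda>x. (x - a) * v x) has_field_derivative v a) (at a)"
        by (auto intro!: derivative_eq_intros)
      thus "(g has_field_derivative v a) (at a)"
        by (rule has_field_derivative_transform_within_open[OF _ S a]) (use v(3) in auto)
    qed
    have "(\<lambda>x. F x / v x) holomorphic_on {x \<in> S. v x \<noteq> 0}"
      by (intro holomorphic_intros holomorphic_on_subset[OF F] holomorphic_on_subset[OF v(1)]) auto
    hence "h holomorphic_on {x \<in> S. v x \<noteq> 0}"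
    proof (rule holomorphic_transform)
      fix x assume x: "x \<in> {x \<in> S. v x \<noteq> 0}"
      show "F x / v x = h x"
      proof (cases "x = a")
        case True
        thus ?thesis using \<open>g a = 0\<close> by (simp add: F_def h_def dg)
      next
        case False
        thus ?thesis using x v(3)[of x] fa by (simp add: F_def h_def)
      qed
    qed
    thus ?thesis using o v(2) a by (auto simp: holomorphic_on_open field_differentiable_def)
  qed
  hence "h holomorphic_on S"
    unfolding holomorphic_on_def by (blast intro: field_differentiable_at_within)
  moreover have "f x = g x * h x" if "x \<in> S" for x
    using zero[OF that] by (simp add: h_def)
  ultimately show ?thesis using that by blast
qed

text \<open>Dividing the argument by r multiplies the product by |1 - y| at the new argument y,
  eventually at least 1 / sqrt r, which is the growth of sqrt y in one step. For arguments below t a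
  constant lower bound suffices. The form t r^i / r^j encodes an arbitrary integral exponent, and
  the conditions on t avoid the zeros.\<close>

lemma qpoch_inf_lower_bound:
  fixes r t :: real
  assumes r: "0 < r" "r < 1" and t: "t > 0" and nt: "\<And>j::nat. t * r ^ j \<noteq> 1" "\<And>j::nat. t \<noteq> r ^ j"
  obtains c where "c > 0"
    "\<And>i j. c * sqrt (t * r ^ i / r ^ j) \<le> norm (qpoch_inf (of_real (t * r ^ i / r ^ j)) (of_real r))"
proof -
  define \<phi> where "\<phi> = (\<lambda>y. norm (qpoch_inf (of_real y) (of_real r)))"
  have nr: "norm (complex_of_real r) < 1" using r by simp
  have step: "\<phi> y = \<bar>1 - y\<bar> * \<phi> (y * r)" for y
    using qpoch_inf_step[OF nr, of "of_real y"] unfolding \<phi>_def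
    by (metis norm_mult norm_of_real of_real_1 of_real_diff of_real_mult)
  have \<phi>t: "\<phi> t > 0"
  proof -
    have "complex_of_real t * of_real r ^ k \<noteq> 1" for k
      using nt(1)[of k] by (metis of_real_eq_1_iff of_real_mult of_real_power)
    thus ?thesis unfolding \<phi>_def using qpoch_inf_eq_0_iff[OF nr, of "of_real t"] by simp
  qed
  have "\<exists>c>0. \<forall>m. c * sqrt (t / r ^ m) \<le> \<phi> (t / r ^ m)"
  proof -
    define \<rho> where "\<rho> = (\<lambda>m. \<phi> (t / r ^ m) / sqrt (t / r ^ m))"
    have pos: "\<phi> (t / r ^ m) > 0" for m
    proof (induction m)
      case (Suc m)
      have "t / r ^ Suc m * r = t / r ^ m" using r by simp
      hence "\<phi> (t / r ^ Suc m) = \<bar>1 - t / r ^ Suc m\<bar> * \<phi> (t / r ^ m)" using step[of "t / r ^ Suc m"] by simp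
      moreover have "t / r ^ Suc m \<noteq> 1" using nt(2)[of "Suc m"] r by (simp add: divide_simps)
      ultimately show ?case using Suc by (simp del: power_Suc)
    qed (use \<phi>t in simp)
    have \<rho>pos: "\<rho> m > 0" for m unfolding \<rho>_def using pos[of m] t r by simp
    have "filterlim (\<lambda>m. inverse (r ^ m)) at_top sequentially"
      using LIMSEQ_inverse_realpow_zero[of "inverse r"] r
      by (intro filterlim_inverse_at_top LIMSEQ_power_zero) (auto intro!: always_eventually)
    hence "eventually (\<lambda>m. inverse (r ^ m) \<ge> (1 + 1 / sqrt r) / t) sequentially"
      by (simp add: filterlim_at_top)
    then obtain M where M: "\<And>m. m \<ge> M \<Longrightarrow> inverse (r ^ m) \<ge> (1 + 1 / sqrt r) / t"
      by (auto simp: eventually_sequentially)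
    have mono: "\<rho> m \<le> \<rho> (Suc m)" if "m \<ge> M" for m
    proof -
      have "t * inverse (r ^ Suc m) \<ge> 1 + 1 / sqrt r"
        using mult_left_mono[OF M[of "Suc m"], of t] that t by simp
      hence a: "\<bar>1 - t / r ^ Suc m\<bar> \<ge> 1 / sqrt r" by (simp add: divide_inverse)
      have e: "t / r ^ Suc m * r = t / r ^ m" using r by simp
      have e2: "sqrt (t / r ^ Suc m) * sqrt r = sqrt (t / r ^ m)" by (metis e real_sqrt_mult)
      have "\<rho> m = 1 / sqrt r * (\<phi> (t / r ^ m) / sqrt (t / r ^ Suc m))"
        unfolding \<rho>_def e2[symmetric] by simp
      also have "\<dots> \<le> \<bar>1 - t / r ^ Suc m\<bar> * (\<phi> (t / r ^ m) / sqrt (t / r ^ Suc m))"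
        using a pos[of m] t r by (intro mult_right_mono) auto
      also have "\<dots> = \<rho> (Suc m)"
        unfolding \<rho>_def step[of "t / r ^ Suc m"] e by simp
      finally show ?thesis .
    qed
    have "\<rho> M \<le> \<rho> m" if "m \<ge> M" for m
      using that by (induction rule: dec_induct) (auto intro: order_trans mono)
    \<comment> \<open>From M on the quotients are nondecreasing, so their minimum is found among the
      first M + 1.\<close>
    moreover define c where "c = Min (\<rho> ` {..M})"
    have "c \<le> \<rho> m" if "m \<le> M" for m unfolding c_def using that by (intro Min_le) auto
    ultimately have "c \<le> \<rho> m" for m by (metis linorder_le_cases order_refl order_trans)
    moreover have "c > 0" unfolding c_def using \<rho>pos by (subst Min_gr_iff) auto
    ultimately show ?thesis using t r
      by (intro exI[of _ c]) (auto simp: \<rho>_def pos_le_divide_eq)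
  qed
  then obtain c1 where c1: "c1 > 0" "\<And>m. c1 * sqrt (t / r ^ m) \<le> \<phi> (t / r ^ m)" by blast
  define E where "E = exp (t / (1 - r))"
  have down: "\<phi> t / E \<le> \<phi> (t * r ^ m)" for m
  proof -
    have "\<phi> t = norm (qpoch (of_real t) (of_real r) m) * \<phi> (t * r ^ m)"
      using qpoch_inf_split[OF nr, of "of_real t" m] by (simp add: \<phi>_def norm_mult)
    also have "\<dots> \<le> E * \<phi> (t * r ^ m)"
      using norm_qpoch_le[OF nr, of "of_real t" t m] t r by (intro mult_right_mono) (auto simp: E_def \<phi>_def)
    finally show ?thesis by (simp add: E_def divide_simps mult.commute)
  qed
  define c where "c = min c1 (\<phi> t / E / sqrt t)"
  have c: "c > 0" "c \<le> c1" "c \<le> \<phi> t / E / sqrt t"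
    using c1(1) \<phi>t t by (auto simp: c_def E_def)
  hence c': "c * sqrt t \<le> \<phi> t / E" using t by (simp only: pos_le_divide_eq real_sqrt_gt_0_iff)
  have "c * sqrt (t * r ^ i / r ^ j) \<le> \<phi> (t * r ^ i / r ^ j)" for i j
  proof (cases "i \<le> j")
    case True
    hence e: "t * r ^ i / r ^ j = t / r ^ (j - i)" using r by (simp add: power_diff)
    have "c * sqrt (t / r ^ (j - i)) \<le> c1 * sqrt (t / r ^ (j - i))" using c t r by (intro mult_right_mono) auto
    thus ?thesis unfolding e using c1(2)[of "j - i"] by linarith
  next
    case False
    hence e: "t * r ^ i / r ^ j = t * r ^ (i - j)" using r by (simp add: power_diff)
    have "c * sqrt (t * r ^ (i - j)) \<le> c * sqrt t"
      using c(1) t r by (intro mult_left_mono) (auto simp: mult_left_le power_le_one)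
    thus ?thesis unfolding e using c' down[of "i - j"] by linarith
  qed
  thus ?thesis using that c(1) unfolding \<phi>_def by blast
qed

text \<open>The reverse triangle inequality holds factor by factor; lower bounds are thereby reduced
  to real arguments.\<close>

lemma norm_qpoch_inf_ge:
  assumes q: "norm q < 1"
  shows "norm (qpoch_inf (of_real (norm a)) (of_real (norm q))) \<le> norm (qpoch_inf a q)"
proof (rule LIMSEQ_le)
  show "(\<lambda>n. norm (qpoch (of_real (norm a)) (of_real (norm q)) n)) \<longlonglongrightarrow> norm (qpoch_inf (of_real (norm a)) (of_real (norm q)))"
    by (intro tendsto_norm qpoch_tendsto) (use q in simp)
  show "(\<lambda>n. norm (qpoch a q n)) \<longlonglongrightarrow> norm (qpoch_inf a q)"
    by (intro tendsto_norm qpoch_tendsto q)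
  have "norm (1 - complex_of_real (norm a) * of_real (norm q) ^ j) \<le> norm (1 - a * q ^ j)" for j
  proof -
    have "norm (1 - complex_of_real (norm a) * of_real (norm q) ^ j) = \<bar>1 - norm (a * q ^ j)\<bar>"
      by (metis norm_mult norm_of_real norm_power of_real_1 of_real_diff of_real_mult of_real_power)
    also have "\<dots> \<le> norm (1 - a * q ^ j)"
      using norm_triangle_ineq3[of 1 "a * q ^ j"] by simp
    finally show ?thesis .
  qed
  thus "\<exists>N. \<forall>n\<ge>N. norm (qpoch (of_real (norm a)) (of_real (norm q)) n) \<le> norm (qpoch a q n)"
    by (auto simp: qpoch_def prod_norm[symmetric] intro!: prod_mono)
qed

text \<open>The common shape of the series in \<open>T\<close> and \<open>W\<close>, with
  coefficients \<open>ct\<close> and \<open>ctau\<close>.\<close>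

definition ksum :: "complex \<Rightarrow> (nat \<Rightarrow> complex) \<Rightarrow> complex \<Rightarrow> complex \<Rightarrow> complex" where
  "ksum q f p x = (\<Sum>k. f k * (qpoch (p * x) q k * qpoch (p / x) q k))"

context
  fixes q :: complex
  assumes q: "norm q < 1"
begin

lemma ksum_term_bound:
  assumes "norm (p * x) \<le> M" "norm (p / x) \<le> M"
  shows "norm (f k * (qpoch (p * x) q k * qpoch (p / x) q k)) \<le> norm (f k) * (exp (M / (1 - norm q)) * exp (M / (1 - norm q)))"
  unfolding norm_mult using assms
  by (intro mult_left_mono mult_mono norm_qpoch_le[OF q]) auto

lemma summable_ksum:
  assumes "summable (\<lambda>k. norm (f k))"
  shows "summable (\<lambda>k. f k * (qpoch (p * x) q k * qpoch (p / x) q k))"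
  by (rule summable_comparison_test'[OF summable_mult2[OF assms]])
     (rule ksum_term_bound[of p x "max (norm (p * x)) (norm (p / x))"], auto)

lemma holomorphic_on_ksum:
  assumes "summable (\<lambda>k. norm (f k))"
  shows "ksum q f p holomorphic_on (- {0})"
  unfolding ksum_def
proof (rule holomorphic_on_suminf)
  fix x :: complex assume "x \<in> - {0}"
  hence x: "norm x > 0" by simp
  define M where "M = max (norm p * (2 * norm x)) (norm p * (2 / norm x))"
  have bnd: "norm (p * y) \<le> M \<and> norm (p / y) \<le> M \<and> y \<noteq> 0" if "y \<in> cball x (norm x / 2)" for y
  proof -
    have "norm (x - y) \<le> norm x / 2" using that by (simp add: dist_norm)
    hence y: "norm y \<le> 2 * norm x" "norm x / 2 \<le> norm y"
      using norm_triangle_ineq2[of x y] norm_triangle_ineq2[of y x] x by (auto simp: norm_minus_commute)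
    have "norm (p * y) \<le> norm p * (2 * norm x)" unfolding norm_mult using y by (intro mult_left_mono) auto
    moreover have "norm (p / y) \<le> norm p * (2 / norm x)"
    proof -
      have "1 / norm y \<le> 2 / norm x" using y x by (simp add: divide_simps mult.commute)
      from mult_left_mono[OF this, of "norm p"] show ?thesis by (simp add: norm_divide)
    qed
    ultimately show ?thesis using y x by (auto simp: M_def)
  qed
  show "\<exists>d>0. \<exists>M. cball x d \<subseteq> - {0} \<and> summable M \<and>
      (\<forall>k. \<forall>y\<in>cball x d. norm (f k * (qpoch (p * y) q k * qpoch (p / y) q k)) \<le> M k)"
  proof (intro exI[of _ "norm x / 2"] conjI exI)
    show "summable (\<lambda>k. norm (f k) * (exp (M / (1 - norm q)) * exp (M / (1 - norm q))))"
      by (rule summable_mult2[OF assms])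
  qed (use x bnd ksum_term_bound in auto)
qed (auto intro!: holomorphic_intros q)

lemma ksum_inverse: "ksum q f p (1 / x) = ksum q f p x"
  by (simp add: ksum_def mult_ac)

text \<open>Dividing by \<open>(p x, p / x; q)\<^sub>\<infinity>\<close> turns the \<open>k\<close>-th term of \<^const>\<open>ksum\<close> into one over
  \<open>(p x q\<^sup>k, p q\<^sup>k / x; q)\<^sub>\<infinity>\<close>, which is at least of order \<open>\<bar>x q\<^sup>k\<bar>\<^sup>1\<^sup>/\<^sup>2\<close> on suitable circles.\<close>

lemma ksum_circle_bound:
  assumes q0: "q \<noteq> 0" and p0: "p \<noteq> 0" and R: "R > 0"
    and nR: "\<And>j::nat. norm p * R * norm q ^ j \<noteq> 1" "\<And>j::nat. norm p * R \<noteq> norm q ^ j"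
    and summ: "summable (\<lambda>k. norm (f k) / sqrt (norm q) ^ k)"
  obtains C where "C > 0" "\<And>n (x::complex). norm x = R / norm q ^ n \<Longrightarrow> norm x \<ge> 2 * norm p \<Longrightarrow>
      norm (ksum q f p x) \<le> C / sqrt (norm x) * norm (qpoch_inf (p * x) q * qpoch_inf (p / x) q)
      \<and> qpoch_inf (p * x) q * qpoch_inf (p / x) q \<noteq> 0"
proof -
  define r where "r = norm q"
  have r: "0 < r" "r < 1" using q q0 by (auto simp: r_def)
  have t: "norm p * R > 0" using p0 R by simp
  obtain c where c: "c > 0"
    "\<And>i j. c * sqrt (norm p * R * r ^ i / r ^ j) \<le> norm (qpoch_inf (of_real (norm p * R * r ^ i / r ^ j)) (of_real r))"
    using qpoch_inf_lower_bound[OF r t] nR unfolding r_def by blast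
  \<comment> \<open>This handles (p q^k / x)_inf, whose argument has modulus at most 1/2 on the
    circles considered.\<close>
  have "\<exists>c1>0. \<forall>y\<in>cball 0 (1/2). c1 \<le> norm (qpoch_inf y q)"
  proof -
    have "compact (cball (0::complex) (1/2))" "cball (0::complex) (1/2) \<noteq> {}" by auto
    moreover have "continuous_on (cball 0 (1/2)) (\<lambda>y. norm (qpoch_inf y q))"
      by (intro continuous_intros q)
    ultimately obtain y0 where y0: "y0 \<in> cball 0 (1/2)" "\<forall>y\<in>cball 0 (1/2). norm (qpoch_inf y0 q) \<le> norm (qpoch_inf y q)"
      using continuous_attains_inf by blast
    moreover have "qpoch_inf y0 q \<noteq> 0" using y0(1) by (intro qpoch_inf_nonzero q) auto
    ultimately show ?thesis by (intro exI[of _ "norm (qpoch_inf y0 q)"]) auto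
  qed
  then obtain c1 where c1: "c1 > 0" "\<And>y. norm y \<le> 1/2 \<Longrightarrow> c1 \<le> norm (qpoch_inf y q)" by auto
  define \<Sigma> where "\<Sigma> = (\<Sum>k. norm (f k) / sqrt r ^ k)"
  define C where "C = \<Sigma> / (c * sqrt (norm p) * c1) + 1"
  have \<Sigma>: "\<Sigma> \<ge> 0" unfolding \<Sigma>_def using summ r by (intro suminf_nonneg) (auto simp: r_def)
  have C: "C > 0" unfolding C_def using \<Sigma> c(1) c1(1) by (simp add: add_nonneg_pos)
  have bnd: "c * sqrt (norm p) * sqrt (norm x) * sqrt r ^ k * c1 \<le> norm (qpoch_inf (p * x * q ^ k) q * qpoch_inf (p / x * q ^ k) q)"
    if x: "norm x = R / norm q ^ n" "norm x \<ge> 2 * norm p" for n k and x :: complex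
  proof -
    have "norm (p * x * q ^ k) = norm p * R * r ^ k / r ^ n" using x(1) by (simp add: norm_mult norm_power r_def)
    hence "c * sqrt (norm (p * x * q ^ k)) \<le> norm (qpoch_inf (p * x * q ^ k) q)"
      using c(2)[of k n] norm_qpoch_inf_ge[OF q, of "p * x * q ^ k"] unfolding r_def by simp
    moreover have "c * sqrt (norm (p * x * q ^ k)) = c * sqrt (norm p) * sqrt (norm x) * sqrt r ^ k"
      by (simp add: norm_mult norm_power real_sqrt_mult real_sqrt_power r_def)
    moreover have "c1 \<le> norm (qpoch_inf (p / x * q ^ k) q)"
    proof (rule c1(2))
      have x0: "norm x > 0" using x(1) R r by (simp add: r_def)
      have "norm (p / x * q ^ k) \<le> norm (p / x) * 1"
        unfolding norm_mult by (intro mult_left_mono norm_qpower_le_one q) auto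
      also have "\<dots> \<le> 1 / 2" using x(2) x0 by (simp add: norm_divide divide_simps)
      finally show "norm (p / x * q ^ k) \<le> 1 / 2" .
    qed
    ultimately show ?thesis unfolding norm_mult using c(1) c1(1) r by (intro mult_mono) auto
  qed
  show ?thesis
  proof (rule that[OF C])
    fix n and x :: complex assume x: "norm x = R / norm q ^ n" "norm x \<ge> 2 * norm p"
    define N where "N = norm (qpoch_inf (p * x) q * qpoch_inf (p / x) q)"
    have x0: "norm x > 0" using x(1) R r by (simp add: r_def)
    have pos: "c * sqrt (norm p) * sqrt (norm x) * c1 > 0" using c c1 p0 x0 by simp
    have "c * sqrt (norm p) * sqrt (norm x) * c1 \<le> N" using bnd[OF x, of 0] by (simp add: N_def)
    with pos have N: "N > 0" by linarith
    have le: "norm (f k * (qpoch (p * x) q k * qpoch (p / x) q k)) \<le> norm (f k) / sqrt r ^ k * (N / (c * sqrt (norm p) * sqrt (norm x) * c1))" for k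
    proof -
      \<comment> \<open>(p x, p / x)_k is the infinite product divided by its tail, and
        \<open>bnd\<close> bounds the tail from below.\<close>
      have "N = norm (qpoch (p * x) q k * qpoch (p / x) q k) * norm (qpoch_inf (p * x * q ^ k) q * qpoch_inf (p / x * q ^ k) q)"
        unfolding N_def qpoch_inf_split[OF q, of "p * x" k] qpoch_inf_split[OF q, of "p / x" k] by (simp add: norm_mult)
      also have "\<dots> \<ge> norm (qpoch (p * x) q k * qpoch (p / x) q k) * (c * sqrt (norm p) * sqrt (norm x) * sqrt r ^ k * c1)"
        by (intro mult_left_mono bnd[OF x]) auto
      finally have "norm (qpoch (p * x) q k * qpoch (p / x) q k) \<le> N / (c * sqrt (norm p) * sqrt (norm x) * sqrt r ^ k * c1)"
        using c(1) c1(1) p0 x0 r by (subst pos_le_divide_eq) (simp_all add: mult_ac)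
      hence "norm (f k * (qpoch (p * x) q k * qpoch (p / x) q k)) \<le> norm (f k) * (N / (c * sqrt (norm p) * sqrt (norm x) * sqrt r ^ k * c1))"
        unfolding norm_mult[of "f k"] by (intro mult_left_mono) auto
      thus ?thesis by (simp add: mult_ac)
    qed
    have "norm (ksum q f p x) \<le> (\<Sum>k. norm (f k) / sqrt r ^ k * (N / (c * sqrt (norm p) * sqrt (norm x) * c1)))"
      unfolding ksum_def by (rule norm_suminf_le[OF le summable_mult2[OF summ[folded r_def]]])
    also have "\<dots> = \<Sigma> * (N / (c * sqrt (norm p) * sqrt (norm x) * c1))"
      unfolding \<Sigma>_def by (rule suminf_mult2[symmetric, OF summ[folded r_def]])
    also have "\<dots> = (\<Sigma> / (c * sqrt (norm p) * c1)) / sqrt (norm x) * N" by (simp add: mult_ac)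
    also have "\<dots> \<le> C / sqrt (norm x) * N"
      using x0 N by (intro mult_right_mono divide_right_mono) (auto simp: C_def)
    finally show "norm (ksum q f p x) \<le> C / sqrt (norm x) * norm (qpoch_inf (p * x) q * qpoch_inf (p / x) q)
      \<and> qpoch_inf (p * x) q * qpoch_inf (p / x) q \<noteq> 0"
      using N by (auto simp: N_def)
  qed
qed

end

section \<open>The series \<open>T\<close> and \<open>W\<close> and the zeros of
  \<open>prefac\<close>\<close>

context clausen
begin

text \<open>\<open>T x / prefac x\<close> is the residue series at the points \<beta> q^k up to
  theta factors, and the constant in front makes the terminating values equal to the squares of
  \<open>W\<close>.\<close>

definition T :: "complex \<Rightarrow> complex" where
  "T x = (qpoch_inf (s * p) q ^ 2 * qpoch_inf (p ^ 2 / B) q / qpoch_inf (1 / B) q) * ksum q ct p x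
     * (qpoch_inf (p / B * x) q * qpoch_inf (p / B / x) q)"

definition W :: "complex \<Rightarrow> complex" where
  "W x = qpoch_inf (s * p) q * qpoch_inf (p ^ 2 / B) q * ksum q ctau p x"

definition prefac :: "complex \<Rightarrow> complex" where
  "prefac x = qpoch_inf (p * x) q * qpoch_inf (p / x) q * (qpoch_inf (p / B * x) q * qpoch_inf (p / B / x) q)"

lemma W_eq_phi22: "W x = qpoch_inf (s * p) q * qpoch_inf (p ^ 2 / B) q * phi22 (p * x) (p / x) (p ^ 2 / B) (s * p) q (s * p / B)"
  unfolding W_def ksum_def phi22_def ctau_def by (simp add: qpochs_def mult_ac)

lemma qpoch_inf_invB_nonzero: "qpoch_inf (1 / (B * q ^ n)) q \<noteq> 0"
proof
  assume "qpoch_inf (1 / (B * q ^ n)) q = 0"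
  then obtain j where j: "1 / (B * q ^ n) * q ^ j = 1" by (auto simp: qpoch_inf_eq_0_iff[OF q])
  hence e: "q ^ j = B * q ^ n" using B0 q0 by (simp add: field_simps)
  show False
  proof (cases "j \<le> n")
    case True
    hence "q ^ n = q ^ j * q ^ (n - j)" by (simp flip: power_add)
    with e have "B * q ^ (n - j) = 1" using q0 by (simp add: field_simps)
    thus False using nB1 by blast
  next
    case False
    hence "q ^ j = q ^ n * q ^ (j - n)" by (simp flip: power_add)
    with e have "q ^ (j - n) = B" using q0 by (simp add: field_simps)
    thus False using nB2 by blast
  qed
qed

lemma norm_mult_power_less_one: "norm a < 1 \<Longrightarrow> norm (a * q ^ n) < 1"
  using mult_left_le[OF norm_qpower_le_one[OF q, of n], of "norm a"] by (simp add: norm_mult)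

lemma ksum_terminating: "ksum q f p (p * q ^ n) = (\<Sum>k\<le>n. cker (q ^ n) k * f k)"
proof -
  have e: "qpoch (p * (p * q ^ n)) q k * qpoch (p / (p * q ^ n)) q k = cker (q ^ n) k" for k
    using p0 by (simp add: cker_def power2_eq_square mult_ac)
  have "ksum q f p (p * q ^ n) = (\<Sum>k\<le>n. f k * cker (q ^ n) k)"
    unfolding ksum_def e by (rule suminf_finite) (auto simp: cker_def qpoch_inverse_power_eq_0)
  thus ?thesis by (simp add: mult.commute)
qed

lemma T_terminating: "T (p * q ^ n) = W (p * q ^ n) ^ 2"
proof -
  have nz: "qpoch (p ^ 2 / B) q n \<noteq> 0" using qpoch_nonzero[OF q nA] .
  have "qpoch_inf (p / B / (p * q ^ n)) q = qpoch (1 / (B * q ^ n)) q n * qpoch_inf (1 / B) q"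
    using qpoch_inf_split[OF q, of "1 / (B * q ^ n)" n] p0 q0 by simp
  moreover have "qpoch_inf (p / B * (p * q ^ n)) q = qpoch_inf (p ^ 2 / B) q / qpoch (p ^ 2 / B) q n"
    using qpoch_inf_split[OF q, of "p ^ 2 / B" n] nz by (simp add: power2_eq_square mult_ac)
  ultimately have "T (p * q ^ n) = (qpoch_inf (s * p) q * qpoch_inf (p ^ 2 / B) q) ^ 2 * (cg n * cs n)"
    using qpoch_inf_invB_nonzero[of 0] unfolding T_def ksum_terminating cs_def[symmetric] cg_def
    by (simp add: power2_eq_square mult_ac)
  thus ?thesis unfolding W_def ksum_terminating cphi_def[symmetric] power_mult_distrib clausen_terminating .
qed

lemma prefac_inverse: "prefac (1 / x) = prefac x"
  by (simp add: prefac_def mult_ac)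

lemma prefac_holomorphic: "prefac holomorphic_on (- {0})"
  unfolding prefac_def by (intro holomorphic_intros q) auto

text \<open>Exactly one factor 1 - p q^n y of (p y)_inf vanishes, with y = 1 / x or y = x. The other
  factors of that product are 1 - q^i with i \<noteq> 0; two of the remaining products have
  arguments p^2 q^n and p^2 q^n / B of modulus below 1, and the last has argument 1 / (B q^n), where
  B is no integral power of q.\<close>

lemma prefac_simple_zero:
  assumes a: "a = p * q ^ n \<or> a = 1 / (p * q ^ n)"
  shows "\<exists>v. v holomorphic_on (- {0}) \<and> v a \<noteq> 0 \<and> (\<forall>x\<in>- {0}. prefac x = (x - a) * v x)"
proof -
  define c where "c = p * q ^ n"
  define g where "g = (\<lambda>y. qpoch (p * y) q n * qpoch_inf (p * y * q ^ Suc n) q)"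
  define g' where "g' = (\<lambda>y. qpoch_inf (p * y) q * (qpoch_inf (p / B * y) q * qpoch_inf (p / B / y) q))"
  have c0: "c \<noteq> 0" using p0 q0 by (simp add: c_def)
  have split: "qpoch_inf (p * y) q = (1 - c * y) * g y" for y
    using qpoch_inf_split[OF q, of "p * y" "Suc n"] by (simp add: g_def c_def qpoch_Suc mult_ac)
  have gnz: "g (1 / c) \<noteq> 0"
  proof -
    have "p * (1 / c) = 1 / q ^ n" using p0 by (simp add: c_def)
    moreover have "qpoch (1 / q ^ n) q n \<noteq> 0"
    proof
      assume "qpoch (1 / q ^ n) q n = 0"
      then obtain j where j: "j < n" "1 / q ^ n * q ^ j = 1" by (auto simp: qpoch_eq_0_iff)
      moreover have "q ^ n = q ^ j * q ^ Suc (n - Suc j)"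
        by (subst power_add[symmetric]) (use j(1) in simp)
      ultimately have "q ^ j = q ^ j * q ^ Suc (n - Suc j)" using q0 by (simp add: divide_simps)
      thus False using q0 q_power_not_one[of "n - Suc j"] by simp
    qed
    moreover have "p * (1 / c) * q ^ Suc n = q" using p0 q0 by (simp add: c_def)
    ultimately show ?thesis using qpoch_inf_nonzero[OF q q] by (simp add: g_def)
  qed
  have g'nz: "g' c \<noteq> 0"
  proof -
    have "qpoch_inf (p * c) q \<noteq> 0" "qpoch_inf (p / B * c) q \<noteq> 0"
      using norm_mult_power_less_one[OF np2, of n] norm_mult_power_less_one[OF nA, of n]
      by (auto intro!: qpoch_inf_nonzero[OF q] simp: c_def power2_eq_square mult_ac)
    moreover have "p / B / c = 1 / (B * q ^ n)" using p0 by (simp add: c_def)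
    ultimately show ?thesis using qpoch_inf_invB_nonzero[of n] by (simp add: g'_def)
  qed
  have g_hol: "(\<lambda>x. g (f x)) holomorphic_on - {0}" if "f holomorphic_on - {0}" for f
    unfolding g_def by (intro holomorphic_intros that q)
  have g'_hol: "g' holomorphic_on - {0}" unfolding g'_def by (intro holomorphic_intros q) auto
  have pf1: "prefac x = qpoch_inf (p * (1 / x)) q * g' x" for x by (simp add: prefac_def g'_def mult_ac)
  have pf2: "prefac x = qpoch_inf (p * x) q * g' (1 / x)" for x by (simp add: prefac_def g'_def mult_ac)
  from a show ?thesis
  proof
    assume a: "a = p * q ^ n"
    have "(\<lambda>x. g (1 / x) * g' x / x) holomorphic_on - {0}"
      by (intro holomorphic_intros g_hol g'_hol) auto
    moreover have "g (1 / a) * g' a / a \<noteq> 0" using gnz g'nz c0 by (simp add: a c_def)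
    moreover have "prefac x = (x - a) * (g (1 / x) * g' x / x)" if "x \<in> - {0}" for x
      using that unfolding pf1 split a c_def[symmetric] by (simp add: field_simps)
    ultimately show ?thesis by blast
  next
    assume a: "a = 1 / (p * q ^ n)"
    have "(g' \<circ> (\<lambda>x. 1 / x)) holomorphic_on - {0}"
      by (intro holomorphic_on_compose_gen[OF _ g'_hol] holomorphic_intros) auto
    hence "(\<lambda>x. - c * g x * g' (1 / x)) holomorphic_on - {0}"
      by (intro holomorphic_intros g_hol) (auto simp: o_def)
    moreover have "- c * g a * g' (1 / a) \<noteq> 0" using gnz g'nz c0 by (simp add: a c_def)
    moreover have "prefac x = (x - a) * (- c * g x * g' (1 / x))" if "x \<in> - {0}" for x
      using that c0 unfolding pf2 split a c_def[symmetric] by (simp add: field_simps)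
    ultimately show ?thesis by blast
  qed
qed

lemma summable_ctau: "summable (\<lambda>k. norm (ctau k) / sqrt (norm q) ^ k)" "summable (\<lambda>k. norm (ctau k))"
proof -
  define r where "r = norm q"
  have r: "0 < r" "r < 1" using q q0 by (auto simp: r_def)
  obtain C1 where C1: "\<And>k. norm (1 / qpoch q q k) \<le> C1"
    using inverse_qpoch_bounded[OF q qpoch_inf_nonzero[OF q q]] by blast
  obtain C2 where C2: "\<And>k. norm (1 / qpoch (s * p) q k) \<le> C2"
    using inverse_qpoch_bounded[OF q qpoch_inf_nonzero[OF q nsp]] by blast
  obtain C3 where C3: "\<And>k. norm (1 / qpoch (p ^ 2 / B) q k) \<le> C3"
    using inverse_qpoch_bounded[OF q qpoch_inf_nonzero[OF q nA]] by blast
  have pos: "0 \<le> C1" "0 \<le> C2" "0 \<le> C3"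
    using order_trans[OF norm_ge_zero C1] order_trans[OF norm_ge_zero C2] order_trans[OF norm_ge_zero C3] by auto
  define N where "N = norm (s * p / B)"
  have le: "norm (ctau k) \<le> C1 * C2 * C3 * (N ^ k * r ^ (k choose 2))" for k
  proof -
    have "norm (ctau k) = norm (1 / qpoch q q k) * norm (1 / qpoch (s * p) q k) * norm (1 / qpoch (p ^ 2 / B) q k) * (N ^ k * r ^ (k choose 2))"
      by (simp add: ctau_def N_def r_def norm_mult norm_divide norm_power power_divide power_mult_distrib)
    also have "\<dots> \<le> C1 * C2 * C3 * (N ^ k * r ^ (k choose 2))"
      using r by (intro mult_right_mono mult_mono C1 C2 C3) (auto simp: pos N_def)
    finally show ?thesis .
  qed
  have 1: "norm (ctau k) / sqrt r ^ k \<le> C1 * C2 * C3 * ((N / sqrt r) ^ k * r ^ (k choose 2))" for k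
    using divide_right_mono[OF le[of k], of "sqrt r ^ k"] r by (simp add: power_divide)
  show "summable (\<lambda>k. norm (ctau k) / sqrt (norm q) ^ k)"
    unfolding r_def[symmetric]
    by (rule summable_comparison_test'[of "\<lambda>k. C1 * C2 * C3 * ((N / sqrt r) ^ k * r ^ (k choose 2))" 0])
       (use r 1 in \<open>auto intro!: summable_mult summable_gauss_power simp: N_def\<close>)
  show "summable (\<lambda>k. norm (ctau k))"
    by (rule summable_comparison_test'[of "\<lambda>k. C1 * C2 * C3 * (N ^ k * r ^ (k choose 2))" 0])
       (use r le in \<open>auto intro!: summable_mult summable_gauss_power simp: N_def\<close>)
qed

lemma ct_bound: obtains C where "C \<ge> 0" "\<And>k. norm (ct k) \<le> C * norm q ^ k"
proof -
  have nz: "qpoch_inf (q * B) q \<noteq> 0"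
  proof
    assume "qpoch_inf (q * B) q = 0"
    then obtain j where "q * B * q ^ j = 1" by (auto simp: qpoch_inf_eq_0_iff[OF q])
    thus False using nB1[of "Suc j"] by (simp add: mult_ac)
  qed
  obtain C1 where C1: "\<And>k. norm (1 / qpoch q q k) \<le> C1"
    using inverse_qpoch_bounded[OF q qpoch_inf_nonzero[OF q q]] by blast
  obtain C2 where C2: "\<And>k. norm (1 / qpoch (q * B) q k) \<le> C2"
    using inverse_qpoch_bounded[OF q nz] by blast
  obtain C3 where C3: "\<And>k. norm (1 / qpoch (s * p) q k) \<le> C3"
    using inverse_qpoch_bounded[OF q qpoch_inf_nonzero[OF q nsp]] by blast
  obtain C4 where C4: "\<And>k. norm (1 / qpoch (p ^ 2) q k) \<le> C4"
    using inverse_qpoch_bounded[OF q qpoch_inf_nonzero[OF q np2]] by blast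
  obtain C5 where C5: "\<And>k. norm (1 / qpoch (p ^ 2 / B) q k) \<le> C5"
    using inverse_qpoch_bounded[OF q qpoch_inf_nonzero[OF q nA]] by blast
  have pos: "0 \<le> C1" "0 \<le> C2" "0 \<le> C3" "0 \<le> C4" "0 \<le> C5"
    using order_trans[OF norm_ge_zero C1] order_trans[OF norm_ge_zero C2] order_trans[OF norm_ge_zero C3]
      order_trans[OF norm_ge_zero C4] order_trans[OF norm_ge_zero C5] by auto
  define E where "E = exp (1 / (1 - norm q))"
  define C where "C = E * E * E * (C1 * C2 * C3 * C4 * C5)"
  have "norm (ct k) \<le> C * norm q ^ k" for k
  proof -
    have "norm (ct k) = norm (qpoch p q k) * norm (qpoch (- p) q k) * norm (qpoch (- (s * p)) q k)
      * (norm (1 / qpoch q q k) * norm (1 / qpoch (q * B) q k) * norm (1 / qpoch (s * p) q k) * norm (1 / qpoch (p ^ 2) q k)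
         * norm (1 / qpoch (p ^ 2 / B) q k)) * norm q ^ k"
      by (simp add: ct_def norm_mult norm_divide norm_power)
    also have "\<dots> \<le> C * norm q ^ k"
      unfolding C_def E_def using np nsp
      by (intro mult_right_mono mult_mono norm_qpoch_le[OF q] C1 C2 C3 C4 C5) (auto simp: pos intro!: mult_nonneg_nonneg)
    finally show ?thesis .
  qed
  moreover have "C \<ge> 0" unfolding C_def E_def using pos by auto
  ultimately show ?thesis using that by blast
qed

text \<open>Dividing the geometric bound of \<open>ct_bound\<close> by the powers of sqrt |q| leaves
  a geometric series of ratio sqrt |q|.\<close>

lemma summable_ct: "summable (\<lambda>k. norm (ct k) / sqrt (norm q) ^ k)" "summable (\<lambda>k. norm (ct k))"
proof -
  define r where "r = norm q"
  have r: "0 < r" "r < 1" using q q0 by (auto simp: r_def)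
  obtain C where C: "C \<ge> 0" "\<And>k. norm (ct k) \<le> C * r ^ k" using ct_bound unfolding r_def by blast
  have e: "r ^ k = sqrt r ^ k * sqrt r ^ k" for k using r by (simp flip: power_mult_distrib)
  have 1: "norm (ct k) / sqrt r ^ k \<le> C * sqrt r ^ k" for k
    using C(2)[of k] r unfolding e by (simp add: pos_divide_le_eq mult_ac)
  show "summable (\<lambda>k. norm (ct k) / sqrt (norm q) ^ k)"
    unfolding r_def[symmetric]
    by (rule summable_comparison_test'[of "\<lambda>k. C * sqrt r ^ k" 0])
       (use r 1 in \<open>auto intro!: summable_mult summable_geometric\<close>)
  show "summable (\<lambda>k. norm (ct k))"
    by (rule summable_comparison_test'[of "\<lambda>k. C * r ^ k" 0])
       (use r C in \<open>auto intro!: summable_mult summable_geometric\<close>)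
qed

lemma T_W_holomorphic: "T holomorphic_on (- {0})" "W holomorphic_on (- {0})"
  unfolding T_def W_def
  by (intro holomorphic_intros q holomorphic_on_ksum summable_ct summable_ctau; auto)+

lemma T_W_inverse: "T (1 / x) = T x" "W (1 / x) = W x"
  using ksum_inverse[OF q, of ct p x] ksum_inverse[OF q, of ctau p x] by (simp_all add: T_def W_def mult_ac)

end

text \<open>The second copy of the parameters is the image of the first one under \<open>\<beta> \<mapsto> 1 / \<beta>\<close>, where
  \<open>p = A \<beta>\<close> and \<open>B = \<beta>\<^sup>2\<close>.\<close>

locale clausen_pair = clausen q s p B + dual: clausen q s "p / B" "1 / B" for q s p B
begin

text \<open>This is \<open>phi22_reflect\<close> for a square root \<beta> of B: its two sides are
  exchanged by \<beta> to 1 / \<beta>.\<close>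

lemma W_dual:
  assumes x: "x \<noteq> 0" shows "dual.W x = W x"
proof -
  define \<beta> where "\<beta> = csqrt B"
  define A where "A = p / \<beta>"
  have \<beta>: "\<beta> ^ 2 = B" "\<beta> \<noteq> 0" using B0 by (auto simp: \<beta>_def)
  have A: "A * \<beta> = p" "A / \<beta> = p / B" "A ^ 2 = p ^ 2 / B"
    using \<beta> by (simp_all add: A_def power_divide power2_eq_square)
  have "A * x / \<beta> = A / \<beta> * x" "A / (\<beta> * x) = A / \<beta> / x" "s * A * \<beta> = s * (A * \<beta>)" "s * A / \<beta> = s * (A / \<beta>)"
    by simp_all
  hence e: "A * x / \<beta> = p / B * x" "A / (\<beta> * x) = p / B / x" "s * A * \<beta> = s * p" "s * A / \<beta> = s * p / B"
    unfolding A by simp_all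
  have "norm (A ^ 2) < 1" "norm (s * A * \<beta>) < 1" "norm (s * A / \<beta>) < 1"
    unfolding A e using nA nsp dual.nsp by simp_all
  from phi22_reflect[OF q s x \<beta>(2) this] show ?thesis
    unfolding dual.W_eq_phi22 W_eq_phi22 e A using B0 by (simp add: power_divide power2_eq_square)
qed

text \<open>The expression is symmetric under duality, so its zeros at p q^n yield those at p q^n /
  B.\<close>

definition D :: "complex \<Rightarrow> complex" where
  "D x = T x + dual.T x - W x * dual.W x"

lemma dual_prefac: "dual.prefac = prefac"
  using B0 by (simp add: fun_eq_iff prefac_def dual.prefac_def mult_ac)

lemma D_zero:
  assumes "a = p * q ^ n \<or> a = 1 / (p * q ^ n)" shows "D a = 0"
proof -
  have "D (p * q ^ n) = 0"
  proof -
    have "p * q ^ n \<noteq> 0" using p0 q0 by simp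
    \<comment> \<open>\<open>dual.T\<close> carries the factor (p / x)_inf, which vanishes at x = p
      q^n.\<close>
    moreover have "dual.T (p * q ^ n) = 0"
    proof -
      have "qpoch_inf (p / B / (1 / B) / (p * q ^ n)) q = 0"
        unfolding qpoch_inf_eq_0_iff[OF q] using p0 q0 B0 by (intro exI[of _ n]) simp
      thus ?thesis by (simp only: dual.T_def mult_zero_right)
    qed
    ultimately show ?thesis by (simp add: D_def T_terminating W_dual power2_eq_square)
  qed
  moreover have "D (1 / x) = D x" for x by (simp add: D_def T_W_inverse dual.T_W_inverse)
  ultimately show ?thesis using assms by auto
qed

lemma D_zero_dual:
  assumes "a = p / B * q ^ n \<or> a = 1 / (p / B * q ^ n)" shows "D a = 0"
proof -
  \<comment> \<open>The dual of the dual parameters is the original set, so starting from p / B and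
    1 / B gives the same \<open>D\<close>.\<close>
  have "clausen q s (p / B / (1 / B)) (1 / (1 / B))" using clausen_axioms B0 by simp
  then interpret swap: clausen_pair q s "p / B" "1 / B"
    by (intro clausen_pair.intro dual.clausen_axioms)
  have "swap.D a = D a"
    unfolding swap.D_def D_def using B0 by (simp add: mult.commute)
  thus ?thesis using swap.D_zero[OF assms] by simp
qed

lemma prefac_zero:
  assumes "a \<noteq> 0" "prefac a = 0"
  shows "D a = 0 \<and> (\<exists>v. v holomorphic_on (- {0}) \<and> v a \<noteq> 0 \<and> (\<forall>x\<in>- {0}. prefac x = (x - a) * v x))"
proof -
  from assms(2) obtain n where "p * a * q ^ n = 1 \<or> p / a * q ^ n = 1 \<or> p / B * a * q ^ n = 1 \<or> p / B / a * q ^ n = 1"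
    by (auto simp: prefac_def qpoch_inf_eq_0_iff[OF q])
  moreover have "a = p * q ^ n \<or> a = 1 / (p * q ^ n)" if "p * a * q ^ n = 1 \<or> p / a * q ^ n = 1"
    using that assms(1) p0 q0 by (auto simp: divide_simps mult_ac)
  moreover have "a = p / B * q ^ n \<or> a = 1 / (p / B * q ^ n)" if "p / B * a * q ^ n = 1 \<or> p / B / a * q ^ n = 1"
    using that assms(1) p0 q0 B0 by (auto simp: divide_simps mult_ac)
  ultimately consider "a = p * q ^ n \<or> a = 1 / (p * q ^ n)" | "a = p / B * q ^ n \<or> a = 1 / (p / B * q ^ n)" by blast
  thus ?thesis
    using D_zero prefac_simple_zero D_zero_dual dual.prefac_simple_zero unfolding dual_prefac by cases blast+
qed

lemma D_inverse: "D (1 / x) = D x"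
  by (simp add: D_def T_W_inverse dual.T_W_inverse)

theorem D_eq_0:
  assumes x0: "x0 \<noteq> 0" shows "D x0 = 0"
proof -
  define r where "r = norm q"
  have r: "0 < r" "r < 1" using q q0 by (auto simp: r_def)
  have pB0: "p / B \<noteq> 0" using p0 B0 by simp
  have "D holomorphic_on (- {0})"
    unfolding D_def[abs_def] by (intro holomorphic_intros T_W_holomorphic dual.T_W_holomorphic)
  note D_hol = this
  have "\<exists>h. h holomorphic_on (- {0}) \<and> (\<forall>x\<in>- {0}. D x = prefac x * h x)"
  proof (rule holomorphic_quotient[OF _ D_hol prefac_holomorphic])
    show "open (- {0 :: complex})" by auto
  next
    fix a :: complex assume "a \<in> - {0}" "prefac a = 0"
    thus "D a = 0 \<and> (\<exists>v. v holomorphic_on (- {0}) \<and> v a \<noteq> 0 \<and> (\<forall>x\<in>- {0}. prefac x = (x - a) * v x))"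
      by (intro prefac_zero) simp
  next
    fix h assume "h holomorphic_on (- {0})" "\<And>x. x \<in> - {0} \<Longrightarrow> D x = prefac x * h x"
    thus "\<exists>h. h holomorphic_on (- {0}) \<and> (\<forall>x\<in>- {0}. D x = prefac x * h x)" by blast
  qed
  then obtain h where h: "h holomorphic_on (- {0})" "\<And>x. x \<in> - {0} \<Longrightarrow> D x = prefac x * h x" by blast
  \<comment> \<open>The radii R for which some circle |x| = R / |q|^n could meet a zero of (p x)_inf
    or of (p x / B)_inf. There are only countably many.\<close>
  define Bad where "Bad = (\<lambda>p. range (\<lambda>j. 1 / (norm p * r ^ j)) \<union> range (\<lambda>j. r ^ j / norm (p::complex)))"
  have "uncountable ({1<..<2::real} - (Bad p \<union> Bad (p / B)))"
    by (rule uncountable_minus_countable) (auto simp: Bad_def uncountable_open_interval)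
  then obtain R where R: "1 < R" "R \<notin> Bad p" "R \<notin> Bad (p / B)"
    by (metis (no_types, lifting) DiffE UnCI countable_empty equals0I greaterThanLessThan_iff)
  have bad: "norm u * R * norm q ^ j \<noteq> 1 \<and> norm u * R \<noteq> norm q ^ j" if "R \<notin> Bad u" "u \<noteq> 0" for u j
    using that r unfolding Bad_def r_def by (auto simp: field_simps)
  have R0: "R > 0" using R by simp
  obtain C1 where C1: "C1 > 0" "\<And>n x. norm x = R / norm q ^ n \<Longrightarrow> norm x \<ge> 2 * norm p \<Longrightarrow>
      norm (ksum q ct p x) \<le> C1 / sqrt (norm x) * norm (qpoch_inf (p * x) q * qpoch_inf (p / x) q)
      \<and> qpoch_inf (p * x) q * qpoch_inf (p / x) q \<noteq> 0"
    by (rule ksum_circle_bound[OF q q0 p0 R0 _ _ summable_ct(1)]) (use bad[OF R(2) p0] in blast)+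
  obtain C2 where C2: "C2 > 0" "\<And>n x. norm x = R / norm q ^ n \<Longrightarrow> norm x \<ge> 2 * norm p \<Longrightarrow>
      norm (ksum q ctau p x) \<le> C2 / sqrt (norm x) * norm (qpoch_inf (p * x) q * qpoch_inf (p / x) q)
      \<and> qpoch_inf (p * x) q * qpoch_inf (p / x) q \<noteq> 0"
    by (rule ksum_circle_bound[OF q q0 p0 R0 _ _ summable_ctau(1)]) (use bad[OF R(2) p0] in blast)+
  obtain C3 where C3: "C3 > 0" "\<And>n x. norm x = R / norm q ^ n \<Longrightarrow> norm x \<ge> 2 * norm (p / B) \<Longrightarrow>
      norm (ksum q dual.ct (p / B) x) \<le> C3 / sqrt (norm x) * norm (qpoch_inf (p / B * x) q * qpoch_inf (p / B / x) q)
      \<and> qpoch_inf (p / B * x) q * qpoch_inf (p / B / x) q \<noteq> 0"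
    by (rule ksum_circle_bound[OF q q0 pB0 R0 _ _ dual.summable_ct(1)]) (use bad[OF R(3) pB0] in blast)+
  obtain C4 where C4: "C4 > 0" "\<And>n x. norm x = R / norm q ^ n \<Longrightarrow> norm x \<ge> 2 * norm (p / B) \<Longrightarrow>
      norm (ksum q dual.ctau (p / B) x) \<le> C4 / sqrt (norm x) * norm (qpoch_inf (p / B * x) q * qpoch_inf (p / B / x) q)
      \<and> qpoch_inf (p / B * x) q * qpoch_inf (p / B / x) q \<noteq> 0"
    by (rule ksum_circle_bound[OF q q0 pB0 R0 _ _ dual.summable_ctau(1)]) (use bad[OF R(3) pB0] in blast)+
  define k1 where "k1 = norm (qpoch_inf (s * p) q ^ 2 * qpoch_inf (p ^ 2 / B) q / qpoch_inf (1 / B) q)"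
  define k2 where "k2 = norm (qpoch_inf (s * p) q * qpoch_inf (p ^ 2 / B) q)"
  define k3 where "k3 = norm (qpoch_inf (s * (p / B)) q ^ 2 * qpoch_inf ((p / B) ^ 2 / (1 / B)) q / qpoch_inf (1 / (1 / B)) q)"
  define k4 where "k4 = norm (qpoch_inf (s * (p / B)) q * qpoch_inf ((p / B) ^ 2 / (1 / B)) q)"
  define M where "M = k1 * C1 + k3 * C3 + k2 * C2 * (k4 * C4)"
  have k: "k1 \<ge> 0" "k2 \<ge> 0" "k3 \<ge> 0" "k4 \<ge> 0" by (simp_all add: k1_def k2_def k3_def k4_def)
  have M: "M \<ge> 0" unfolding M_def using k C1(1) C2(1) C3(1) C4(1) by (intro add_nonneg_nonneg mult_nonneg_nonneg) auto
  \<comment> \<open>Relative to \<open>prefac\<close>, each of \<open>T\<close> and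
    \<open>dual.T\<close> decays like |x|^(-1/2) and the product of \<open>W\<close> and
    \<open>dual.W\<close> like 1 / |x|. Invariance of \<open>D\<close> and \<open>prefac\<close>
    under inversion transfers the bound to 1 / x.\<close>
  have circle: "norm (h x) \<le> M / sqrt (R / r ^ n) \<and> norm (h (1 / x)) \<le> M / sqrt (R / r ^ n)"
    if x: "norm x = R / r ^ n" and big: "norm x \<ge> 2 * norm p" "norm x \<ge> 2 * norm (p / B)" for x n
  proof -
    define u where "u = qpoch_inf (p * x) q * qpoch_inf (p / x) q"
    define v where "v = qpoch_inf (p / B * x) q * qpoch_inf (p / B / x) q"
    have xn: "norm x = R / norm q ^ n" using x by (simp add: r_def)
    have x1: "norm x \<ge> 1" using R r unfolding x by (simp add: le_divide_eq power_le_one order_trans[OF power_le_one])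
    have x0: "x \<noteq> 0" using x1 by auto
    define S where "S = 1 / sqrt (norm x)"
    have S1: "1 \<le> sqrt (norm x)" using x1 by simp
    hence "0 < sqrt (norm x)" by linarith
    with S1 have S: "0 < S" "S \<le> 1" by (simp_all add: S_def divide_le_eq del: real_sqrt_gt_0_iff)
    have SS: "S * S \<le> S" using S by (simp add: mult_left_le)
    have uv: "u \<noteq> 0" "v \<noteq> 0" "norm (ksum q ct p x) \<le> C1 * S * norm u" "norm (ksum q ctau p x) \<le> C2 * S * norm u"
      "norm (ksum q dual.ct (p / B) x) \<le> C3 * S * norm v" "norm (ksum q dual.ctau (p / B) x) \<le> C4 * S * norm v"
      using C1(2)[OF xn big(1)] C2(2)[OF xn big(1)] C3(2)[OF xn big(2)] C4(2)[OF xn big(2)]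
      unfolding u_def v_def S_def by simp_all
    have "norm (T x) = k1 * norm (ksum q ct p x) * norm v"
      unfolding T_def k1_def v_def norm_mult by (simp only: mult_ac)
    also have "\<dots> \<le> k1 * (C1 * S * norm u) * norm v" by (intro mult_left_mono mult_right_mono uv k) auto
    finally have 1: "norm (T x) \<le> (k1 * C1) * S * norm (u * v)" by (simp add: norm_mult mult_ac)
    have pB: "p / B / (1 / B) = p" using B0 by simp
    have "norm (dual.T x) = k3 * norm (ksum q dual.ct (p / B) x) * norm u"
      unfolding dual.T_def k3_def u_def norm_mult pB by (simp only: mult_ac)
    also have "\<dots> \<le> k3 * (C3 * S * norm v) * norm u" by (intro mult_left_mono mult_right_mono uv k) auto
    finally have 2: "norm (dual.T x) \<le> (k3 * C3) * S * norm (u * v)" by (simp add: norm_mult mult_ac)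
    have "norm (W x * dual.W x) = (k2 * norm (ksum q ctau p x)) * (k4 * norm (ksum q dual.ctau (p / B) x))"
      unfolding W_def dual.W_def k2_def k4_def norm_mult by simp
    also have "\<dots> \<le> (k2 * (C2 * S * norm u)) * (k4 * (C4 * S * norm v))"
      using k C2(1) C4(1) S by (intro mult_mono mult_left_mono uv mult_nonneg_nonneg) auto
    also have "\<dots> = (k2 * C2 * (k4 * C4)) * norm (u * v) * (S * S)" by (simp add: norm_mult mult_ac)
    also have "\<dots> \<le> (k2 * C2 * (k4 * C4)) * norm (u * v) * S"
      using SS k C2(1) C4(1) by (intro mult_left_mono) auto
    finally have 3: "norm (W x * dual.W x) \<le> (k2 * C2 * (k4 * C4)) * S * norm (u * v)" by (simp add: mult_ac)
    have "norm (D x) \<le> norm (T x) + norm (dual.T x) + norm (W x * dual.W x)"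
      unfolding D_def by (intro order_trans[OF norm_triangle_ineq4] add_right_mono norm_triangle_ineq)
    also have "\<dots> \<le> M * S * norm (u * v)" using 1 2 3 unfolding M_def by (simp add: algebra_simps)
    finally have Dle: "norm (D x) \<le> M * S * norm (u * v)" .
    have pf: "prefac x = u * v" by (simp add: prefac_def u_def v_def)
    have "norm (u * v) * norm (h x) \<le> norm (u * v) * (M * S)"
      using Dle h(2)[of x] x0 by (simp add: pf norm_mult mult_ac)
    hence hx: "norm (h x) \<le> M * S" using uv(1,2) by simp
    have "prefac (1 / x) * h (1 / x) = prefac x * h x"
      using h(2)[of x] h(2)[of "1 / x"] x0 D_inverse[of x] by simp
    hence "h (1 / x) = h x" using uv(1,2) by (simp add: prefac_inverse pf)
    thus ?thesis using hx by (simp add: S_def x)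
  qed
  \<comment> \<open>The maximum principle is applied on annuli 1 / \<rho> \<le> |z| \<le> \<rho>,
    whose boundary circles are exchanged by inversion; the possible singularity at 0 needs no
    analysis.\<close>
  have "norm (h x0) \<le> 0"
  proof (rule LIMSEQ_le_const)
    have "(\<lambda>n. M / sqrt R * sqrt r ^ n) \<longlonglongrightarrow> 0"
      by (intro tendsto_mult_right_zero LIMSEQ_power_zero) (use r in auto)
    moreover have "M / sqrt (R / r ^ n) = M / sqrt R * sqrt r ^ n" for n
      using r by (simp add: real_sqrt_divide real_sqrt_power)
    ultimately show "(\<lambda>n. M / sqrt (R / r ^ n)) \<longlonglongrightarrow> 0" by simp
    \<comment> \<open>A radius above L makes the annulus contain x0 and satisfies the lower bounds
      on |x| in \<open>circle\<close>.\<close>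
    define L where "L = max (max (2 * norm p) (2 * norm (p / B))) (max (norm x0) (1 / norm x0))"
    have "filterlim (\<lambda>m. inverse (r ^ m)) at_top sequentially"
      using r by (intro filterlim_inverse_at_top LIMSEQ_power_zero) (auto intro!: always_eventually)
    hence "eventually (\<lambda>m. inverse (r ^ m) \<ge> L) sequentially" by (simp add: filterlim_at_top)
    then obtain N where N: "\<And>m. m \<ge> N \<Longrightarrow> inverse (r ^ m) \<ge> L" by (auto simp: eventually_sequentially)
    have "norm (h x0) \<le> M / sqrt (R / r ^ n)" if n: "n \<ge> N" for n
    proof -
      define \<rho> where "\<rho> = R / r ^ n"
      have "inverse (r ^ n) * 1 \<le> inverse (r ^ n) * R" using R r by (intro mult_left_mono) auto
      hence "L \<le> \<rho>" using N[OF n] by (simp add: \<rho>_def divide_inverse mult.commute)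
      hence \<rho>: "2 * norm p \<le> \<rho>" "2 * norm (p / B) \<le> \<rho>" "norm x0 \<le> \<rho>" "1 / norm x0 \<le> \<rho>"
        by (auto simp: L_def)
      have \<rho>0: "\<rho> > 0" using R r by (simp add: \<rho>_def)
      define S where "S = {x::complex. 1 / \<rho> \<le> norm x \<and> norm x \<le> \<rho>}"
      have Seq: "S = cball 0 \<rho> - ball 0 (1 / \<rho>)" by (auto simp: S_def)
      have clS: "closed S" unfolding Seq by (intro closed_Diff) auto
      have S0: "S \<subseteq> - {0}" using \<rho>0 by (auto simp: S_def not_le)
      show ?thesis
      proof (rule maximum_modulus_frontier[of h S])
        show "h holomorphic_on interior S"
          by (rule holomorphic_on_subset[OF h(1)]) (use S0 interior_subset in blast)
        show "continuous_on (closure S) h"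
          unfolding closure_closed[OF clS]
          by (rule continuous_on_subset[OF holomorphic_on_imp_continuous_on[OF h(1)] S0])
        show "bounded S" by (rule bounded_subset[OF bounded_cball[of 0 \<rho>]]) (auto simp: Seq)
        show "x0 \<in> S" using \<rho> x0 \<rho>0 by (simp add: S_def field_simps)
        fix z assume z: "z \<in> frontier S"
        have zS: "z \<in> S" using z clS frontier_subset_closed by blast
        have "norm z = \<rho> \<or> norm z = 1 / \<rho>"
        proof (rule ccontr)
          assume "\<not> ?thesis"
          hence "z \<in> ball 0 \<rho> - cball 0 (1 / \<rho>)" using zS by (auto simp: S_def)
          moreover have "open (ball 0 \<rho> - cball (0::complex) (1 / \<rho>))" by (intro open_Diff) auto
          moreover have "ball 0 \<rho> - cball 0 (1 / \<rho>) \<subseteq> S" by (auto simp: S_def)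
          ultimately have "z \<in> interior S" by (meson interior_maximal subsetD)
          thus False using z by (simp add: frontier_def)
        qed
        thus "norm (h z) \<le> M / sqrt (R / r ^ n)"
        proof
          assume "norm z = \<rho>"
          thus ?thesis using circle[of z n] \<rho> by (simp add: \<rho>_def)
        next
          assume "norm z = 1 / \<rho>"
          hence "norm (1 / z) = \<rho>" by (simp add: norm_divide)
          thus ?thesis using circle[of "1 / z" n] \<rho> by (simp add: \<rho>_def)
        qed
      qed
    qed
    thus "\<exists>N. \<forall>n\<ge>N. norm (h x0) \<le> M / sqrt (R / r ^ n)" by blast
  qed
  thus ?thesis using h(2)[of x0] x0 by simp
qed

end

subsection \<open>Summing residues in a punctured disc\<close>

lemma has_integral_periodic_shift:
  fixes g :: "real \<Rightarrow> complex"
  assumes g: "(g has_integral I) {0..2 * pi}" and per: "\<And>t. g (t + 2 * pi) = g t"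
  shows "(g has_integral I) {- pi..pi}"
proof -
  have "g integrable_on {0..2 * pi}" using g by (rule has_integral_integrable)
  hence "g integrable_on {0..pi}" "g integrable_on {pi..2 * pi}"
    by (auto intro: integrable_on_subinterval)
  then obtain I1 I2 where I: "(g has_integral I1) {0..pi}" "(g has_integral I2) {pi..2 * pi}"
    by (auto simp: integrable_on_def)
  have "(g has_integral (I1 + I2)) {0..2 * pi}"
    by (rule has_integral_combine[OF _ _ I]) auto
  with g have "I = I1 + I2" by (rule has_integral_unique)
  moreover have "(g has_integral I2) {- pi..0}"
    using has_integral_shift_real_ivl[OF I(2), of "2 * pi"] by (simp add: per)
  hence "(g has_integral (I2 + I1)) {- pi..pi}"
    by (rule has_integral_combine[rotated 2]) (use I(1) in auto)
  ultimately show ?thesis by (simp add: add.commute)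
qed

text \<open>Subtracting the principal parts leaves removable singularities, and the remaining
  function has equal integrals over both circles. Each principal part contributes 2 pi i times its
  coefficient on the outer circle and nothing on the inner one.\<close>

lemma annulus_residues:
  fixes f :: "complex \<Rightarrow> complex" and p :: "'i \<Rightarrow> complex"
  assumes X: "finite X" "inj_on p X" and r: "0 < r" "r \<le> R"
    and U: "open U" and annulus: "\<And>u. r \<le> norm u \<Longrightarrow> norm u \<le> R \<Longrightarrow> u \<in> U"
    and f: "f holomorphic_on (U - p ` X)"
    and loc: "\<And>i. i \<in> X \<Longrightarrow> r < norm (p i) \<and> norm (p i) < R"
    and pole: "\<And>i. i \<in> X \<Longrightarrow> \<exists>T. open T \<and> p i \<in> T \<and> \<phi> i holomorphic_on T \<and> (\<forall>u\<in>T - {p i}. f u = \<phi> i u / (u - p i))"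
  shows "contour_integral (circlepath 0 R) f = contour_integral (circlepath 0 r) f + 2 * pi * \<i> * (\<Sum>i\<in>X. \<phi> i (p i))"
proof -
  define s where "s = (\<lambda>u. \<Sum>i\<in>X. \<phi> i (p i) / (u - p i))"
  \<comment> \<open>The limit of f - s at the pole p i: the derivative of \<phi> i there minus the
    principal parts belonging to the other poles.\<close>
  define L where "L = (\<lambda>i. deriv (\<phi> i) (p i) - (\<Sum>j\<in>X - {i}. \<phi> j (p j) / (p i - p j)))"
  define h where "h = (\<lambda>u. if u \<in> p ` X then L (the_inv_into X p u) else f u - s u)"
  have R0: "R > 0" using r by simp
  have hol: "h holomorphic_on U"
  proof (rule no_isolated_singularity'[OF _ _ U])
    show "finite (p ` X)" using X by simp
    have "s holomorphic_on (U - p ` X)" unfolding s_def by (intro holomorphic_intros) auto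
    hence "(\<lambda>u. f u - s u) holomorphic_on (U - p ` X)" by (intro holomorphic_intros f)
    thus "h holomorphic_on (U - p ` X)" by (rule holomorphic_transform) (auto simp: h_def)
    fix z assume "z \<in> p ` X"
    then obtain i where i: "i \<in> X" "z = p i" by auto
    from pole[OF i(1)] obtain T where T: "open T" "p i \<in> T" "\<phi> i holomorphic_on T" "\<And>u. u \<in> T - {p i} \<Longrightarrow> f u = \<phi> i u / (u - p i)"
      by blast
    have "(\<phi> i has_field_derivative deriv (\<phi> i) (p i)) (at (p i))"
      using T by (intro holomorphic_derivI)
    hence "((\<lambda>u. (\<phi> i u - \<phi> i (p i)) / (u - p i)) \<longlongrightarrow> deriv (\<phi> i) (p i)) (at (p i))"
      by (simp add: has_field_derivative_iff)
    moreover have "((\<lambda>u. \<Sum>j\<in>X - {i}. \<phi> j (p j) / (u - p j)) \<longlongrightarrow> (\<Sum>j\<in>X - {i}. \<phi> j (p j) / (p i - p j))) (at (p i))"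
    proof (intro tendsto_sum tendsto_divide tendsto_diff tendsto_const tendsto_ident_at)
      fix j assume "j \<in> X - {i}"
      thus "p i - p j \<noteq> 0" using X(2) i(1) by (auto dest: inj_onD)
    qed
    ultimately have lim: "((\<lambda>u. (\<phi> i u - \<phi> i (p i)) / (u - p i) - (\<Sum>j\<in>X - {i}. \<phi> j (p j) / (u - p j))) \<longlongrightarrow> L i) (at (p i))"
      unfolding L_def by (rule tendsto_diff)
    have o: "open (T - p ` (X - {i}))" using X(1) T(1) by (intro open_Diff finite_imp_closed) auto
    have "p i \<in> T - p ` (X - {i})" using X(2) i(1) T(2) by (auto dest: inj_onD)
    from eventually_at_in_open[OF o this]
    have "eventually (\<lambda>u. (\<phi> i u - \<phi> i (p i)) / (u - p i) - (\<Sum>j\<in>X - {i}. \<phi> j (p j) / (u - p j)) = h u) (at (p i))"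
    proof eventually_elim
      case (elim u)
      hence u: "u \<in> T - {p i}" "u \<notin> p ` X" by auto
      have "s u = \<phi> i (p i) / (u - p i) + (\<Sum>j\<in>X - {i}. \<phi> j (p j) / (u - p j))"
        unfolding s_def using X(1) i(1) by (subst sum.remove) auto
      thus ?case using u(2) T(4)[OF u(1)] by (simp add: h_def diff_divide_distrib)
    qed
    with lim have "(h \<longlongrightarrow> L i) (at (p i))" by (rule Lim_transform_eventually)
    moreover have "h z = L i" using i X(2) by (simp add: h_def the_inv_into_f_f)
    ultimately show "(h \<longlongrightarrow> h z) (at z within U)"
      using i(2) by (auto intro: tendsto_within_subset)
  qed
  have sub: "path_image (circlepath 0 \<rho>) \<subseteq> U - p ` X" "path_image (circlepath 0 \<rho>) \<subseteq> U" if "\<rho> = r \<or> \<rho> = R" for \<rho>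
    using that annulus loc r R0 by fastforce+
  have "contour_integral (circlepath 0 R) h = contour_integral (circlepath 0 r) h"
  proof (rule Cauchy_theorem_homotopic_loops[OF _ U hol])
    show "homotopic_loops U (circlepath 0 R) (circlepath 0 r)"
    proof (rule homotopic_loops_linear)
      fix t x :: real assume "t \<in> {0..1}"
      show "closed_segment (circlepath 0 R t) (circlepath 0 r t) \<subseteq> U"
      proof
        fix u assume "u \<in> closed_segment (circlepath 0 R t) (circlepath 0 r t)"
        then obtain v where v: "0 \<le> v" "v \<le> 1" "u = (1 - v) *\<^sub>R circlepath 0 R t + v *\<^sub>R circlepath 0 r t"
          by (auto simp: closed_segment_def)
        have "u = of_real ((1 - v) * R + v * r) * exp (2 * of_real pi * \<i> * of_real t)"
          unfolding v(3) by (simp add: circlepath scaleR_conv_of_real algebra_simps)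
        hence "norm u = \<bar>(1 - v) * R + v * r\<bar>"
          by (simp add: norm_mult norm_exp_eq_Re del: of_real_add of_real_mult)
        moreover have "(1 - v) * R + v * r \<ge> r" "(1 - v) * R + v * r \<le> R"
          using v r mult_left_mono[of r R "1 - v"] mult_left_mono[of r R v] by (auto simp: algebra_simps)
        ultimately show "u \<in> U" using r by (intro annulus) auto
      qed
    qed auto
  qed auto
  moreover have "contour_integral (circlepath 0 \<rho>) h = contour_integral (circlepath 0 \<rho>) f - contour_integral (circlepath 0 \<rho>) s"
    if \<rho>: "\<rho> = r \<or> \<rho> = R" for \<rho>
  proof -
    have "continuous_on (path_image (circlepath 0 \<rho>)) f"
      by (rule continuous_on_subset[OF holomorphic_on_imp_continuous_on[OF f] sub(1)[OF \<rho>]])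
    moreover have "continuous_on (path_image (circlepath 0 \<rho>)) s"
      unfolding s_def using sub(1)[OF \<rho>] by (intro continuous_intros) auto
    ultimately have "contour_integral (circlepath 0 \<rho>) (\<lambda>u. f u - s u) = contour_integral (circlepath 0 \<rho>) f - contour_integral (circlepath 0 \<rho>) s"
      by (intro contour_integral_diff contour_integrable_continuous_circlepath)
    moreover have "contour_integral (circlepath 0 \<rho>) h = contour_integral (circlepath 0 \<rho>) (\<lambda>u. f u - s u)"
      by (rule contour_integral_eq) (use sub(1)[OF \<rho>] in \<open>auto simp: h_def\<close>)
    ultimately show ?thesis by simp
  qed
  moreover have "(s has_contour_integral (\<Sum>i\<in>X. 2 * of_real pi * \<i> * \<phi> i (p i))) (circlepath 0 R)"
    unfolding s_def
  proof (rule has_contour_integral_sum[OF X(1)])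
    fix i assume "i \<in> X"
    hence "norm (p i) < R" using loc by blast
    thus "((\<lambda>u. \<phi> i (p i) / (u - p i)) has_contour_integral 2 * of_real pi * \<i> * \<phi> i (p i)) (circlepath 0 R)"
      by (intro Cauchy_integral_circlepath_simple[of "\<lambda>_. \<phi> i (p i)"]) auto
  qed
  moreover have "(s has_contour_integral (\<Sum>i\<in>X. 0)) (circlepath 0 r)"
    unfolding s_def
  proof (rule has_contour_integral_sum[OF X(1)])
    fix i assume "i \<in> X"
    hence i: "r < norm (p i)" using loc by blast
    have "(\<lambda>u. \<phi> i (p i) / (u - p i)) holomorphic_on ball 0 (norm (p i))"
      by (intro holomorphic_intros) auto
    thus "((\<lambda>u. \<phi> i (p i) / (u - p i)) has_contour_integral 0) (circlepath 0 r)"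
      by (rule Cauchy_theorem_convex_simple) (use i r in auto)
  qed
  ultimately show ?thesis
    by (simp add: contour_integral_unique sum_distrib_left algebra_simps)
qed

lemma continuous_on_compact_bounded:
  fixes f :: "complex \<Rightarrow> complex"
  assumes "continuous_on K f" "compact K"
  obtains C where "C > 0" "\<And>x. x \<in> K \<Longrightarrow> norm (f x) \<le> C"
proof -
  have "bounded (f ` K)" by (rule compact_imp_bounded[OF compact_continuous_image[OF assms]])
  thus ?thesis using that by (auto simp: bounded_pos)
qed

section \<open>Theta quotients, their quasi-period and their residues\<close>

lemma qtheta_eq: "qtheta x q = qpoch_inf x q * qpoch_inf (q / x) q"
  by (simp add: qtheta_def qpochs_inf_def)

definition theta_quot :: "complex \<Rightarrow> complex \<Rightarrow> complex \<Rightarrow> complex \<Rightarrow> complex" where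
  "theta_quot q H \<beta> v = qtheta (H / v) q * qtheta (H * v) q / (qpoch_inf (\<beta> / v) q * qpoch_inf (1 / (\<beta> * v)) q)"

text \<open>The residue of \<open>theta_quot q H \<beta> u * F u / u\<close> at u = \<beta>
  q^k.\<close>

definition theta_res :: "complex \<Rightarrow> complex \<Rightarrow> complex \<Rightarrow> (complex \<Rightarrow> complex) \<Rightarrow> nat \<Rightarrow> complex" where
  "theta_res q H \<beta> F k = qtheta (H / \<beta>) q * qtheta (H * \<beta>) q / (qpoch_inf q q * qpoch_inf (1 / \<beta> ^ 2) q)
     * (q ^ k * F (\<beta> * q ^ k) / (qpoch q q k * qpoch (q * \<beta> ^ 2) q k))"

context
  fixes q :: complex
  assumes q: "norm q < 1" and q0: "q \<noteq> 0"
begin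

lemma qtheta_step:
  assumes "x \<noteq> 0" shows "qtheta (q * x) q = - (1 / x) * qtheta x q"
proof -
  have "qtheta (q * x) q = qpoch_inf (x * q) q * ((1 - 1 / x) * qpoch_inf (q / x) q)"
    using qpoch_inf_step[OF q, of "1 / x"] q0 by (simp add: qtheta_eq mult.commute)
  also have "\<dots> = - (1 / x) * (((1 - x) * qpoch_inf (x * q) q) * qpoch_inf (q / x) q)"
    using assms by (simp add: field_simps)
  also have "\<dots> = - (1 / x) * qtheta x q"
    by (simp only: qpoch_inf_step[OF q, of x, symmetric] qtheta_eq mult.assoc)
  finally show ?thesis .
qed

text \<open>The two theta functions contribute multipliers in which H cancels, and the leading
  factors of the denominator cancel the powers of v. What remains is q divided by two factors that
  tend to 1 as v tends to 0.\<close>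

lemma theta_quot_step:
  assumes v: "v \<noteq> 0" and H: "H \<noteq> 0" and \<beta>: "\<beta> \<noteq> 0"
  shows "theta_quot q H \<beta> (q * v) = q * theta_quot q H \<beta> v / ((1 - q * v / \<beta>) * (1 - q * v * \<beta>))"
proof -
  have "qtheta (H / v) q = - (q * v / H) * qtheta (H / (q * v)) q"
    using qtheta_step[of "H / (q * v)"] v H q0 by simp
  hence t1: "qtheta (H / (q * v)) q = - (H / (q * v)) * qtheta (H / v) q" using v H q0 by simp
  have t2: "qtheta (H * (q * v)) q = - (1 / (H * v)) * qtheta (H * v) q"
    using qtheta_step[of "H * v"] v H by (simp add: mult_ac)
  have f: "1 - \<beta> / (q * v) = - (\<beta> / (q * v)) * (1 - q * v / \<beta>)"
    "1 - 1 / (\<beta> * (q * v)) = - (1 / (\<beta> * q * v)) * (1 - q * v * \<beta>)"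
    "\<beta> / (q * v) * q = \<beta> / v" "1 / (\<beta> * (q * v)) * q = 1 / (\<beta> * v)"
    using v \<beta> q0 by (simp_all add: field_simps)
  have t3: "qpoch_inf (\<beta> / (q * v)) q = - (\<beta> / (q * v)) * (1 - q * v / \<beta>) * qpoch_inf (\<beta> / v) q"
    using qpoch_inf_step[OF q, of "\<beta> / (q * v)"] unfolding f .
  have t4: "qpoch_inf (1 / (\<beta> * (q * v))) q = - (1 / (\<beta> * q * v)) * (1 - q * v * \<beta>) * qpoch_inf (1 / (\<beta> * v)) q"
    using qpoch_inf_step[OF q, of "1 / (\<beta> * (q * v))"] unfolding f .
  have *: "(- (H / (q * v)) * a) * (- (1 / (H * v)) * b) / ((- (\<beta> / (q * v)) * c * d) * (- (1 / (\<beta> * q * v)) * e * f))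
     = q * (a * b / (d * f)) / (c * e)" for a b c d e f
    using v H \<beta> q0 by (simp add: field_simps)
  show ?thesis unfolding theta_quot_def t1 t2 t3 t4 by (rule *)
qed

lemma theta_quot_power:
  assumes v: "v \<noteq> 0" and H: "H \<noteq> 0" and \<beta>: "\<beta> \<noteq> 0"
  shows "theta_quot q H \<beta> (q ^ k * v) = q ^ k * theta_quot q H \<beta> v / (qpoch (q * v / \<beta>) q k * qpoch (q * v * \<beta>) q k)"
proof (induction k)
  case (Suc k)
  have "theta_quot q H \<beta> (q ^ Suc k * v) = theta_quot q H \<beta> (q * (q ^ k * v))" by (simp add: mult_ac)
  also have "\<dots> = q * theta_quot q H \<beta> (q ^ k * v) / ((1 - q * (q ^ k * v) / \<beta>) * (1 - q * (q ^ k * v) * \<beta>))"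
    by (rule theta_quot_step) (use v H \<beta> q0 in auto)
  also have "\<dots> = q ^ Suc k * theta_quot q H \<beta> v / (qpoch (q * v / \<beta>) q (Suc k) * qpoch (q * v * \<beta>) q (Suc k))"
    unfolding Suc.IH qpoch_Suc by (simp add: mult_ac)
  finally show ?case .
qed simp

lemma theta_quot_inverse: "theta_quot q H (1 / \<beta>) v = theta_quot q H \<beta> v"
  by (simp add: theta_quot_def mult_ac)

lemma qpoch_inf_zeroE:
  assumes "qpoch_inf (b / u) q = 0" "u \<noteq> 0"
  obtains k where "u = b * q ^ k"
  using assms by (auto simp: qpoch_inf_eq_0_iff[OF q] divide_simps)

text \<open>\<open>theta_quot q H b u * F u / u\<close> with its pole at b q^k divided out:
  \<open>theta_quot_power\<close> rescales u to u / q^k, and then the first factor 1 - b q^k / u of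
  (b q^k / u)_inf is removed.\<close>

definition theta_local :: "complex \<Rightarrow> complex \<Rightarrow> (complex \<Rightarrow> complex) \<Rightarrow> nat \<Rightarrow> complex \<Rightarrow> complex" where
  "theta_local H b F k u = q ^ k * (qtheta (H * q ^ k / u) q * qtheta (H * u / q ^ k) q) * F u /
     (qpoch_inf (b * q ^ Suc k / u) q * qpoch_inf (q ^ k / (b * u)) q * (qpoch (q * u / (q ^ k * b)) q k * qpoch (q * u * b / q ^ k) q k))"

text \<open>The denominator left after removing the vanishing factor is non-zero at b q^k because
  b^2 is no integral power of q, hence also nearby; so the pole is at most simple.\<close>

lemma theta_local_pole:
  assumes b: "b \<noteq> 0" and H: "H \<noteq> 0" and nb: "\<And>j::nat. b ^ 2 * q ^ j \<noteq> 1" "\<And>j::nat. q ^ j \<noteq> b ^ 2"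
    and F: "F holomorphic_on ball 0 R" and bR: "norm b < R"
  shows "\<exists>T. open T \<and> b * q ^ k \<in> T \<and> theta_local H b F k holomorphic_on T \<and>
     (\<forall>u\<in>T - {b * q ^ k}. theta_quot q H b u * F u / u = theta_local H b F k u / (u - b * q ^ k))"
    and "theta_local H b F k (b * q ^ k) = theta_res q H b F k"
proof -
  define Den where "Den = (\<lambda>u. qpoch_inf (b * q ^ Suc k / u) q * qpoch_inf (q ^ k / (b * u)) q * (qpoch (q * u / (q ^ k * b)) q k * qpoch (q * u * b / q ^ k) q k))"
  define T where "T = {u \<in> ball 0 R - {0}. Den u \<noteq> 0}"
  have Den_hol: "Den holomorphic_on (ball 0 R - {0})"
    unfolding Den_def by (intro holomorphic_intros q) (use b q0 in auto)
  have "open ((ball 0 R - {0}) \<inter> Den -` (- {0}))"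
    by (rule continuous_open_preimage[OF holomorphic_on_imp_continuous_on[OF Den_hol]]) auto
  moreover have "(ball 0 R - {0}) \<inter> Den -` (- {0}) = T" by (auto simp: T_def)
  ultimately have oT: "open T" by simp
  have at: "b * q ^ Suc k / (b * q ^ k) = q" "q ^ k / (b * (b * q ^ k)) = 1 / b ^ 2"
     "q * (b * q ^ k) / (q ^ k * b) = q" "q * (b * q ^ k) * b / q ^ k = q * b ^ 2"
    "H * q ^ k / (b * q ^ k) = H / b" "H * (b * q ^ k) / q ^ k = H * b"
    using b q0 by (simp_all add: power2_eq_square)
  have "qpoch_inf (1 / b ^ 2) q \<noteq> 0"
    using nb(2) b by (auto simp: qpoch_inf_eq_0_iff[OF q] divide_simps)
  moreover have "qpoch (q * b ^ 2) q k \<noteq> 0"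
  proof
    assume "qpoch (q * b ^ 2) q k = 0"
    then obtain j where "q * b ^ 2 * q ^ j = 1" by (auto simp: qpoch_eq_0_iff)
    thus False using nb(1)[of "Suc j"] by (simp add: mult_ac)
  qed
  ultimately have "Den (b * q ^ k) \<noteq> 0"
    unfolding Den_def at using qpoch_inf_nonzero[OF q q] qpoch_q_nonzero[OF q] by simp
  moreover have "norm (b * q ^ k) < R"
    using mult_left_le[OF norm_qpower_le_one[OF q, of k], of "norm b"] bR by (simp add: norm_mult)
  ultimately have inT: "b * q ^ k \<in> T" using b q0 by (simp add: T_def)
  have "theta_local H b F k holomorphic_on T"
    unfolding theta_local_def[abs_def] qtheta_eq
    by (intro holomorphic_intros q holomorphic_on_subset[OF F]) (use b q0 H in \<open>auto simp: T_def Den_def\<close>)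
  moreover have "theta_quot q H b u * F u / u = theta_local H b F k u / (u - b * q ^ k)" if u: "u \<in> T - {b * q ^ k}" for u
  proof -
    define v where "v = u / q ^ k"
    have u0: "u \<noteq> 0" using u by (simp add: T_def)
    hence v0: "v \<noteq> 0" using q0 by (simp add: v_def)
    have uv: "u = q ^ k * v" using q0 by (simp add: v_def)
    have e: "q * u / (q ^ k * b) = q * v / b" "q * u * b / q ^ k = q * v * b" "H * q ^ k / u = H / v" "H * u / q ^ k = H * v"
       "b * q ^ Suc k / u = q * b / v" "q ^ k / (b * u) = 1 / (b * v)"
      using q0 by (simp_all add: v_def)
    have 1: "qpoch_inf (b / v) q = (1 - b / v) * qpoch_inf (q * b / v) q"
      using qpoch_inf_step[OF q, of "b / v"] by (simp add: mult.commute)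
    have 2: "u * (1 - b / v) = u - b * q ^ k" using v0 by (simp add: uv field_simps)
    have A: "theta_quot q H b u = q ^ k * theta_quot q H b v / (qpoch (q * v / b) q k * qpoch (q * v * b) q k)"
      unfolding uv by (rule theta_quot_power[OF v0 H b])
    have B: "theta_quot q H b v = qtheta (H / v) q * qtheta (H * v) q / (((1 - b / v) * qpoch_inf (q * b / v) q) * qpoch_inf (1 / (b * v)) q)"
      by (simp only: theta_quot_def 1)
    have "theta_quot q H b u * F u / u = q ^ k * (qtheta (H / v) q * qtheta (H * v) q / (((1 - b / v) * qpoch_inf (q * b / v) q) * qpoch_inf (1 / (b * v)) q))
      / (qpoch (q * v / b) q k * qpoch (q * v * b) q k) * F u / u"
      unfolding A B ..
    also have "\<dots> = q ^ k * (qtheta (H / v) q * qtheta (H * v) q) * F u /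
       (qpoch_inf (q * b / v) q * qpoch_inf (1 / (b * v)) q * (qpoch (q * v / b) q k * qpoch (q * v * b) q k)) / (u * (1 - b / v))"
      by (simp add: mult_ac)
    also have "\<dots> = theta_local H b F k u / (u - b * q ^ k)"
      unfolding 2 theta_local_def e ..
    finally show ?thesis .
  qed
  ultimately show "\<exists>T. open T \<and> b * q ^ k \<in> T \<and> theta_local H b F k holomorphic_on T \<and>
     (\<forall>u\<in>T - {b * q ^ k}. theta_quot q H b u * F u / u = theta_local H b F k u / (u - b * q ^ k))"
    using oT inT by blast
  show "theta_local H b F k (b * q ^ k) = theta_res q H b F k"
    unfolding theta_local_def at theta_res_def by simp
qed

lemma summable_theta_res:
  assumes nb: "\<And>j::nat. b ^ 2 * q ^ j \<noteq> 1" and F: "F holomorphic_on ball 0 R" and bR: "norm b < R"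
  shows "summable (\<lambda>k. norm (theta_res q H b F k))"
proof -
  have nz: "qpoch_inf (q * b ^ 2) q \<noteq> 0"
  proof
    assume "qpoch_inf (q * b ^ 2) q = 0"
    then obtain j where "q * b ^ 2 * q ^ j = 1" by (auto simp: qpoch_inf_eq_0_iff[OF q])
    thus False using nb[of "Suc j"] by (simp add: mult_ac)
  qed
  obtain C1 where C1: "\<And>k. norm (1 / qpoch q q k) \<le> C1"
    using inverse_qpoch_bounded[OF q qpoch_inf_nonzero[OF q q]] by blast
  obtain C2 where C2: "\<And>k. norm (1 / qpoch (q * b ^ 2) q k) \<le> C2"
    using inverse_qpoch_bounded[OF q nz] by blast
  have "continuous_on (cball 0 (norm b)) F"
    using bR by (intro holomorphic_on_imp_continuous_on holomorphic_on_subset[OF F]) auto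
  then obtain C3 where C3: "C3 > 0" "\<And>x. x \<in> cball 0 (norm b) \<Longrightarrow> norm (F x) \<le> C3"
    by (rule continuous_on_compact_bounded) auto
  define c where "c = norm (qtheta (H / b) q * qtheta (H * b) q / (qpoch_inf q q * qpoch_inf (1 / b ^ 2) q))"
  have pos: "0 \<le> C1" "0 \<le> C2" "0 \<le> c"
    using order_trans[OF norm_ge_zero C1] order_trans[OF norm_ge_zero C2] by (auto simp: c_def)
  show ?thesis
  proof (rule summable_comparison_test'[of "\<lambda>k. c * (C3 * (C1 * C2)) * norm q ^ k" 0])
    show "summable (\<lambda>k. c * (C3 * (C1 * C2)) * norm q ^ k)"
      by (intro summable_mult summable_geometric) (use q in auto)
    fix k
    have "b * q ^ k \<in> cball 0 (norm b)"
      using mult_left_le[OF norm_qpower_le_one[OF q, of k], of "norm b"] by (simp add: norm_mult)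
    note C3k = C3(2)[OF this]
    have "norm (theta_res q H b F k) = c * (norm (F (b * q ^ k)) * (norm (1 / qpoch q q k) * norm (1 / qpoch (q * b ^ 2) q k))) * norm q ^ k"
      unfolding theta_res_def c_def by (simp add: norm_mult norm_divide norm_power)
    also have "\<dots> \<le> c * (C3 * (C1 * C2)) * norm q ^ k"
      by (intro mult_right_mono mult_left_mono mult_mono C3k C1 C2) (use pos C3(1) in auto)
    finally show "norm (norm (theta_res q H b F k)) \<le> c * (C3 * (C1 * C2)) * norm q ^ k" by simp
  qed
qed

end

section \<open>Contraction of the contour to the origin\<close>

context
  fixes q :: complex
  assumes q: "norm q < 1" and q0: "q \<noteq> 0"
begin

text \<open>The quasi-period \<open>q\<close> of \<^const>\<open>theta_quot\<close> makes the integrals over the circles of radius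
  \<open>\<rho> \<bar>q\<bar>\<^sup>N\<close> tend to zero.\<close>

theorem theta_quot_integral:
  assumes \<beta>: "\<beta> \<noteq> 0" and H: "H \<noteq> 0" and nb: "\<And>j::nat. \<beta> ^ 2 * q ^ j \<noteq> 1" "\<And>j::nat. q ^ j \<noteq> \<beta> ^ 2"
    and \<rho>: "norm \<beta> < \<rho>" "1 / norm \<beta> < \<rho>" "\<rho> < R" and F: "F holomorphic_on ball 0 R"
  shows "((\<lambda>t. theta_quot q H \<beta> (\<rho> * cis t) * F (\<rho> * cis t)) has_integral
    2 * of_real pi * ((\<Sum>k. theta_res q H \<beta> F k) + (\<Sum>k. theta_res q H (1 / \<beta>) F k))) {- pi..pi}"
proof -
  define r where "r = norm q"
  have r: "0 < r" "r < 1" using q q0 by (auto simp: r_def)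
  \<comment> \<open>The Boolean selects the family of poles: False for \<beta> q^k, True for q^k /
    \<beta>.\<close>
  define b where "b = (\<lambda>i. if i then 1 / \<beta> else \<beta>)"
  have b0: "b i \<noteq> 0" and b\<rho>: "norm (b i) < \<rho>" and nbb: "b i ^ 2 * q ^ j \<noteq> 1" "q ^ j \<noteq> b i ^ 2" for i j
    using \<beta> \<rho> nb[of j] by (auto simp: b_def norm_divide divide_simps mult.commute)
  define J where "J = (\<lambda>u. theta_quot q H \<beta> u * F u / u)"
  have Jb: "J u = theta_quot q H (b i) u * F u / u" for i u
    by (simp add: J_def b_def theta_quot_inverse[OF q q0])
  define den where "den = (\<lambda>u. qpoch_inf (\<beta> / u) q * qpoch_inf (1 / (\<beta> * u)) q)"
  have den_zero: "\<exists>i k. u = b i * q ^ k" if "den u = 0" "u \<noteq> 0" for u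
  proof -
    have "qpoch_inf (b False / u) q = 0 \<or> qpoch_inf (b True / u) q = 0"
      using that(1) by (simp add: den_def b_def)
    thus ?thesis using qpoch_inf_zeroE[OF q q0 _ that(2)] by metis
  qed
  define U0 where "U0 = {u \<in> ball 0 R - {0}. den u \<noteq> 0}"
  have "den holomorphic_on (ball 0 R - {0})"
    unfolding den_def by (intro holomorphic_intros q) (use \<beta> in auto)
  hence "open ((ball 0 R - {0}) \<inter> den -` (- {0}))"
    by (intro continuous_open_preimage holomorphic_on_imp_continuous_on) auto
  moreover have "(ball 0 R - {0}) \<inter> den -` (- {0}) = U0" by (auto simp: U0_def)
  ultimately have oU0: "open U0" by simp
  have JU0: "J holomorphic_on U0"
    unfolding J_def theta_quot_def qtheta_eq
    by (intro holomorphic_intros q holomorphic_on_subset[OF F]) (use \<beta> H in \<open>auto simp: U0_def den_def\<close>)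
  define \<phi> where "\<phi> = (\<lambda>(i, k). theta_local q H (b i) F k)"
  define p where "p = (\<lambda>(i, k). b i * q ^ k)"
  have pole: "\<exists>T. open T \<and> p x \<in> T \<and> \<phi> x holomorphic_on T \<and> (\<forall>u\<in>T - {p x}. J u = \<phi> x u / (u - p x))" for x
  proof (cases x)
    case (Pair i k)
    have "norm (b i) < R" using b\<rho>[of i] \<rho>(3) by simp
    from theta_local_pole(1)[OF q q0 b0 H nbb F this, of k] show ?thesis
      by (simp add: Pair p_def \<phi>_def Jb[of _ i])
  qed
  have \<phi>p: "\<phi> (i, k) (p (i, k)) = theta_res q H (b i) F k" for i k
    unfolding \<phi>_def p_def using theta_local_pole(2)[OF q q0 b0 H nbb F, of i k] b\<rho>[of i] \<rho>(3) by simp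
  have qinj: "k = l" if "q ^ k = q ^ l" for k l
  proof -
    have e: "r ^ k = r ^ l" using that unfolding r_def by (metis norm_power)
    show ?thesis
      using power_strict_decreasing[of k l r] power_strict_decreasing[of l k r] e r by (metis linorder_neqE_nat order_less_irrefl)
  qed
  have p_inj: "inj p"
  proof (rule injI)
    \<comment> \<open>A common point of the two families would make \<beta>^2 an integral power of
      q.\<close>
    have cross: False if "\<beta> * q ^ k = 1 / \<beta> * q ^ l" for k l
    proof -
      have e: "\<beta> ^ 2 * q ^ k = q ^ l" using that \<beta> by (simp add: field_simps power2_eq_square)
      show False
      proof (cases "k \<le> l")
        case True
        hence "q ^ l = q ^ (l - k) * q ^ k" by (simp flip: power_add)
        with e have "q ^ (l - k) = \<beta> ^ 2" using q0 by simp
        thus False using nb(2) by blast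
      next
        case False
        hence "q ^ k = q ^ (k - l) * q ^ l" by (simp flip: power_add)
        with e have "\<beta> ^ 2 * q ^ (k - l) = 1" using q0 by simp
        thus False using nb(1) by blast
      qed
    qed
    fix x y assume xy: "p x = p y"
    obtain i k j l where xy': "x = (i, k)" "y = (j, l)" by (metis surj_pair)
    have "i = j" using xy cross[of k l] cross[of l k] by (auto simp: p_def xy' b_def split: if_splits)
    thus "x = y" using xy qinj[of k l] b0[of i] by (simp add: p_def xy')
  qed
  have shift: "contour_integral (circlepath 0 R2) J = contour_integral (circlepath 0 R1) J + 2 * pi * \<i> * (\<Sum>x\<in>X. \<phi> x (p x))"
    if R12: "0 < R1" "R1 \<le> R2" "R2 < R" and X: "X = {x. R1 < norm (p x)}" "finite X"
      "\<And>x. norm (p x) \<noteq> R1" "\<And>x. norm (p x) < R2" for R1 R2 X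
  proof -
    from pole obtain T where T: "\<And>x. open (T x)" "\<And>x. p x \<in> T x" "\<And>x. \<phi> x holomorphic_on T x"
      "\<And>x u. u \<in> T x - {p x} \<Longrightarrow> J u = \<phi> x u / (u - p x)" by metis
    show ?thesis
    proof (rule annulus_residues[OF X(2) inj_on_subset[OF p_inj subset_UNIV] R12(1,2)])
      show "open (U0 \<union> (\<Union>x\<in>X. T x))" by (intro open_Un open_UN ballI oU0 T(1))
      show "u \<in> U0 \<union> (\<Union>x\<in>X. T x)" if u: "R1 \<le> norm u" "norm u \<le> R2" for u
      proof (cases "den u = 0")
        case False
        thus ?thesis using u R12 by (auto simp: U0_def)
      next
        case True
        have "u \<noteq> 0" using u R12 by auto
        from den_zero[OF True this] obtain i k where "u = p (i, k)" by (auto simp: p_def)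
        moreover from this have "(i, k) \<in> X" using u X(3)[of "(i, k)"] by (auto simp: X(1))
        ultimately show ?thesis using T(2) by blast
      qed
      have "J holomorphic_on (U0 - p ` X) \<union> (\<Union>x\<in>X. T x - p ` X)"
      proof (intro holomorphic_on_Un holomorphic_on_UN_open)
        show "J holomorphic_on U0 - p ` X" by (rule holomorphic_on_subset[OF JU0]) auto
        show "open (U0 - p ` X)" "\<And>x. open (T x - p ` X)" "open (\<Union>x\<in>X. T x - p ` X)"
          by (intro open_UN ballI open_Diff oU0 T(1) finite_imp_closed finite_imageI X(2))+
        fix x assume x: "x \<in> X"
        have "(\<lambda>u. \<phi> x u / (u - p x)) holomorphic_on T x - p ` X"
          by (intro holomorphic_intros holomorphic_on_subset[OF T(3)[of x]]) (use x in auto)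
        thus "J holomorphic_on T x - p ` X"
          proof (rule holomorphic_transform)
          fix u assume "u \<in> T x - p ` X"
          hence "u \<in> T x - {p x}" using x by auto
          thus "\<phi> x u / (u - p x) = J u" using T(4) by simp
        qed
      qed
      moreover have "(U0 - p ` X) \<union> (\<Union>x\<in>X. T x - p ` X) = U0 \<union> (\<Union>x\<in>X. T x) - p ` X" by auto
      ultimately show "J holomorphic_on U0 \<union> (\<Union>x\<in>X. T x) - p ` X" by simp
      show "R1 < norm (p x) \<and> norm (p x) < R2" if "x \<in> X" for x using that X by auto
      show "\<exists>T. open T \<and> p x \<in> T \<and> \<phi> x holomorphic_on T \<and> (\<forall>u\<in>T - {p x}. J u = \<phi> x u / (u - p x))" for x
        by (rule pole)
    qed
  qed
  define bm where "bm = max (norm \<beta>) (1 / norm \<beta>)"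
  have bm: "norm (b i) \<le> bm" for i by (auto simp: b_def bm_def norm_divide)
  have "bm < \<rho>" using \<rho> by (simp add: bm_def)
  \<comment> \<open>For \<rho>0 outside \<open>Bad\<close> no circle of radius \<rho>0 |q|^N meets a
    pole. The prescribed \<rho> need not have this property, so the contour is first moved to a
    slightly smaller \<rho>0 that still encloses all poles.\<close>
  define Bad where "Bad = (\<Union>i. \<Union>k. \<Union>N. {norm (b i) * r ^ k / r ^ N})"
  have "uncountable ({bm<..<\<rho>} - Bad)"
    by (rule uncountable_minus_countable) (auto simp: Bad_def uncountable_open_interval \<open>bm < \<rho>\<close> intro!: countable_UN)
  then obtain \<rho>0 where \<rho>0: "bm < \<rho>0" "\<rho>0 < \<rho>" "\<rho>0 \<notin> Bad"
    by (metis (no_types, lifting) DiffE countable_empty equals0I greaterThanLessThan_iff)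
  have "norm \<beta> > 0" using \<beta> by simp
  hence \<rho>00: "\<rho>0 > 0" using order.strict_trans[of 0 "norm \<beta>" \<rho>0] \<rho>0(1) by (simp add: bm_def)
  have gen: "norm (b i) * r ^ k \<noteq> \<rho>0 * r ^ N" for i k N
  proof
    assume "norm (b i) * r ^ k = \<rho>0 * r ^ N"
    hence "\<rho>0 = norm (b i) * r ^ k / r ^ N" using r by simp
    thus False using \<rho>0(3) unfolding Bad_def by blast
  qed
  have np: "norm (p (i, k)) = norm (b i) * r ^ k" for i k by (simp add: p_def norm_mult norm_power r_def)
  have np_le: "norm (p x) < \<rho>0" for x
  proof (cases x)
    case (Pair i k)
    have "norm (b i) * r ^ k \<le> norm (b i)" using r by (simp add: mult_left_le power_le_one)
    thus ?thesis unfolding Pair np using bm[of i] \<rho>0(1) by linarith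
  qed
  have c1: "contour_integral (circlepath 0 \<rho>) J = contour_integral (circlepath 0 \<rho>0) J"
  proof -
    have "{x. \<rho>0 < norm (p x)} = {}" using np_le by (auto simp: not_less intro: less_imp_le)
    from shift[OF \<rho>00 less_imp_le[OF \<rho>0(2)] \<rho>(3) this[symmetric]] show ?thesis
      using order.strict_trans[OF np_le \<rho>0(2)] np_le by (simp add: less_imp_neq)
  qed
  \<comment> \<open>Indices of the poles of family i outside the circle of radius \<rho>0 |q|^N.
    These finite sets exhaust the naturals, so absolute summability identifies the limit of the
    residue sums.\<close>
  define K where "K = (\<lambda>N i. {k. \<rho>0 * r ^ N < norm (b i) * r ^ k})"
  have K_fin: "finite (K N i)" for N i
  proof -
    have "(\<lambda>k. norm (b i) * r ^ k) \<longlonglongrightarrow> 0"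
      by (intro tendsto_mult_right_zero LIMSEQ_power_zero) (use r in auto)
    hence "eventually (\<lambda>k. norm (b i) * r ^ k < \<rho>0 * r ^ N) sequentially"
      by (rule order_tendstoD) (use \<rho>00 r in simp)
    then obtain M where "\<And>k. k \<ge> M \<Longrightarrow> norm (b i) * r ^ k < \<rho>0 * r ^ N" by (auto simp: eventually_sequentially)
    hence "K N i \<subseteq> {..<M}" by (force simp: K_def not_less[symmetric])
    thus ?thesis by (rule finite_subset) simp
  qed
  have K_lim: "filterlim (\<lambda>N. K N i) (finite_subsets_at_top UNIV) sequentially" for i
    unfolding filterlim_finite_subsets_at_top
  proof safe
    fix X :: "nat set" assume X: "finite X"
    have "eventually (\<lambda>N. k \<in> K N i) sequentially" for k
    proof -
      have "(\<lambda>N. \<rho>0 * r ^ N) \<longlonglongrightarrow> 0"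
        by (intro tendsto_mult_right_zero LIMSEQ_power_zero) (use r in auto)
      hence "eventually (\<lambda>N. \<rho>0 * r ^ N < norm (b i) * r ^ k) sequentially"
        by (rule order_tendstoD) (use b0[of i] r in simp)
      thus ?thesis by (simp add: K_def)
    qed
    hence "eventually (\<lambda>N. \<forall>k\<in>X. k \<in> K N i) sequentially" using X by (intro eventually_ball_finite) auto
    thus "eventually (\<lambda>N. finite (K N i) \<and> X \<subseteq> K N i \<and> K N i \<subseteq> UNIV) sequentially"
      by eventually_elim (use K_fin in auto)
  qed
  have res_lim: "(\<lambda>N. \<Sum>k\<in>K N i. theta_res q H (b i) F k) \<longlonglongrightarrow> (\<Sum>k. theta_res q H (b i) F k)" for i
  proof -
    have "summable (\<lambda>k. norm (theta_res q H (b i) F k))"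
      by (rule summable_theta_res[OF q q0 nbb(1) F]) (use b\<rho>[of i] \<rho>(3) in simp)
    hence "(theta_res q H (b i) F has_sum (\<Sum>k. theta_res q H (b i) F k)) UNIV"
      by (intro norm_summable_imp_has_sum summable_sums[OF summable_norm_cancel])
    thus ?thesis unfolding has_sum_def by (rule filterlim_compose[OF _ K_lim])
  qed
  have c2: "contour_integral (circlepath 0 \<rho>0) J = contour_integral (circlepath 0 (\<rho>0 * r ^ N)) J
      + 2 * pi * \<i> * ((\<Sum>k\<in>K N False. theta_res q H (b False) F k) + (\<Sum>k\<in>K N True. theta_res q H (b True) F k))" for N
  proof -
    have X: "(Pair False ` K N False) \<union> (Pair True ` K N True) = {x. \<rho>0 * r ^ N < norm (p x)}" (is "?X = _")
      by (auto simp: K_def np image_iff) (metis (full_types))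
    have "contour_integral (circlepath 0 \<rho>0) J = contour_integral (circlepath 0 (\<rho>0 * r ^ N)) J + 2 * pi * \<i> * (\<Sum>x\<in>?X. \<phi> x (p x))"
    proof (rule shift[OF _ _ _ X])
      show "0 < \<rho>0 * r ^ N" "\<rho>0 * r ^ N \<le> \<rho>0" "\<rho>0 < R"
        using \<rho>00 r \<rho>0(2) \<rho>(3) by (auto simp: mult_left_le power_le_one)
      show "finite ?X" using K_fin by auto
      show "norm (p x) \<noteq> \<rho>0 * r ^ N" for x by (cases x) (simp only: np gen not_False_eq_True)
      show "norm (p x) < \<rho>0" for x by (rule np_le)
    qed
    also have "(\<Sum>x\<in>?X. \<phi> x (p x)) = (\<Sum>x\<in>Pair False ` K N False. \<phi> x (p x)) + (\<Sum>x\<in>Pair True ` K N True. \<phi> x (p x))"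
      using K_fin by (intro sum.union_disjoint) auto
    also have "\<dots> = (\<Sum>k\<in>K N False. theta_res q H (b False) F k) + (\<Sum>k\<in>K N True. theta_res q H (b True) F k)"
      by (simp add: sum.reindex inj_on_def \<phi>p)
    finally show ?thesis .
  qed
  have small: "(\<lambda>N. contour_integral (circlepath 0 (\<rho>0 * r ^ N)) J) \<longlonglongrightarrow> 0"
  proof -
    \<comment> \<open>By quasi-periodicity J at u = q^N v is q^N / u times \<open>w v\<close>, two
      infinite products and F, all bounded for |v| = \<rho>0. As |q^N / u| = 1 / \<rho>0, J stays
      bounded while the circles shrink.\<close>
    define w where "w = (\<lambda>v. theta_quot q H \<beta> v / (qpoch_inf (q * v / \<beta>) q * qpoch_inf (q * v * \<beta>) q))"
    have nz: "den v \<noteq> 0" "qpoch_inf (q * v / \<beta>) q \<noteq> 0" "qpoch_inf (q * v * \<beta>) q \<noteq> 0" "v \<noteq> 0" if v: "norm v = \<rho>0" for v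
    proof -
      show v0: "v \<noteq> 0" using v \<rho>00 by auto
      show "den v \<noteq> 0"
      proof
        assume "den v = 0"
        from den_zero[OF this v0] obtain i k where "v = b i * q ^ k" by blast
        hence "norm (b i) * r ^ k = \<rho>0 * r ^ 0" using v by (simp add: norm_mult norm_power r_def)
        thus False using gen by blast
      qed
      have no: "v * q ^ N \<noteq> b i" for i N
        using gen[of i 0 N] v by (auto simp: norm_mult norm_power r_def dest: arg_cong[of _ _ norm])
      show "qpoch_inf (q * v / \<beta>) q \<noteq> 0"
        using no[of "Suc _" False] \<beta> by (auto simp: qpoch_inf_eq_0_iff[OF q] b_def field_simps)
      show "qpoch_inf (q * v * \<beta>) q \<noteq> 0"
        using no[of "Suc _" True] \<beta> by (auto simp: qpoch_inf_eq_0_iff[OF q] b_def field_simps)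
    qed
    have "continuous_on (sphere 0 \<rho>0) w"
      unfolding w_def theta_quot_def qtheta_eq using nz \<beta> H unfolding den_def
      by (intro continuous_intros q) auto
    then obtain C1 where C1: "C1 > 0" "\<And>v. v \<in> sphere 0 \<rho>0 \<Longrightarrow> norm (w v) \<le> C1"
      by (rule continuous_on_compact_bounded) auto
    have "continuous_on (cball 0 \<rho>0) F"
      using \<rho>0(2) \<rho>(3) by (intro holomorphic_on_imp_continuous_on holomorphic_on_subset[OF F]) auto
    then obtain C2 where C2: "C2 > 0" "\<And>x. x \<in> cball 0 \<rho>0 \<Longrightarrow> norm (F x) \<le> C2"
      by (rule continuous_on_compact_bounded) auto
    define E where "E = exp (\<rho>0 * bm / (1 - norm q))"
    define C where "C = C1 * (E * E) * C2"
    have C0: "C > 0" using C1(1) C2(1) by (simp add: C_def E_def)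
    have bnd: "norm (J u) \<le> C / \<rho>0" if u: "norm u = \<rho>0 * r ^ N" for u N
    proof -
      define v where "v = u / q ^ N"
      have v: "norm v = \<rho>0" using u q0 by (simp add: v_def norm_divide norm_power r_def)
      have uv: "u = q ^ N * v" using q0 by (simp add: v_def)
      have E1: "norm (qpoch_inf (q * v / \<beta> * q ^ N) q) \<le> E" "norm (qpoch_inf (q * v * \<beta> * q ^ N) q) \<le> E"
      proof -
        have le: "norm (q * q ^ N) \<le> 1" using norm_qpower_le_one[OF q, of "Suc N"] by simp
        have "norm (v / \<beta>) * norm (q * q ^ N) \<le> norm (v / \<beta>) * 1" "norm (v * \<beta>) * norm (q * q ^ N) \<le> norm (v * \<beta>) * 1"
          by (intro mult_left_mono le; simp)+
        moreover have "norm (v / \<beta>) \<le> \<rho>0 * bm" "norm (v * \<beta>) \<le> \<rho>0 * bm"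
          using \<rho>00 mult_left_mono[OF bm[of True], of \<rho>0] mult_left_mono[OF bm[of False], of \<rho>0]
          by (simp_all add: norm_mult norm_divide v b_def)
        ultimately have "norm (q * v / \<beta> * q ^ N) \<le> \<rho>0 * bm" "norm (q * v * \<beta> * q ^ N) \<le> \<rho>0 * bm"
          by (simp_all add: norm_mult norm_divide mult_ac)
        thus "norm (qpoch_inf (q * v / \<beta> * q ^ N) q) \<le> E" "norm (qpoch_inf (q * v * \<beta> * q ^ N) q) \<le> E"
          unfolding E_def by - (erule norm_qpoch_inf_le[OF q])+
      qed
      have split: "1 / qpoch (q * v / \<beta>) q N = qpoch_inf (q * v / \<beta> * q ^ N) q / qpoch_inf (q * v / \<beta>) q"
        "1 / qpoch (q * v * \<beta>) q N = qpoch_inf (q * v * \<beta> * q ^ N) q / qpoch_inf (q * v * \<beta>) q"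
        using nz(2,3)[OF v] qpoch_inf_split[OF q, of "q * v / \<beta>" N] qpoch_inf_split[OF q, of "q * v * \<beta>" N]
        by auto
      have "theta_quot q H \<beta> u = q ^ N * theta_quot q H \<beta> v * ((1 / qpoch (q * v / \<beta>) q N) * (1 / qpoch (q * v * \<beta>) q N))"
        unfolding uv theta_quot_power[OF q q0 nz(4)[OF v] H \<beta>] by simp
      also have "\<dots> = q ^ N * w v * (qpoch_inf (q * v / \<beta> * q ^ N) q * qpoch_inf (q * v * \<beta> * q ^ N) q)"
        unfolding split w_def by simp
      finally have "J u = q ^ N * (w v * (qpoch_inf (q * v / \<beta> * q ^ N) q * qpoch_inf (q * v * \<beta> * q ^ N) q) * F u) / u"
        by (simp add: J_def mult_ac)
      hence "norm (J u) = norm (w v) * (norm (qpoch_inf (q * v / \<beta> * q ^ N) q) * norm (qpoch_inf (q * v * \<beta> * q ^ N) q)) * norm (F u) / \<rho>0"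
        using u r by (simp add: norm_mult norm_divide norm_power flip: r_def)
      also have "\<dots> \<le> C / \<rho>0"
      proof (intro divide_right_mono)
        have "u \<in> cball 0 \<rho>0" using u \<rho>00 r by (simp add: mult_left_le power_le_one)
        thus "norm (w v) * (norm (qpoch_inf (q * v / \<beta> * q ^ N) q) * norm (qpoch_inf (q * v * \<beta> * q ^ N) q)) * norm (F u) \<le> C"
          unfolding C_def using C1 C2 v E1 by (intro mult_mono) (auto simp: E_def)
      qed (use \<rho>00 in simp)
      finally show ?thesis .
    qed
    have "norm (contour_integral (circlepath 0 (\<rho>0 * r ^ N)) J) \<le> C / \<rho>0 * (2 * pi * (\<rho>0 * r ^ N))" for N
    proof (rule has_contour_integral_bound_circlepath)
      have "path_image (circlepath 0 (\<rho>0 * r ^ N)) \<subseteq> U0"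
      proof
        fix u assume "u \<in> path_image (circlepath 0 (\<rho>0 * r ^ N))"
        hence u: "norm u = \<rho>0 * r ^ N" using \<rho>00 r by simp
        have "\<rho>0 * r ^ N \<le> \<rho>0" using \<rho>00 r by (simp add: mult_left_le power_le_one)
        hence "norm u < R" using u \<rho>0(2) \<rho>(3) by linarith
        hence "u \<in> ball 0 R - {0}" using u \<rho>00 r by auto
        moreover have "den u \<noteq> 0"
        proof
          assume "den u = 0"
          moreover have "u \<noteq> 0" using \<open>u \<in> ball 0 R - {0}\<close> by simp
          ultimately obtain i k where "u = b i * q ^ k" using den_zero by metis
          thus False using gen[of i k N] u by (simp add: norm_mult norm_power r_def)
        qed
        ultimately show "u \<in> U0" by (simp add: U0_def)
      qed
      hence "continuous_on (path_image (circlepath 0 (\<rho>0 * r ^ N))) J"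
        by (rule continuous_on_subset[OF holomorphic_on_imp_continuous_on[OF JU0]])
      thus "(J has_contour_integral contour_integral (circlepath 0 (\<rho>0 * r ^ N)) J) (circlepath 0 (\<rho>0 * r ^ N))"
        by (intro has_contour_integral_integral contour_integrable_continuous_circlepath)
    qed (use C0 \<rho>00 r bnd in auto)
    hence le: "norm (contour_integral (circlepath 0 (\<rho>0 * r ^ N)) J) \<le> 2 * pi * C * r ^ N" for N
      using \<rho>00 by (simp add: mult_ac)
    have "(\<lambda>N. 2 * pi * C * r ^ N) \<longlonglongrightarrow> 0"
      by (intro tendsto_mult_right_zero LIMSEQ_power_zero) (use r in auto)
    thus ?thesis by (rule Lim_null_comparison[rotated]) (use le in auto)
  qed
  have "(\<lambda>N. contour_integral (circlepath 0 (\<rho>0 * r ^ N)) J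
      + 2 * pi * \<i> * ((\<Sum>k\<in>K N False. theta_res q H (b False) F k) + (\<Sum>k\<in>K N True. theta_res q H (b True) F k)))
    \<longlonglongrightarrow> 0 + 2 * pi * \<i> * ((\<Sum>k. theta_res q H (b False) F k) + (\<Sum>k. theta_res q H (b True) F k))"
    by (intro tendsto_intros small res_lim)
  hence c3: "contour_integral (circlepath 0 \<rho>) J = 2 * pi * \<i> * ((\<Sum>k. theta_res q H \<beta> F k) + (\<Sum>k. theta_res q H (1 / \<beta>) F k))"
    unfolding c1 c2[symmetric] by (simp add: LIMSEQ_const_iff b_def)
  have \<rho>pos: "\<rho> > 0" using \<rho>0(2) \<rho>00 by simp
  have "path_image (circlepath 0 \<rho>) \<subseteq> U0"
  proof
    fix u assume "u \<in> path_image (circlepath 0 \<rho>)"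
    hence u: "norm u = \<rho>" using \<rho>pos by simp
    hence "u \<in> ball 0 R - {0}" using \<rho>pos \<rho>(3) by auto
    moreover have "den u \<noteq> 0"
    proof
      assume "den u = 0"
      moreover have "u \<noteq> 0" using \<open>u \<in> ball 0 R - {0}\<close> by simp
      ultimately obtain i k where "u = p (i, k)" unfolding p_def using den_zero by (metis case_prod_conv)
      thus False using np_le[of "(i, k)"] u \<rho>0(2) by simp
    qed
    ultimately show "u \<in> U0" by (simp add: U0_def)
  qed
  hence "continuous_on (path_image (circlepath 0 \<rho>)) J"
    by (rule continuous_on_subset[OF holomorphic_on_imp_continuous_on[OF JU0]])
  hence "(J has_contour_integral contour_integral (circlepath 0 \<rho>) J) (circlepath 0 \<rho>)"
    by (intro has_contour_integral_integral contour_integrable_continuous_circlepath)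
  hence "((\<lambda>t. J (0 + \<rho> * cis t) * \<rho> * \<i> * cis t) has_integral contour_integral (circlepath 0 \<rho>) J) {0..2 * pi}"
    unfolding circlepath_def by (subst (asm) has_contour_integral_part_circlepath_iff) auto
  \<comment> \<open>J contains the factor 1 / u, and du / u = i dt on the circle; multiplication by
    - i leaves the integral over the angle.\<close>
  hence "((\<lambda>t. - \<i> * (J (0 + \<rho> * cis t) * \<rho> * \<i> * cis t)) has_integral - \<i> * contour_integral (circlepath 0 \<rho>) J) {0..2 * pi}"
    by (rule has_integral_mult_right)
  moreover have "- \<i> * (J (0 + \<rho> * cis t) * \<rho> * \<i> * cis t) = theta_quot q H \<beta> (\<rho> * cis t) * F (\<rho> * cis t)" for t
  proof -
    have alg: "- i * (Y * c * i * d) = - (i * i) * (Y * (c * d))" for i Y c d :: complex by algebra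
    have "- \<i> * (X / (\<rho> * cis t) * \<rho> * \<i> * cis t) = X" for X
      unfolding alg using \<rho>pos by simp
    thus ?thesis by (simp only: J_def add_0_left)
  qed
  moreover have "- \<i> * contour_integral (circlepath 0 \<rho>) J = 2 * of_real pi * ((\<Sum>k. theta_res q H \<beta> F k) + (\<Sum>k. theta_res q H (1 / \<beta>) F k))"
  proof -
    have alg: "- i * (c * i * X) = - (i * i) * (c * X)" for i c X :: complex by algebra
    show ?thesis unfolding c3 alg by simp
  qed
  ultimately have "((\<lambda>t. theta_quot q H \<beta> (\<rho> * cis t) * F (\<rho> * cis t)) has_integral
    2 * of_real pi * ((\<Sum>k. theta_res q H \<beta> F k) + (\<Sum>k. theta_res q H (1 / \<beta>) F k))) {0..2 * pi}"
    by (simp only:)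
  moreover have "cis (t + 2 * pi) = cis t" for t by (metis cis_mult cis_2pi mult.right_neutral)
  ultimately show ?thesis by (intro has_integral_periodic_shift) simp_all
qed

end

subsection \<open>Evaluating the residue series\<close>

text \<open>As q = s^2, the factors of even index are differences of squares in p q^k and those of
  odd index in s p q^k. The limit is taken along the even lengths.\<close>

lemma qpoch_inf_square:
  assumes q: "norm q < 1" and s: "s ^ 2 = q"
  shows "qpoch_inf (p ^ 2) q = qpoch_inf p q * qpoch_inf (- p) q * (qpoch_inf (s * p) q * qpoch_inf (- (s * p)) q)"
proof -
  have "qpoch (p ^ 2) q (2 * k) = qpoch p q k * qpoch (- p) q k * (qpoch (s * p) q k * qpoch (- (s * p)) q k)" for k
  proof (induction k)
    case (Suc k)
    define X where "X = q ^ k"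
    have e: "q ^ (2 * k) = X ^ 2" "q ^ Suc (2 * k) = s ^ 2 * X ^ 2"
      by (simp_all add: X_def s power_mult flip: power_mult_distrib) (simp_all add: mult.commute flip: power_mult)
    have "qpoch (p ^ 2) q (2 * Suc k) = qpoch (p ^ 2) q (2 * k) * ((1 - p ^ 2 * X ^ 2) * (1 - p ^ 2 * (s ^ 2 * X ^ 2)))"
      by (simp only: mult_Suc_right add_2_eq_Suc qpoch_Suc e mult.assoc)
    also have "(1 - p ^ 2 * X ^ 2) * (1 - p ^ 2 * (s ^ 2 * X ^ 2)) =
       ((1 - p * X) * (1 - (- p) * X)) * ((1 - s * p * X) * (1 - (- (s * p)) * X))"
      by algebra
    finally show ?case unfolding Suc.IH qpoch_Suc X_def by (simp only: mult_ac)
  qed simp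
  moreover have "(\<lambda>k. qpoch (p ^ 2) q (2 * k)) \<longlonglongrightarrow> qpoch_inf (p ^ 2) q"
    using LIMSEQ_subseq_LIMSEQ[OF qpoch_tendsto[OF q], of "\<lambda>k. 2 * k"] by (simp add: strict_mono_def o_def)
  moreover have "(\<lambda>k. qpoch p q k * qpoch (- p) q k * (qpoch (s * p) q k * qpoch (- (s * p)) q k)) \<longlonglongrightarrow>
      qpoch_inf p q * qpoch_inf (- p) q * (qpoch_inf (s * p) q * qpoch_inf (- (s * p)) q)"
    by (intro tendsto_intros qpoch_tendsto q)
  ultimately show ?thesis by (simp add: LIMSEQ_unique)
qed

definition wgt :: "complex \<Rightarrow> complex \<Rightarrow> complex \<Rightarrow> complex \<Rightarrow> complex \<Rightarrow> complex \<Rightarrow> complex" where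
  "wgt q s A x \<beta> u = qpoch_inf (s * A * u) q * qpoch_inf (\<beta> * A ^ 2 * u) q * qpoch_inf (A ^ 2 / \<beta> * u) q /
     (qpoch_inf (A * x * u) q * qpoch_inf (A / x * u) q * qpoch_inf (A * u) q * qpoch_inf (- (A * u)) q * qpoch_inf (- (s * A * u)) q)"

text \<open>At u = \<beta> q^k the weight contains (p^2 q^k)_inf. Splitting (p^2)_inf by
  \<open>qpoch_inf_square\<close> cancels three of the four parts against the denominator; the
  fourth is the second factor (s p)_inf in \<open>T\<close>.\<close>

lemma (in clausen) suminf_theta_res:
  assumes \<beta>: "\<beta> ^ 2 = B" and x: "x \<noteq> 0"
    and nx: "norm (p * x) < 1" "norm (p / x) < 1" "norm (p / B * x) < 1" "norm (p / B / x) < 1"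
  shows "(\<Sum>k. theta_res q H \<beta> (wgt q s (p / \<beta>) x \<beta>) k) =
    qtheta (H / \<beta>) q * qtheta (H * \<beta>) q / qpoch_inf q q * (T x / prefac x)"
proof -
  have \<beta>0: "\<beta> \<noteq> 0" using \<beta> B0 by auto
  define c where "c = qtheta (H / \<beta>) q * qtheta (H * \<beta>) q / qpoch_inf q q"
  define K where "K = qpoch_inf (s * p) q ^ 2 * qpoch_inf (p ^ 2 / B) q / (qpoch_inf (p * x) q * qpoch_inf (p / x) q)"
  have np': "norm (- p) < 1" "norm (- (s * p)) < 1" using np nsp by simp_all
  note nz = qpoch_inf_nonzero[OF q nx(1)] qpoch_inf_nonzero[OF q nx(2)] qpoch_inf_nonzero[OF q nx(3)] qpoch_inf_nonzero[OF q nx(4)]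
    qpoch_inf_nonzero[OF q np] qpoch_inf_nonzero[OF q np'(1)] qpoch_inf_nonzero[OF q np'(2)] qpoch_inf_nonzero[OF q nsp]
  have split: "qpoch_inf (a * q ^ k) q = qpoch_inf a q / qpoch a q k" if "norm a < 1" for a k
    using qpoch_inf_split[OF q, of a k] qpoch_nonzero[OF q that, of k] by simp
  have res: "theta_res q H \<beta> (wgt q s (p / \<beta>) x \<beta>) k =
      c / qpoch_inf (1 / B) q * K * (ct k * (qpoch (p * x) q k * qpoch (p / x) q k))" for k
  proof -
    have e: "s * (p / \<beta>) * (\<beta> * q ^ k) = s * p * q ^ k" "\<beta> * (p / \<beta>) ^ 2 * (\<beta> * q ^ k) = p ^ 2 * q ^ k"
      "(p / \<beta>) ^ 2 / \<beta> * (\<beta> * q ^ k) = p ^ 2 / B * q ^ k" "p / \<beta> * x * (\<beta> * q ^ k) = p * x * q ^ k"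
      "p / \<beta> / x * (\<beta> * q ^ k) = p / x * q ^ k" "p / \<beta> * (\<beta> * q ^ k) = p * q ^ k"
      using \<beta>0 by (simp_all add: power2_eq_square flip: \<beta>)
    have m: "- (p * q ^ k) = - p * q ^ k" "- (s * p * q ^ k) = - (s * p) * q ^ k" by simp_all
    have arr: "g1 / n1 * ((P * M * (S * N)) / n2) * (g3 / n3) / (g4 / n4 * (g5 / n5) * (P / n6) * (M / n7) * (N / n8))
      = S * g1 * g3 / (g4 * g5) * ((n4 * n5 * n6 * n7 * n8) / (n1 * n2 * n3))"
      if "P \<noteq> 0" "M \<noteq> 0" "N \<noteq> 0" for P M S N g1 g3 g4 g5 n1 n2 n3 n4 n5 n6 n7 n8 :: complex
      using that by (simp add: mult_ac)
    have "wgt q s (p / \<beta>) x \<beta> (\<beta> * q ^ k) = qpoch_inf (s * p * q ^ k) q * qpoch_inf (p ^ 2 * q ^ k) q * qpoch_inf (p ^ 2 / B * q ^ k) q /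
      (qpoch_inf (p * x * q ^ k) q * qpoch_inf (p / x * q ^ k) q * qpoch_inf (p * q ^ k) q * qpoch_inf (- p * q ^ k) q * qpoch_inf (- (s * p) * q ^ k) q)"
      unfolding wgt_def e m ..
    also have "\<dots> = qpoch_inf (s * p) q * qpoch_inf (s * p) q * qpoch_inf (p ^ 2 / B) q / (qpoch_inf (p * x) q * qpoch_inf (p / x) q) *
       ((qpoch (p * x) q k * qpoch (p / x) q k * qpoch p q k * qpoch (- p) q k * qpoch (- (s * p)) q k) /
        (qpoch (s * p) q k * qpoch (p ^ 2) q k * qpoch (p ^ 2 / B) q k))"
      unfolding split[OF nsp] split[OF np2] split[OF nA] split[OF nx(1)] split[OF nx(2)] split[OF np] split[OF np'(1)] split[OF np'(2)]
        qpoch_inf_square[OF q s, of p]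
      by (rule arr) (use nz in auto)
    finally have w: "wgt q s (p / \<beta>) x \<beta> (\<beta> * q ^ k) = K * ((qpoch (p * x) q k * qpoch (p / x) q k * qpoch p q k * qpoch (- p) q k * qpoch (- (s * p)) q k) /
        (qpoch (s * p) q k * qpoch (p ^ 2) q k * qpoch (p ^ 2 / B) q k))"
      by (simp only: K_def power2_eq_square)
    show ?thesis unfolding theta_res_def w \<beta> ct_def c_def by (simp add: mult_ac)
  qed
  have sum: "(\<lambda>k. ct k * (qpoch (p * x) q k * qpoch (p / x) q k)) sums ksum q ct p x"
    unfolding ksum_def by (intro summable_sums summable_ksum q summable_ct)
  have "(\<Sum>k. theta_res q H \<beta> (wgt q s (p / \<beta>) x \<beta>) k) = c / qpoch_inf (1 / B) q * K * ksum q ct p x"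
    unfolding res by (rule sums_unique[symmetric, OF sums_mult[OF sum]])
  also have "\<dots> = c * (T x / prefac x)"
    unfolding T_def prefac_def K_def using nz(1-4) by simp
  finally show ?thesis unfolding c_def .
qed

lemma wgt_inverse: "wgt q s A x (1 / \<beta>) = wgt q s A x \<beta>"
  by (simp add: fun_eq_iff wgt_def mult_ac)

theorem (in clausen_pair) suminf_theta_res_pair:
  assumes \<beta>: "\<beta> ^ 2 = B" and x: "x \<noteq> 0"
    and nx: "norm (p * x) < 1" "norm (p / x) < 1" "norm (p / B * x) < 1" "norm (p / B / x) < 1"
  shows "(\<Sum>k. theta_res q H \<beta> (wgt q s (p / \<beta>) x \<beta>) k) + (\<Sum>k. theta_res q H (1 / \<beta>) (wgt q s (p / \<beta>) x \<beta>) k) =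
    qtheta (H / \<beta>) q * qtheta (H * \<beta>) q / qpoch_inf q q * (W x ^ 2 / prefac x)"
proof -
  have \<beta>0: "\<beta> \<noteq> 0" using \<beta> B0 by auto
  have e: "p / B / (1 / \<beta>) = p / \<beta>" "(1 / \<beta>) ^ 2 = 1 / B" "H / (1 / \<beta>) = H * \<beta>" "H * (1 / \<beta>) = H / \<beta>"
    "p / B / (1 / B) = p"
    using \<beta>0 B0 by (simp_all add: power2_eq_square divide_simps flip: \<beta>)
  have "(\<Sum>k. theta_res q H (1 / \<beta>) (wgt q s (p / \<beta>) x \<beta>) k) = qtheta (H * \<beta>) q * qtheta (H / \<beta>) q / qpoch_inf q q * (dual.T x / prefac x)"
    using dual.suminf_theta_res[of "1 / \<beta>" x H] x nx unfolding e wgt_inverse dual_prefac by simp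
  moreover have "T x + dual.T x = W x ^ 2"
    using D_eq_0[OF x] W_dual[OF x] by (simp add: D_def power2_eq_square)
  ultimately show ?thesis
    unfolding suminf_theta_res[OF \<beta> x nx] by (simp add: add_divide_distrib ring_distribs mult_ac flip: \<open>_ = W x ^ 2\<close>)
qed

subsection \<open>Continuity in the parameters\<close>

text \<open>The 2phi1 multiplied by (c, z)_inf, with (c)_inf / (c)_k rewritten as (c q^k)_inf. This
  form has no exceptional values of c and is holomorphic in the parameters.\<close>

definition phi21_reg :: "complex \<Rightarrow> complex \<Rightarrow> complex \<Rightarrow> complex \<Rightarrow> complex \<Rightarrow> complex" where
  "phi21_reg q a b c z = qpoch_inf z q * (\<Sum>k. qpoch a q k * qpoch b q k * qpoch_inf (c * q ^ k) q / qpoch q q k * z ^ k)"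

lemma phi21_reg_eq:
  assumes q: "norm q < 1" and z: "norm z < 1" and c: "qpoch_inf c q \<noteq> 0"
  shows "phi21_reg q a b c z = qpoch_inf c q * qpoch_inf z q * phi21 a b c q z"
proof -
  have nz: "qpoch c q k \<noteq> 0" for k
    using qpoch_inf_split[OF q, of c k] c by auto
  obtain C where C: "\<And>k. norm (1 / qpoch q q k) \<le> C"
    using inverse_qpoch_bounded[OF q qpoch_inf_nonzero[OF q q]] by blast
  obtain C' where C': "\<And>k. norm (1 / qpoch c q k) \<le> C'"
    using inverse_qpoch_bounded[OF q c] by blast
  define E where "E = (\<lambda>a::complex. exp (norm a / (1 - norm q)))"
  have sum: "summable (\<lambda>k. qpochs [a, b] q k / qpochs [q, c] q k * z ^ k)"
  proof (rule summable_comparison_test'[of "\<lambda>k. E a * E b * (C * C') * norm z ^ k" 0])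
    show "summable (\<lambda>k. E a * E b * (C * C') * norm z ^ k)"
      by (intro summable_mult summable_geometric) (use z in simp)
    fix k
    have C0: "0 \<le> C" "0 \<le> C'" using order_trans[OF norm_ge_zero C[of k]] order_trans[OF norm_ge_zero C'[of k]] .
    have "norm (qpochs [a, b] q k / qpochs [q, c] q k * z ^ k) =
        norm (qpoch a q k) * norm (qpoch b q k) * (norm (1 / qpoch q q k) * norm (1 / qpoch c q k)) * norm z ^ k"
      by (simp add: qpochs_def norm_mult norm_divide norm_power)
    also have "\<dots> \<le> E a * E b * (C * C') * norm z ^ k"
      unfolding E_def by (intro mult_mono mult_right_mono norm_qpoch_le[OF q] C C') (auto simp: C0)
    finally show "norm (qpochs [a, b] q k / qpochs [q, c] q k * z ^ k) \<le> E a * E b * (C * C') * norm z ^ k" .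
  qed
  have "qpoch a q k * qpoch b q k * qpoch_inf (c * q ^ k) q / qpoch q q k * z ^ k =
      qpoch_inf c q * (qpochs [a, b] q k / qpochs [q, c] q k * z ^ k)" for k
    using qpoch_inf_split[OF q, of c k] nz[of k] by (simp add: qpochs_def)
  thus ?thesis
    unfolding phi21_reg_def phi21_def using suminf_mult[OF sum, of "qpoch_inf c q"] by (simp add: mult_ac)
qed

lemma holomorphic_on_phi21_reg:
  assumes q: "norm q < 1" and S: "open S" and hol: "a holomorphic_on S" "c holomorphic_on S" "z holomorphic_on S"
    and z: "\<And>y. y \<in> S \<Longrightarrow> norm (z y) < 1"
  shows "(\<lambda>y. phi21_reg q (a y) b (c y) (z y)) holomorphic_on S"
  unfolding phi21_reg_def
proof (intro holomorphic_intros q hol holomorphic_on_suminf S)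
  show "qpoch q q k \<noteq> 0" for k by (rule qpoch_nonzero[OF q q])
  fix y assume "y \<in> S"
  then obtain d where d: "d > 0" "cball y d \<subseteq> S" using S by (auto simp: open_contains_cball)
  have cont: "continuous_on (cball y d) a" "continuous_on (cball y d) c" "continuous_on (cball y d) z"
    using hol d(2) by (auto intro: holomorphic_on_imp_continuous_on holomorphic_on_subset)
  obtain Ma where Ma: "Ma > 0" "\<And>x. x \<in> cball y d \<Longrightarrow> norm (a x) \<le> Ma"
    using continuous_on_compact_bounded[OF cont(1) compact_cball] by blast
  obtain Mc where Mc: "Mc > 0" "\<And>x. x \<in> cball y d \<Longrightarrow> norm (c x) \<le> Mc"
    using continuous_on_compact_bounded[OF cont(2) compact_cball] by blast
  have "\<exists>x0\<in>cball y d. \<forall>x\<in>cball y d. norm (z x) \<le> norm (z x0)"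
    by (intro continuous_attains_sup continuous_on_norm cont) (use d(1) in auto)
  then obtain x0 where x0: "x0 \<in> cball y d" "\<And>x. x \<in> cball y d \<Longrightarrow> norm (z x) \<le> norm (z x0)" by blast
  obtain C where C: "\<And>k. norm (1 / qpoch q q k) \<le> C"
    using inverse_qpoch_bounded[OF q qpoch_inf_nonzero[OF q q]] by blast
  have C0: "0 \<le> C" using order_trans[OF norm_ge_zero C[of 0]] .
  define E where "E = (\<lambda>m. exp (m / (1 - norm q)))"
  have bd: "norm (qpoch (a x) q k * qpoch b q k * qpoch_inf (c x * q ^ k) q / qpoch q q k * z x ^ k)
     \<le> E Ma * E (norm b) * E Mc * C * norm (z x0) ^ k" if x: "x \<in> cball y d" for x k
  proof -
    have "norm (c x * q ^ k) \<le> norm (c x)"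
      using mult_left_le[OF norm_qpower_le_one[OF q, of k], of "norm (c x)"] by (simp add: norm_mult)
    hence m: "norm (c x * q ^ k) \<le> Mc" using Mc(2)[OF x] by simp
    have "norm (qpoch (a x) q k * qpoch b q k * qpoch_inf (c x * q ^ k) q / qpoch q q k * z x ^ k) =
       norm (qpoch (a x) q k) * norm (qpoch b q k) * norm (qpoch_inf (c x * q ^ k) q) * norm (1 / qpoch q q k) * norm (z x) ^ k"
      by (simp add: norm_mult norm_divide norm_power)
    also have "\<dots> \<le> E Ma * E (norm b) * E Mc * C * norm (z x0) ^ k"
      unfolding E_def using Ma(2)[OF x] m C x0(2)[OF x] C0
      by (intro mult_mono power_mono norm_qpoch_le[OF q] norm_qpoch_inf_le[OF q]) auto
    finally show ?thesis .
  qed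
  have "summable (\<lambda>k. E Ma * E (norm b) * E Mc * C * norm (z x0) ^ k)"
    by (intro summable_mult summable_geometric) (use z x0(1) d(2) in auto)
  with d bd show "\<exists>d>0. \<exists>M. cball y d \<subseteq> S \<and> summable M \<and>
      (\<forall>k. \<forall>x\<in>cball y d. norm (qpoch (a x) q k * qpoch b q k * qpoch_inf (c x * q ^ k) q / qpoch q q k * z x ^ k) \<le> M k)"
    by blast
qed

lemma countable_square_roots:
  fixes f :: "'i::countable \<Rightarrow> complex"
  shows "countable {\<beta>. \<exists>i. \<beta> ^ 2 = f i}"
proof -
  have "{\<beta>. \<exists>i. \<beta> ^ 2 = f i} \<subseteq> (\<Union>i. {csqrt (f i), - csqrt (f i)})"
    by (auto simp: power2_eq_iff) (metis power2_csqrt power2_eq_iff)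
  thus ?thesis by (rule countable_subset) auto
qed

text \<open>If f and g differed at a point, they would differ on a disc, which would then be
  contained in the countable set C.\<close>

lemma continuous_on_eq_off_countable:
  fixes f g :: "complex \<Rightarrow> complex"
  assumes U: "open U" and f: "continuous_on U f" and g: "continuous_on U g" and C: "countable C"
    and eq: "\<And>y. y \<in> U \<Longrightarrow> y \<notin> C \<Longrightarrow> f y = g y" and y: "y \<in> U"
  shows "f y = g y"
proof (rule ccontr)
  assume neq: "f y \<noteq> g y"
  have "open (U \<inter> (\<lambda>y. f y - g y) -` (- {0}))"
    by (intro continuous_open_preimage continuous_intros f g U open_Compl closed_singleton)
  moreover have "y \<in> U \<inter> (\<lambda>y. f y - g y) -` (- {0})" using neq y by simp
  ultimately obtain d where d: "d > 0" "ball y d \<subseteq> U \<inter> (\<lambda>y. f y - g y) -` (- {0})"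
    by (meson open_contains_ball)
  have "ball y d \<subseteq> C" using d(2) eq by force
  hence "countable (ball y d)" using C by (rule countable_subset)
  thus False using uncountable_ball[OF d(1), of y] by simp
qed

section \<open>The integral as a function of \<beta>\<close>

definition param_annulus :: "real \<Rightarrow> complex set" where
  "param_annulus \<rho> = {\<beta>. norm \<beta> < \<rho> \<and> 1 < \<rho> * norm \<beta>}"

text \<open>The right-hand side of the theorem as a function of \<beta>, with A, x and H held fixed:
  A x / \<beta> = a, s x = b, s A / \<beta> = q a / b and A \<beta> / x = z.\<close>

definition wgt_integral :: "complex \<Rightarrow> complex \<Rightarrow> complex \<Rightarrow> complex \<Rightarrow> complex \<Rightarrow> complex \<Rightarrow> complex" where
  "wgt_integral q s A x H \<beta> = 2 * of_real pi * (qtheta (H / \<beta>) q * qtheta (H * \<beta>) q / qpoch_inf q q *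
     (phi21_reg q (A * x / \<beta>) (s * x) (s * A / \<beta>) (A / x * \<beta>) ^ 2 /
      (qpoch_inf (A * x * \<beta>) q * qpoch_inf (A / x * \<beta>) q * (qpoch_inf (A * x / \<beta>) q * qpoch_inf (A / x / \<beta>) q))))"

context
  fixes q s A x H :: complex and \<rho> :: real
  assumes q: "norm q < 1" and q0: "q \<noteq> 0" and s: "s ^ 2 = q" and A0: "A \<noteq> 0" and x0: "x \<noteq> 0" and H0: "H \<noteq> 0"
    and \<rho>: "\<rho> > 0" "norm (A * x) * \<rho> < 1" "norm (A / x) * \<rho> < 1" "norm A * \<rho> < 1"
begin

lemma param_annulusD:
  assumes "\<beta> \<in> param_annulus \<rho>"
  shows "\<beta> \<noteq> 0" "norm \<beta> < \<rho>" "1 / norm \<beta> < \<rho>"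
  using assms by (auto simp: param_annulus_def divide_simps mult_ac)

lemma norm_param_less_one:
  assumes "\<beta> \<in> param_annulus \<rho>" and M: "norm M * \<rho> < 1"
  shows "norm (M * \<beta>) < 1" "norm (M / \<beta>) < 1"
proof -
  note b = param_annulusD[OF assms(1)]
  have "norm (M * \<beta>) \<le> norm M * \<rho>" unfolding norm_mult using b by (intro mult_left_mono) auto
  thus "norm (M * \<beta>) < 1" using M by simp
  have "norm (M / \<beta>) = norm M * (1 / norm \<beta>)" by (simp add: norm_divide)
  also have "\<dots> \<le> norm M * \<rho>" using b by (intro mult_left_mono) auto
  finally show "norm (M / \<beta>) < 1" using M by simp
qed

lemma norm_s: "norm s < 1"
  using q power_less_one_iff[of "norm s" 2] by (simp add: norm_power flip: s)

lemma norm_sA: "norm (s * A) * \<rho> < 1"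
proof -
  have "norm (s * A) * \<rho> = norm s * (norm A * \<rho>)" by (simp add: norm_mult)
  also have "\<dots> \<le> 1 * (norm A * \<rho>)" by (intro mult_right_mono) (use norm_s \<rho>(1) in auto)
  finally show ?thesis using \<rho>(4) by simp
qed

text \<open>The exclusions on \<beta> are those of \<open>clausen_pair\<close> for p = A \<beta> and
  B = \<beta>^2.\<close>

lemma integral_generic:
  assumes \<beta>: "\<beta> \<in> param_annulus \<rho>" and nb: "\<And>j::nat. \<beta> ^ 2 * q ^ j \<noteq> 1" "\<And>j::nat. q ^ j \<noteq> \<beta> ^ 2"
    and nq: "(A * \<beta>) ^ 2 \<noteq> q" "(A / \<beta>) ^ 2 \<noteq> q"
  shows "((\<lambda>t. theta_quot q H \<beta> (\<rho> * cis t) * wgt q s A x \<beta> (\<rho> * cis t)) has_integral wgt_integral q s A x H \<beta>) {- pi..pi}"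
proof -
  note b = param_annulusD[OF \<beta>]
  note less = norm_param_less_one[OF \<beta>]
  have e: "A * \<beta> / \<beta> ^ 2 = A / \<beta>" "(A * \<beta>) ^ 2 / \<beta> ^ 2 = A ^ 2" "(A / \<beta>) ^ 2 / (1 / \<beta> ^ 2) = A ^ 2" "A * \<beta> / \<beta> = A"
    using b(1) by (simp_all add: power2_eq_square)
  have nA2: "norm (A ^ 2) < 1"
  proof -
    have "norm (A ^ 2) = norm (A * \<beta>) * norm (A / \<beta>)" using b(1) by (simp add: power2_eq_square norm_mult norm_divide)
    also have "\<dots> < 1 * 1" by (rule mult_strict_mono) (use less[OF \<rho>(4)] in auto)
    finally show ?thesis by simp
  qed
  interpret clausen_pair q s "A * \<beta>" "\<beta> ^ 2"
  proof (unfold clausen_pair_def clausen_def e, safe)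
    fix j :: nat
    show False if "1 / \<beta> ^ 2 * q ^ j = 1" using that b(1) nb(2)[of j] by simp
    show False if "q ^ j = 1 / \<beta> ^ 2" using that b(1) nb(1)[of j] by simp
  qed (use q q0 s A0 b nb nq less[OF \<rho>(4)] nA2 in auto)
  \<comment> \<open>The largest modulus among the denominator parameters of \<open>wgt\<close>,
    which is therefore holomorphic for |u| < 1 / M, a disc containing the circle of radius
    \<rho>.\<close>
  define M where "M = max (max (norm (A * x)) (norm (A / x))) (max (norm A) (norm (s * A)))"
  have M: "norm (A * x) \<le> M" "norm (A / x) \<le> M" "norm A \<le> M" "norm (s * A) \<le> M" by (auto simp: M_def)
  have M\<rho>: "M * \<rho> < 1" using \<rho> norm_sA by (auto simp: M_def max_def)
  have M0: "M > 0" using M(3) A0 by (meson less_le_trans zero_less_norm_iff)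
  have "wgt q s A x \<beta> holomorphic_on ball 0 (1 / M)"
  proof -
    have nz: "qpoch_inf (c * u) q \<noteq> 0" if u: "u \<in> ball 0 (1 / M)" and c: "norm c \<le> M" for u c
    proof (rule qpoch_inf_nonzero[OF q])
      have "norm (c * u) \<le> M * norm u" unfolding norm_mult by (intro mult_right_mono c) auto
      also have "\<dots> < 1" using u M0 by (simp add: field_simps)
      finally show "norm (c * u) < 1" .
    qed
    show ?thesis
      unfolding wgt_def[abs_def]
      using nz[OF _ M(1)] nz[OF _ M(2)] nz[OF _ M(3)] nz[OF _ M(4)] nz[of _ "- A"] nz[of _ "- (s * A)"] M(3,4)
      by (intro holomorphic_intros q) (auto simp: b(1))
  qed
  from theta_quot_integral[OF q q0 b(1) H0 nb b(2,3) _ this]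
  have I: "((\<lambda>t. theta_quot q H \<beta> (\<rho> * cis t) * wgt q s A x \<beta> (\<rho> * cis t)) has_integral
      2 * of_real pi * ((\<Sum>k. theta_res q H \<beta> (wgt q s A x \<beta>) k) + (\<Sum>k. theta_res q H (1 / \<beta>) (wgt q s A x \<beta>) k))) {- pi..pi}"
    using M\<rho> M0 by (simp add: field_simps)
  have nx: "norm (A * \<beta> * x) < 1" "norm (A * \<beta> / x) < 1" "norm (A * \<beta> / \<beta> ^ 2 * x) < 1" "norm (A * \<beta> / \<beta> ^ 2 / x) < 1"
    using less[OF \<rho>(2)] less[OF \<rho>(3)] unfolding e by (simp_all add: mult_ac)
  have S: "(\<Sum>k. theta_res q H \<beta> (wgt q s A x \<beta>) k) + (\<Sum>k. theta_res q H (1 / \<beta>) (wgt q s A x \<beta>) k) =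
    qtheta (H / \<beta>) q * qtheta (H * \<beta>) q / qpoch_inf q q * (W x ^ 2 / prefac x)"
    using suminf_theta_res_pair[OF refl x0 nx, of H] unfolding e .
  have W: "W x = phi21_reg q (A * x / \<beta>) (s * x) (s * A / \<beta>) (A / x * \<beta>)"
  proof -
    have nc: "qpoch_inf (s * A / \<beta>) q \<noteq> 0" "qpoch_inf (A / x * \<beta>) q \<noteq> 0"
      by (intro qpoch_inf_nonzero[OF q] less norm_sA \<rho>)+
    have az: "A * x / \<beta> * (A / x * \<beta>) = A ^ 2" "s * x * (A / x * \<beta>) = s * A * \<beta>"
      using x0 b(1) by (simp_all add: power2_eq_square)
    have "phi21 (A * x / \<beta>) (s * x) (s * A / \<beta>) q (A / x * \<beta>) =
        qpoch_inf (A ^ 2) q / qpoch_inf (A / x * \<beta>) q * phi22 (A * x / \<beta>) (A / x / \<beta>) (s * A / \<beta>) (A ^ 2) q (s * A * \<beta>)"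
      using phi21_eq_phi22[OF q less(1)[OF \<rho>(3)], of "s * A / \<beta>" "s * x" "A / x / \<beta>" "A * x / \<beta>"]
        nc x0 qpoch_inf_nonzero[OF q nA2] unfolding az by simp
    hence reg: "phi21_reg q (A * x / \<beta>) (s * x) (s * A / \<beta>) (A / x * \<beta>) =
        qpoch_inf (s * A / \<beta>) q * qpoch_inf (A ^ 2) q * phi22 (A * x / \<beta>) (A / x / \<beta>) (s * A / \<beta>) (A ^ 2) q (s * A * \<beta>)"
      unfolding phi21_reg_eq[OF q less(1)[OF \<rho>(3)] nc(1)] using nc by simp
    \<comment> \<open>The dual form of W is the one whose 2phi2 has the denominator parameters and
      the argument produced by \<open>phi21_eq_phi22\<close>.\<close>
    have "W x = dual.W x" by (rule W_dual[OF x0, symmetric])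
    also have "\<dots> = qpoch_inf (s * (A / \<beta>)) q * qpoch_inf (A ^ 2) q *
        phi22 (A / \<beta> * x) (A / \<beta> / x) (A ^ 2) (s * (A / \<beta>)) q (s * (A / \<beta>) / (1 / \<beta> ^ 2))"
      by (subst dual.W_eq_phi22) (simp only: e)
    also have "\<dots> = qpoch_inf (s * A / \<beta>) q * qpoch_inf (A ^ 2) q * phi22 (A * x / \<beta>) (A / x / \<beta>) (s * A / \<beta>) (A ^ 2) q (s * A * \<beta>)"
      using b(1) by (simp add: phi22_def qpochs_def power2_eq_square mult_ac)
    finally show ?thesis unfolding reg .
  qed
  have "prefac x = qpoch_inf (A * x * \<beta>) q * qpoch_inf (A / x * \<beta>) q * (qpoch_inf (A * x / \<beta>) q * qpoch_inf (A / x / \<beta>) q)"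
    unfolding prefac_def e by (simp add: mult_ac)
  with I show ?thesis unfolding S W wgt_integral_def by simp
qed

theorem theta_quot_wgt_integral:
  assumes "\<beta> \<in> param_annulus \<rho>"
  shows "((\<lambda>t. theta_quot q H \<beta> (\<rho> * cis t) * wgt q s A x \<beta> (\<rho> * cis t)) has_integral wgt_integral q s A x H \<beta>) {- pi..pi}"
proof -
  define I where "I = (\<lambda>\<beta> t. theta_quot q H \<beta> (\<rho> * cis t) * wgt q s A x \<beta> (\<rho> * cis t))"
  \<comment> \<open>Indexing by \<open>unit\<close> lets \<open>countable_square_roots\<close> also
    cover the single equations (A \<beta>)^2 = q and (A / \<beta>)^2 = q.\<close>
  define Bad where "Bad = {\<beta>. \<exists>j. \<beta> ^ 2 = 1 / q ^ j} \<union> {\<beta>. \<exists>j. \<beta> ^ 2 = q ^ j}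
     \<union> {\<beta>. \<exists>j::unit. \<beta> ^ 2 = q / A ^ 2} \<union> {\<beta>. \<exists>j::unit. \<beta> ^ 2 = A ^ 2 / q}"
  have Bad: "countable Bad" unfolding Bad_def by (intro countable_Un countable_square_roots)
  have U: "open (param_annulus \<rho>)"
  proof -
    have "param_annulus \<rho> = {\<beta>. norm \<beta> < \<rho>} \<inter> {\<beta>. 1 < \<rho> * norm \<beta>}" by (auto simp: param_annulus_def)
    thus ?thesis by (auto intro!: open_Int open_Collect_less continuous_intros)
  qed
  have nz: "qpoch_inf (c * (\<rho> * cis t)) q \<noteq> 0" if "norm c * \<rho> < 1" for c t
    by (rule qpoch_inf_nonzero[OF q]) (use that \<rho>(1) in \<open>simp add: norm_mult\<close>)
  have nzA: "qpoch_inf (- (A * (\<rho> * cis t))) q \<noteq> 0" "qpoch_inf (- (s * A * (\<rho> * cis t))) q \<noteq> 0" for t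
    using nz[of "- A" t] nz[of "- (s * A)" t] \<rho>(4) norm_sA by simp_all
  have nzb: "qpoch_inf (\<beta> / (\<rho> * cis t)) q \<noteq> 0" "qpoch_inf (1 / (\<beta> * (\<rho> * cis t))) q \<noteq> 0"
    if "\<beta> \<in> param_annulus \<rho>" for \<beta> t
    by (rule qpoch_inf_nonzero[OF q], use that \<rho>(1) in \<open>simp add: norm_mult norm_divide param_annulus_def mult_ac\<close>)+
  \<comment> \<open>With A, x and H fixed, joint continuity in \<beta> and the angle over a compact
    interval makes the integral continuous in \<beta>.\<close>
  have cont: "continuous_on (param_annulus \<rho> \<times> cbox (- pi) pi) (\<lambda>(\<beta>, t). I \<beta> t)"
    unfolding I_def split_def theta_quot_def wgt_def qtheta_eq
    using nz[OF \<rho>(2)] nz[OF \<rho>(3)] nz[OF \<rho>(4)] nzA nzb \<rho>(1) H0 param_annulusD(1)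
    by (intro continuous_intros q) auto
  have contL: "continuous_on (param_annulus \<rho>) (\<lambda>\<beta>. integral (cbox (- pi) pi) (I \<beta>))"
    by (rule integral_continuous_on_param[OF cont])
  have contR: "continuous_on (param_annulus \<rho>) (wgt_integral q s A x H)"
  proof -
    have h: "continuous_on (param_annulus \<rho>) (\<lambda>\<beta>. phi21_reg q (A * x / \<beta>) (s * x) (s * A / \<beta>) (A / x * \<beta>))"
      using norm_param_less_one(1)[OF _ \<rho>(3)] param_annulusD(1)
      by (intro holomorphic_on_imp_continuous_on[OF holomorphic_on_phi21_reg[OF q U]] holomorphic_intros) auto
    have n: "qpoch_inf (M * \<beta>) q \<noteq> 0" "qpoch_inf (M / \<beta>) q \<noteq> 0" if "\<beta> \<in> param_annulus \<rho>" "norm M * \<rho> < 1" for M \<beta>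
      by (intro qpoch_inf_nonzero[OF q] norm_param_less_one that)+
    show ?thesis
      unfolding wgt_integral_def qtheta_eq
      using n[OF _ \<rho>(2)] n[OF _ \<rho>(3)] param_annulusD(1) H0 qpoch_inf_nonzero[OF q q]
      by (intro continuous_intros q h) auto
  qed
  have eq: "integral (cbox (- pi) pi) (I \<beta>) = wgt_integral q s A x H \<beta>" if "\<beta> \<in> param_annulus \<rho>" for \<beta>
  proof (rule continuous_on_eq_off_countable[OF U contL contR Bad _ that])
    fix \<beta> assume \<beta>: "\<beta> \<in> param_annulus \<rho>" "\<beta> \<notin> Bad"
    note b = param_annulusD(1)[OF \<beta>(1)]
    have "(I \<beta> has_integral wgt_integral q s A x H \<beta>) {- pi..pi}"
      unfolding I_def
    proof (rule integral_generic[OF \<beta>(1)])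
      show "\<beta> ^ 2 * q ^ j \<noteq> 1" for j
        using \<beta>(2) q0 by (auto simp: Bad_def field_simps)
      have "\<beta> ^ 2 \<noteq> q ^ j" for j using \<beta>(2) by (auto simp: Bad_def)
      thus "q ^ j \<noteq> \<beta> ^ 2" for j by metis
      show "(A * \<beta>) ^ 2 \<noteq> q" "(A / \<beta>) ^ 2 \<noteq> q"
        using \<beta>(2) q0 A0 b by (auto simp: Bad_def field_simps)
    qed
    thus "integral (cbox (- pi) pi) (I \<beta>) = wgt_integral q s A x H \<beta>" by (simp add: integral_unique)
  qed
  have "continuous_on (cbox (- pi) pi) (I \<beta>)"
  proof -
    have "continuous_on (cbox (- pi) pi) ((\<lambda>(\<beta>, t). I \<beta> t) \<circ> (\<lambda>t. (\<beta>, t)))"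
      by (intro continuous_on_compose continuous_intros continuous_on_subset[OF cont]) (use assms in auto)
    thus ?thesis by (simp add: o_def)
  qed
  hence "I \<beta> integrable_on cbox (- pi) pi" by (rule integrable_continuous)
  hence "(I \<beta> has_integral wgt_integral q s A x H \<beta>) (cbox (- pi) pi)"
    using eq[OF assms] by (metis integrable_integral)
  thus ?thesis by (simp add: I_def)
qed

end

section \<open>Translation into the parameters of the theorem\<close>

theorem theorem8p3:
  fixes q z a b h sq sa sz :: complex and \<sigma> :: real and w :: "real \<Rightarrow> complex"
  assumes nonzero: "q \<noteq> 0" "z \<noteq> 0" "a \<noteq> 0" "b \<noteq> 0" "h \<noteq> 0"
    and norms: "norm q < 1" "norm z < 1"
    and sqrts: "sq ^ 2 = q" "sa ^ 2 = a" "sz ^ 2 = z"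
    and sigma: "\<sigma> > 0"
    and w: "\<And>\<psi>. w \<psi> = exp (\<i> * of_real \<psi>)"
    and h_generic: "h / b * (sq * sa / sz) \<notin> {q powi k | k :: int. True}"
    and nonvanishing_rhs: "\<And>x. x \<in> {q, a, q * a / b ^ 2, b ^ 2 * z / q} \<Longrightarrow> qpoch_inf x q \<noteq> 0"
    and nonvanishing_series: "q * a / b \<notin> {1 / q ^ k | k :: nat. True}"
    and nonvanishing_integrand:
      "\<And>\<psi> x. \<psi> \<in> {-pi..pi} \<Longrightarrow>
        x \<in> set (times_list [b * (sz / (sq * sa)), 1 / b * (sq * sa / sz)] (of_real \<sigma> / w \<psi>) @
                 times_list [b * (sa * sz / sq), sa * sz, - (sa * sz), 1 / b * (sq * sa * sz),
                             - (sq * sa * sz)] (w \<psi> / of_real \<sigma>)) \<Longrightarrow>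
        qpoch_inf x q \<noteq> 0"
    and modulus_inner:
      "norm (of_real \<sigma> * b * (sz / (sq * sa))) < 1"
      "norm (of_real \<sigma> / b * (sq * sa / sz)) < 1"
    and modulus_outer:
      "\<And>\<gamma>. \<gamma> \<in> {b * (sa * sz / sq), sa * sz, - (sa * sz), 1 / b * (sq * sa * sz),
                  - (sq * sa * sz)} \<Longrightarrow> norm \<gamma> / \<sigma> < 1"
  shows
    "((\<lambda>\<psi>.
        qpochs_inf
          (times_list [h / b * (sq * sa / sz), q * b / h * (sz / (sq * sa))] (of_real \<sigma> / w \<psi>) @
           times_list [h / b * (sq * sa / sz), q * b / h * (sz / (sq * sa)), sq * sa * sz,
                       b * (sa * sz ^ 3 / sq), 1 / b * (sq * sa ^ 3 * sz)] (w \<psi> / of_real \<sigma>)) q /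
        qpochs_inf
          (times_list [b * (sz / (sq * sa)), 1 / b * (sq * sa / sz)] (of_real \<sigma> / w \<psi>) @
           times_list [b * (sa * sz / sq), sa * sz, - (sa * sz), 1 / b * (sq * sa * sz),
                       - (sq * sa * sz)] (w \<psi> / of_real \<sigma>)) q)
      has_integral
        (2 * of_real pi * qthetas [h, h * (q * a / (b ^ 2 * z))] q *
           qpochs_inf [z, q * a / b, q * a / b] q /
           qpochs_inf [q, a, q * a / b ^ 2, b ^ 2 * z / q] q *
         (phi21 a b (q * a / b) q z) ^ 2)) {-pi..pi}"
proof -
  define \<rho> where "\<rho> = 1 / \<sigma>"
  define \<beta> where "\<beta> = b * (sz / (sq * sa))"
  define A where "A = sa * sz"
  define x where "x = b / sq"
  define H where "H = h / \<beta>"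
  have nz: "sq \<noteq> 0" "sa \<noteq> 0" "sz \<noteq> 0" using nonzero sqrts by auto
  have \<beta>0: "\<beta> \<noteq> 0" and A0: "A \<noteq> 0" and x0: "x \<noteq> 0" and H0: "H \<noteq> 0"
    using nz nonzero by (auto simp: \<beta>_def A_def x_def H_def)
  have \<rho>0: "\<rho> > 0" using sigma by (simp add: \<rho>_def)
  have par: "b * (A / sq) = A * x" "1 / b * (sq * A) = A / x" "sq * sa * sz = sq * A"
    "1 / b * (sq * sa / sz) = 1 / \<beta>" "h / b * (sq * sa / sz) = H" "q * b / h * (sz / (sq * sa)) = q / H"
    "b * (sa * sz ^ 3 / sq) = \<beta> * A ^ 2" "1 / b * (sq * sa ^ 3 * sz) = A ^ 2 / \<beta>"
    "b * (sz / (sq * sa)) = \<beta>" "sa * sz = A"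
    using nz nonzero(4,5) by (simp_all add: \<beta>_def A_def x_def H_def power2_eq_square power3_eq_cube)
  have out: "norm (A * x) * \<rho> < 1" "norm (A / x) * \<rho> < 1" "norm A * \<rho> < 1"
    using modulus_outer[of "A * x"] modulus_outer[of "A / x"] modulus_outer[of A] unfolding par by (simp_all add: \<rho>_def)
  \<comment> \<open>The two inner modulus conditions say that \<beta> and 1 / \<beta> lie inside the
    circle |u| = 1 / \<sigma>.\<close>
  have ann: "\<beta> \<in> param_annulus \<rho>"
  proof -
    have "of_real \<sigma> * b * (sz / (sq * sa)) = of_real \<sigma> * \<beta>" "of_real \<sigma> / b * (sq * sa / sz) = of_real \<sigma> / \<beta>"
      using nz nonzero(4) by (simp_all add: \<beta>_def)
    hence "norm (of_real \<sigma> * \<beta>) < 1" "norm (of_real \<sigma> / \<beta>) < 1"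
      using modulus_inner by (simp_all only:)
    hence "\<sigma> * norm \<beta> < 1" "\<sigma> / norm \<beta> < 1"
      using sigma by (simp_all add: norm_mult norm_divide)
    thus ?thesis using sigma \<beta>0 by (simp add: param_annulus_def \<rho>_def field_simps)
  qed
  have arg: "A * x / \<beta> = a" "sq * x = b" "sq * A / \<beta> = q * a / b" "A / x * \<beta> = z" "A * x * \<beta> = b ^ 2 * z / q"
    "A / x / \<beta> = q * a / b ^ 2" "H * \<beta> = h" "H / \<beta> = h * (q * a / (b ^ 2 * z))"
    using nz nonzero(4,5) by (simp_all add: \<beta>_def A_def x_def H_def power2_eq_square mult_ac flip: sqrts)
  have nc: "qpoch_inf (q * a / b) q \<noteq> 0"
    using nonvanishing_series nonzero(1) by (auto simp: qpoch_inf_eq_0_iff[OF norms(1)] field_simps)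
  have rhs: "wgt_integral q sq A x H \<beta> = 2 * of_real pi * qthetas [h, h * (q * a / (b ^ 2 * z))] q *
           qpochs_inf [z, q * a / b, q * a / b] q /
           qpochs_inf [q, a, q * a / b ^ 2, b ^ 2 * z / q] q *
         (phi21 a b (q * a / b) q z) ^ 2"
  proof -
    have "qpoch_inf z q \<noteq> 0" by (rule qpoch_inf_nonzero[OF norms])
    thus ?thesis
      unfolding wgt_integral_def arg phi21_reg_eq[OF norms nc]
      by (simp add: qthetas_def qpochs_inf_def power2_eq_square mult_ac)
  qed
  have integrand: "qpochs_inf
          (times_list [H, q / H] (of_real \<sigma> / w \<psi>) @
           times_list [H, q / H, sq * A, \<beta> * A ^ 2, A ^ 2 / \<beta>] (w \<psi> / of_real \<sigma>)) q /
        qpochs_inf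
          (times_list [\<beta>, 1 / \<beta>] (of_real \<sigma> / w \<psi>) @
           times_list [A * x, A, - A, A / x, - (sq * A)] (w \<psi> / of_real \<sigma>)) q
      = theta_quot q H \<beta> (\<rho> * cis \<psi>) * wgt q sq A x \<beta> (\<rho> * cis \<psi>)" for \<psi>
  proof -
    define u where "u = \<rho> * cis \<psi>"
    have u: "w \<psi> / of_real \<sigma> = u" "of_real \<sigma> / w \<psi> = 1 / u"
      using sigma by (simp_all add: u_def \<rho>_def w cis_conv_exp)
    \<comment> \<open>The theta functions pair the entries crosswise: H / u with (q / H) u, and H u
      with (q / H) / u.\<close>
    have l: "times_list [H, q / H] (1 / u) @ times_list [H, q / H, sq * A, \<beta> * A ^ 2, A ^ 2 / \<beta>] u =
        [H / u, q / (H * u), H * u, q / (H / u), sq * A * u, \<beta> * A ^ 2 * u, A ^ 2 / \<beta> * u]"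
      "times_list [\<beta>, 1 / \<beta>] (1 / u) @ times_list [A * x, A, - A, A / x, - (sq * A)] u =
        [\<beta> / u, 1 / (\<beta> * u), A * x * u, A * u, - (A * u), A / x * u, - (sq * A * u)]"
      by (simp_all add: times_list_def)
    show ?thesis
      unfolding u u_def[symmetric] l theta_quot_def wgt_def qtheta_eq
      by (simp only: qpochs_inf_def list.map prod_list.Cons prod_list.Nil mult_1_left mult_1_right times_divide_times_eq mult_ac)
  qed
  show ?thesis
    unfolding par integrand rhs[symmetric]
    by (rule theta_quot_wgt_integral[OF norms(1) nonzero(1) sqrts(1) A0 x0 H0 \<rho>0 out ann])
qed

end
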